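(* Let $\mathcal{A}$ be an abelian category and $\mathcal{D}$ an additive category. Let $f^*\colon\mathcal{A}\to\mathcal{D}$ be a faithful functor, and assume there exist adjunctions $f_!\dashv f^*\dashv f_*\dashv f^{\times}$. (1) If $\nu\colon\mathcal{A}\to\mathcal{A}$ is a Nakayama functor relative to $f_!\dashv f^*$ satisfying $\nu\circ f_!=f_*$, then $\gamma_\nu:=\chi_{f_*}\circ f^*(\lambda_{f_!})$ induces an isomorphism of monads \[ \gamma_\nu\colon (f^*f_!,\ \alpha^{f_!\dashv f^*},\ f^*(\beta^{f_!\dashv f^*}_{f_!}))\xrightarrow{\cong}(f^{\times}f_*,\ \alpha^{f_*\dashv f^\times},\ f^\times(\beta^{f_*\dashv f^\times}_{f_*})) \] where $\lambda\colon 1_{\mathcal{A}}\to\nu^-\circ\nu$ is the unit of $\nu\dashv\nu^-$ and $\chi\colon f^*\circ\nu^-\xrightarrow{\cong}f^\times$ is the natural transformation which is conjugate to the identity $f_*=\nu\circ f_!$. (2) If $\gamma\colon (f^*f_!,\alpha^{f_!\dashv f^*},f^*(\beta^{f_!\dashv f^*}_{f_!}))\xrightarrow{\cong}(f^{\times}f_*,\alpha^{f_*\dashv f^\times},f^\times(\beta^{f_*\dashv f^\times}_{f_*}))$ is an isomorphism of monads, then there exists a Nakayama functor $\nu\colon\mathcal{A}\to\mathcal{A}$ relative to $f_!\dashv f^*$ satisfying $\nu\circ f_!=f_*$ and $\gamma_\nu=\gamma$. Furthermore, if $\nu'$ is another Nakayama functor relative to $f_!\dashv f^*$ satisfying $\nu'\circ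 f_!=f_*$ and $\gamma_{\nu'}=\gamma$, then there exists a unique isomorphism $\zeta\colon\nu\to\nu'$ with $\zeta_{f_!}=1_{f_*}$.
   Context: All categories are preadditive and all functors additive. For an adjunction $L\dashv R$, $\alpha^{L\dashv R}\colon 1\to RL$ is the unit and $\beta^{L\dashv R}\colon LR\to 1$ the counit. For a natural transformation $\eta$ and a functor $G$, $\eta_G$ denotes $\eta$ precomposed with $G$. A monad is written as a triple (endofunctor, unit, multiplication); the monads above are monads on $\mathcal{D}$. A morphism of monads $\delta\colon(T_1,\eta_1,\mu_1)\to(T_2,\eta_2,\mu_2)$ is a natural transformation $\delta\colon T_1\to T_2$ with $\eta_2=\delta\circ\eta_1$ and $\mu_2\circ\delta^2=\delta\circ\mu_1$, where $\delta^2=T_2(\delta)\circ\delta_{T_1}$. A Nakayama functor relative to $f_!\dashv f^*$ is a functor $\nu\colon\mathcal{A}\to\mathcal{A}$ with a right adjoint $\nu^-$ such that (1) $\nu\circ f_!$ is right adjoint to $f^*$; (2) the unit of $\nu\dashv\nu^-$ precomposed with $f_!$ is an isomorphism $f_!\to\nu^-\circ\nu\circ f_!$. Conjugate transformations: for adjunctions $L_1\dashv R_1$, $L_2\dashv R_2$ between categories $\mathcal{X}$ and $\mathcal{Y}$, with adjunction isomorphisms $\phi_i\colon\mathcal{Y}(L_i(X),Y)\to\mathcal{X}(X,R_i(Y))$, natural transformations $\sigma\colon L_1\to L_2$ and $\tau\colon R_2\to R_1$ are conjugate if $\phi_1(h\circ\sigma_X)=\tau_Y\circ\phi_2(h)$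 for all $h\colon L_2(X)\to Y$. For $\chi$ one uses the adjunction $f_*\dashv f^\times$ and the composite adjunction $\nu\circ f_!\dashv f^*\circ\nu^-$.
   Formalization: Equality ν∘f_! = f_* is taken up to a natural isomorphism θ (with γ_ν, ζ adjusted); literal equality in the existence part of (2), false in general, is proved exactly when f_!X = f_!Y implies f_*X = f_*Y and γ_X = γ_Y, a necessary condition. *)

theory Defs
  imports "HOL-Algebra.Group"
begin

section \<open>Preadditive, additive and abelian categories\<close>

text \<open>Objects and arrows are carrier sets, as in \<^theory>\<open>HOL-Algebra.Group\<close>; all operations are only
  meaningful on the carriers, and addition only on parallel arrows.\<close>

record ('o, 'a) cat =
  Obj :: "'o set"
  Arr :: "'a set"
  Dom :: "'a \<Rightarrow> 'o"
  Cod :: "'a \<Rightarrow> 'o"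
  Ident :: "'o \<Rightarrow> 'a"
  Comp :: "'a \<Rightarrow> 'a \<Rightarrow> 'a"  (infixl \<open>\<cdot>\<index>\<close> 70)
  Add :: "'a \<Rightarrow> 'a \<Rightarrow> 'a"
  Zer :: "'o \<Rightarrow> 'o \<Rightarrow> 'a"

definition hom_set :: "('o, 'a) cat \<Rightarrow> 'o \<Rightarrow> 'o \<Rightarrow> 'a set" where
  "hom_set C X Y = {f \<in> Arr C. Dom C f = X \<and> Cod C f = Y}"

definition hom_group :: "('o, 'a) cat \<Rightarrow> 'o \<Rightarrow> 'o \<Rightarrow> 'a monoid" where
  "hom_group C X Y = \<lparr>carrier = hom_set C X Y, mult = Add C, one = Zer C X Y\<rparr>"

locale preadditive_category =
  fixes C :: "('o, 'a) cat" (structure)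
  assumes dom_obj: "f \<in> Arr C \<Longrightarrow> Dom C f \<in> Obj C"
    and cod_obj: "f \<in> Arr C \<Longrightarrow> Cod C f \<in> Obj C"
    and ident_hom: "X \<in> Obj C \<Longrightarrow> Ident C X \<in> hom_set C X X"
    and comp_hom: "\<lbrakk>f \<in> hom_set C X Y; g \<in> hom_set C Y Z\<rbrakk> \<Longrightarrow> g \<cdot> f \<in> hom_set C X Z"
    and comp_assoc: "\<lbrakk>f \<in> hom_set C W X; g \<in> hom_set C X Y; h \<in> hom_set C Y Z\<rbrakk>
      \<Longrightarrow> (h \<cdot> g) \<cdot> f = h \<cdot> (g \<cdot> f)"
    and comp_ident_right: "f \<in> hom_set C X Y \<Longrightarrow> f \<cdot> Ident C X = f"
    and comp_ident_left: "f \<in> hom_set C X Y \<Longrightarrow> Ident C Y \<cdot> f = f"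
    and hom_comm_group: "\<lbrakk>X \<in> Obj C; Y \<in> Obj C\<rbrakk> \<Longrightarrow> comm_group (hom_group C X Y)"
    and comp_add_right: "\<lbrakk>f \<in> hom_set C X Y; f' \<in> hom_set C X Y; g \<in> hom_set C Y Z\<rbrakk>
      \<Longrightarrow> g \<cdot> Add C f f' = Add C (g \<cdot> f) (g \<cdot> f')"
    and comp_add_left: "\<lbrakk>f \<in> hom_set C X Y; g \<in> hom_set C Y Z; g' \<in> hom_set C Y Z\<rbrakk>
      \<Longrightarrow> Add C g g' \<cdot> f = Add C (g \<cdot> f) (g' \<cdot> f)"

definition zero_object :: "('o, 'a) cat \<Rightarrow> 'o \<Rightarrow> bool" where
  "zero_object C Z \<longleftrightarrow> Z \<in> Obj C \<and>
    (\<forall>X\<in>Obj C. (\<exists>!f. f \<in> hom_set C X Z) \<and> (\<exists>!f. f \<in> hom_set C Z X))"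

definition biproduct ::
  "('o, 'a) cat \<Rightarrow> 'o \<Rightarrow> 'o \<Rightarrow> 'o \<Rightarrow> 'a \<Rightarrow> 'a \<Rightarrow> 'a \<Rightarrow> 'a \<Rightarrow> bool" where
  "biproduct C X Y P i j p q \<longleftrightarrow>
    i \<in> hom_set C X P \<and> j \<in> hom_set C Y P \<and> p \<in> hom_set C P X \<and> q \<in> hom_set C P Y \<and>
    p \<cdot>\<^bsub>C\<^esub> i = Ident C X \<and> q \<cdot>\<^bsub>C\<^esub> j = Ident C Y \<and>
    p \<cdot>\<^bsub>C\<^esub> j = Zer C Y X \<and> q \<cdot>\<^bsub>C\<^esub> i = Zer C X Y \<and>
    Add C (i \<cdot>\<^bsub>C\<^esub> p) (j \<cdot>\<^bsub>C\<^esub> q) = Ident C P"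

locale additive_category = preadditive_category +
  assumes ex_zero_object: "\<exists>Z. zero_object C Z"
    and ex_biproduct: "\<lbrakk>X \<in> Obj C; Y \<in> Obj C\<rbrakk>
      \<Longrightarrow> \<exists>P\<in>Obj C. \<exists>i j p q. biproduct C X Y P i j p q"

definition mono_arrow :: "('o, 'a) cat \<Rightarrow> 'a \<Rightarrow> bool" where
  "mono_arrow C f \<longleftrightarrow> f \<in> Arr C \<and>
    (\<forall>W\<in>Obj C. \<forall>g\<in>hom_set C W (Dom C f). \<forall>h\<in>hom_set C W (Dom C f).
      f \<cdot>\<^bsub>C\<^esub> g = f \<cdot>\<^bsub>C\<^esub> h \<longrightarrow> g = h)"

definition epi_arrow :: "('o, 'a) cat \<Rightarrow> 'a \<Rightarrow> bool" where
  "epi_arrow C f \<longleftrightarrow> f \<in> Arr C \<and>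
    (\<forall>W\<in>Obj C. \<forall>g\<in>hom_set C (Cod C f) W. \<forall>h\<in>hom_set C (Cod C f) W.
      g \<cdot>\<^bsub>C\<^esub> f = h \<cdot>\<^bsub>C\<^esub> f \<longrightarrow> g = h)"

definition kernel_of :: "('o, 'a) cat \<Rightarrow> 'a \<Rightarrow> 'a \<Rightarrow> bool" where
  "kernel_of C k f \<longleftrightarrow> k \<in> Arr C \<and> f \<in> Arr C \<and> Cod C k = Dom C f \<and>
    f \<cdot>\<^bsub>C\<^esub> k = Zer C (Dom C k) (Cod C f) \<and>
    (\<forall>W\<in>Obj C. \<forall>g\<in>hom_set C W (Dom C f). f \<cdot>\<^bsub>C\<^esub> g = Zer C W (Cod C f) \<longrightarrow>
      (\<exists>!u. u \<in> hom_set C W (Dom C k) \<and> k \<cdot>\<^bsub>C\<^esub> u = g))"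

definition cokernel_of :: "('o, 'a) cat \<Rightarrow> 'a \<Rightarrow> 'a \<Rightarrow> bool" where
  "cokernel_of C c f \<longleftrightarrow> c \<in> Arr C \<and> f \<in> Arr C \<and> Dom C c = Cod C f \<and>
    c \<cdot>\<^bsub>C\<^esub> f = Zer C (Dom C f) (Cod C c) \<and>
    (\<forall>W\<in>Obj C. \<forall>g\<in>hom_set C (Cod C f) W. g \<cdot>\<^bsub>C\<^esub> f = Zer C (Dom C f) W \<longrightarrow>
      (\<exists>!u. u \<in> hom_set C (Cod C c) W \<and> u \<cdot>\<^bsub>C\<^esub> c = g))"

locale abelian_category = additive_category +
  assumes ex_kernel: "f \<in> Arr C \<Longrightarrow> \<exists>k. kernel_of C k f"
    and ex_cokernel: "f \<in> Arr C \<Longrightarrow> \<exists>c. cokernel_of C c f"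
    and mono_is_kernel: "mono_arrow C m \<Longrightarrow> \<exists>f. kernel_of C m f"
    and epi_is_cokernel: "epi_arrow C e \<Longrightarrow> \<exists>f. cokernel_of C e f"

definition inverse_arrows :: "('o, 'a) cat \<Rightarrow> 'a \<Rightarrow> 'a \<Rightarrow> bool" where
  "inverse_arrows C f g \<longleftrightarrow> f \<in> Arr C \<and> g \<in> hom_set C (Cod C f) (Dom C f) \<and>
    g \<cdot>\<^bsub>C\<^esub> f = Ident C (Dom C f) \<and> f \<cdot>\<^bsub>C\<^esub> g = Ident C (Cod C f)"

definition iso_arrow :: "('o, 'a) cat \<Rightarrow> 'a \<Rightarrow> bool" where
  "iso_arrow C f \<longleftrightarrow> (\<exists>g. inverse_arrows C f g)"

definition inv_arrow :: "('o, 'a) cat \<Rightarrow> 'a \<Rightarrow> 'a" where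
  "inv_arrow C f = (THE g. inverse_arrows C f g)"


section \<open>Additive functors and natural transformations\<close>

record ('o, 'a, 'p, 'b) func =
  fo :: "'o \<Rightarrow> 'p"
  fa :: "'a \<Rightarrow> 'b"

locale additive_functor = C: preadditive_category C + D: preadditive_category D
  for C :: "('o, 'a) cat" and D :: "('p, 'b) cat" +
  fixes F :: "('o, 'a, 'p, 'b) func"
  assumes fo_obj: "X \<in> Obj C \<Longrightarrow> fo F X \<in> Obj D"
    and fa_hom: "f \<in> hom_set C X Y \<Longrightarrow> fa F f \<in> hom_set D (fo F X) (fo F Y)"
    and fa_ident: "X \<in> Obj C \<Longrightarrow> fa F (Ident C X) = Ident D (fo F X)"
    and fa_comp: "\<lbrakk>f \<in> hom_set C X Y; g \<in> hom_set C Y Z\<rbrakk>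
      \<Longrightarrow> fa F (g \<cdot>\<^bsub>C\<^esub> f) = fa F g \<cdot>\<^bsub>D\<^esub> fa F f"
    and fa_add: "\<lbrakk>f \<in> hom_set C X Y; g \<in> hom_set C X Y\<rbrakk>
      \<Longrightarrow> fa F (Add C f g) = Add D (fa F f) (fa F g)"

definition id_func :: "('o, 'a, 'o, 'a) func" where
  "id_func = \<lparr>fo = \<lambda>X. X, fa = \<lambda>f. f\<rparr>"

definition comp_func ::
  "('p, 'b, 'q, 'c) func \<Rightarrow> ('o, 'a, 'p, 'b) func \<Rightarrow> ('o, 'a, 'q, 'c) func"
  (infixl \<open>\<odot>\<close> 70) where
  "G \<odot> F = \<lparr>fo = \<lambda>X. fo G (fo F X), fa = \<lambda>f. fa G (fa F f)\<rparr>"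

text \<open>Equality of functors defined on \<open>C\<close>; values off the carriers are disregarded.\<close>

definition func_eq ::
  "('o, 'a) cat \<Rightarrow> ('o, 'a, 'p, 'b) func \<Rightarrow> ('o, 'a, 'p, 'b) func \<Rightarrow> bool" where
  "func_eq C F G \<longleftrightarrow> (\<forall>X\<in>Obj C. fo F X = fo G X) \<and> (\<forall>f\<in>Arr C. fa F f = fa G f)"

definition faithful :: "('o, 'a) cat \<Rightarrow> ('o, 'a, 'p, 'b) func \<Rightarrow> bool" where
  "faithful C F \<longleftrightarrow> (\<forall>X\<in>Obj C. \<forall>Y\<in>Obj C. inj_on (fa F) (hom_set C X Y))"

definition nat_trans :: "('o, 'a) cat \<Rightarrow> ('p, 'b) cat \<Rightarrow>
    ('o, 'a, 'p, 'b) func \<Rightarrow> ('o, 'a, 'p, 'b) func \<Rightarrow> ('o \<Rightarrow> 'b) \<Rightarrow> bool" where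
  "nat_trans C D F G \<eta> \<longleftrightarrow> additive_functor C D F \<and> additive_functor C D G \<and>
    (\<forall>X\<in>Obj C. \<eta> X \<in> hom_set D (fo F X) (fo G X)) \<and>
    (\<forall>X\<in>Obj C. \<forall>Y\<in>Obj C. \<forall>f\<in>hom_set C X Y. fa G f \<cdot>\<^bsub>D\<^esub> \<eta> X = \<eta> Y \<cdot>\<^bsub>D\<^esub> fa F f)"

definition nat_iso :: "('o, 'a) cat \<Rightarrow> ('p, 'b) cat \<Rightarrow>
    ('o, 'a, 'p, 'b) func \<Rightarrow> ('o, 'a, 'p, 'b) func \<Rightarrow> ('o \<Rightarrow> 'b) \<Rightarrow> bool" where
  "nat_iso C D F G \<eta> \<longleftrightarrow> nat_trans C D F G \<eta> \<and> (\<forall>X\<in>Obj C. iso_arrow D (\<eta> X))"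

definition id_trans :: "('p, 'b) cat \<Rightarrow> ('o, 'a, 'p, 'b) func \<Rightarrow> 'o \<Rightarrow> 'b" where
  "id_trans D F = (\<lambda>X. Ident D (fo F X))"

text \<open>Equality of natural transformations between functors defined on \<open>C\<close>.\<close>

definition trans_eq :: "('o, 'a) cat \<Rightarrow> ('o \<Rightarrow> 'b) \<Rightarrow> ('o \<Rightarrow> 'b) \<Rightarrow> bool" where
  "trans_eq C \<eta> \<eta>' \<longleftrightarrow> (\<forall>X\<in>Obj C. \<eta> X = \<eta>' X)"


section \<open>Adjunctions and conjugate transformations\<close>

text \<open>\<open>adjunction C D L R \<alpha> \<beta>\<close>: the functor \<open>L\<close> from \<open>C\<close> to \<open>D\<close> is left adjoint to \<open>R\<close>,
  with unit \<open>\<alpha>\<close> and counit \<open>\<beta>\<close>.\<close>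

definition adjunction :: "('o, 'a) cat \<Rightarrow> ('p, 'b) cat \<Rightarrow>
    ('o, 'a, 'p, 'b) func \<Rightarrow> ('p, 'b, 'o, 'a) func \<Rightarrow> ('o \<Rightarrow> 'a) \<Rightarrow> ('p \<Rightarrow> 'b) \<Rightarrow> bool" where
  "adjunction C D L R \<alpha> \<beta> \<longleftrightarrow>
    additive_functor C D L \<and> additive_functor D C R \<and>
    nat_trans C C id_func (R \<odot> L) \<alpha> \<and> nat_trans D D (L \<odot> R) id_func \<beta> \<and>
    (\<forall>X\<in>Obj C. \<beta> (fo L X) \<cdot>\<^bsub>D\<^esub> fa L (\<alpha> X) = Ident D (fo L X)) \<and>
    (\<forall>Y\<in>Obj D. fa R (\<beta> Y) \<cdot>\<^bsub>C\<^esub> \<alpha> (fo R Y) = Ident C (fo R Y))"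

text \<open>The adjunction isomorphism from \<open>D(L X, Y)\<close> to \<open>C(X, R Y)\<close>.\<close>

definition adj_iso ::
  "('o, 'a) cat \<Rightarrow> ('p, 'b, 'o, 'a) func \<Rightarrow> ('o \<Rightarrow> 'a) \<Rightarrow> 'o \<Rightarrow> 'b \<Rightarrow> 'a" where
  "adj_iso C R \<alpha> X h = fa R h \<cdot>\<^bsub>C\<^esub> \<alpha> X"

text \<open>Unit of the composite \<open>L' L \<stileturn> R R'\<close> of \<open>L \<stileturn> R\<close> (unit \<open>\<alpha>\<close>) and \<open>L' \<stileturn> R'\<close> (unit \<open>\<alpha>'\<close>).\<close>

definition comp_unit :: "('o, 'a) cat \<Rightarrow> ('o, 'a, 'p, 'b) func \<Rightarrow> ('p, 'b, 'o, 'a) func \<Rightarrow>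
    ('o \<Rightarrow> 'a) \<Rightarrow> ('p \<Rightarrow> 'b) \<Rightarrow> 'o \<Rightarrow> 'a" where
  "comp_unit C L R \<alpha> \<alpha>' = (\<lambda>X. fa R (\<alpha>' (fo L X)) \<cdot>\<^bsub>C\<^esub> \<alpha> X)"

text \<open>\<open>\<alpha>1\<close> and \<open>\<alpha>2\<close> are the units of \<open>L1 \<stileturn> R1\<close> and \<open>L2 \<stileturn> R2\<close>, where \<open>L1\<close>, \<open>L2\<close> go
  from \<open>C\<close> to \<open>D\<close>.\<close>

definition conjugate :: "('o, 'a) cat \<Rightarrow> ('p, 'b) cat \<Rightarrow>
    ('o, 'a, 'p, 'b) func \<Rightarrow> ('p, 'b, 'o, 'a) func \<Rightarrow> ('o \<Rightarrow> 'a) \<Rightarrow>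
    ('o, 'a, 'p, 'b) func \<Rightarrow> ('p, 'b, 'o, 'a) func \<Rightarrow> ('o \<Rightarrow> 'a) \<Rightarrow>
    ('o \<Rightarrow> 'b) \<Rightarrow> ('p \<Rightarrow> 'a) \<Rightarrow> bool" where
  "conjugate C D L1 R1 \<alpha>1 L2 R2 \<alpha>2 \<sigma> \<tau> \<longleftrightarrow>
    nat_trans C D L1 L2 \<sigma> \<and> nat_trans D C R2 R1 \<tau> \<and>
    (\<forall>X\<in>Obj C. \<forall>Y\<in>Obj D. \<forall>h\<in>hom_set D (fo L2 X) Y.
      adj_iso C R1 \<alpha>1 X (h \<cdot>\<^bsub>D\<^esub> \<sigma> X) = \<tau> Y \<cdot>\<^bsub>C\<^esub> adj_iso C R2 \<alpha>2 X h)"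


section \<open>Monads\<close>

definition monad :: "('o, 'a) cat \<Rightarrow> ('o, 'a, 'o, 'a) func \<Rightarrow> ('o \<Rightarrow> 'a) \<Rightarrow> ('o \<Rightarrow> 'a) \<Rightarrow> bool" where
  "monad D T \<eta> \<mu> \<longleftrightarrow> nat_trans D D id_func T \<eta> \<and> nat_trans D D (T \<odot> T) T \<mu> \<and>
    (\<forall>X\<in>Obj D. \<mu> X \<cdot>\<^bsub>D\<^esub> fa T (\<mu> X) = \<mu> X \<cdot>\<^bsub>D\<^esub> \<mu> (fo T X)) \<and>
    (\<forall>X\<in>Obj D. \<mu> X \<cdot>\<^bsub>D\<^esub> fa T (\<eta> X) = Ident D (fo T X)) \<and>
    (\<forall>X\<in>Obj D. \<mu> X \<cdot>\<^bsub>D\<^esub> \<eta> (fo T X) = Ident D (fo T X))"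

definition monad_morphism :: "('o, 'a) cat \<Rightarrow>
    ('o, 'a, 'o, 'a) func \<Rightarrow> ('o \<Rightarrow> 'a) \<Rightarrow> ('o \<Rightarrow> 'a) \<Rightarrow>
    ('o, 'a, 'o, 'a) func \<Rightarrow> ('o \<Rightarrow> 'a) \<Rightarrow> ('o \<Rightarrow> 'a) \<Rightarrow> ('o \<Rightarrow> 'a) \<Rightarrow> bool" where
  "monad_morphism D T1 \<eta>1 \<mu>1 T2 \<eta>2 \<mu>2 \<delta> \<longleftrightarrow>
    monad D T1 \<eta>1 \<mu>1 \<and> monad D T2 \<eta>2 \<mu>2 \<and> nat_trans D D T1 T2 \<delta> \<and>
    (\<forall>X\<in>Obj D. \<eta>2 X = \<delta> X \<cdot>\<^bsub>D\<^esub> \<eta>1 X) \<and>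
    (\<forall>X\<in>Obj D. \<mu>2 X \<cdot>\<^bsub>D\<^esub> (fa T2 (\<delta> X) \<cdot>\<^bsub>D\<^esub> \<delta> (fo T1 X)) = \<delta> X \<cdot>\<^bsub>D\<^esub> \<mu>1 X)"

definition monad_iso :: "('o, 'a) cat \<Rightarrow>
    ('o, 'a, 'o, 'a) func \<Rightarrow> ('o \<Rightarrow> 'a) \<Rightarrow> ('o \<Rightarrow> 'a) \<Rightarrow>
    ('o, 'a, 'o, 'a) func \<Rightarrow> ('o \<Rightarrow> 'a) \<Rightarrow> ('o \<Rightarrow> 'a) \<Rightarrow> ('o \<Rightarrow> 'a) \<Rightarrow> bool" where
  "monad_iso D T1 \<eta>1 \<mu>1 T2 \<eta>2 \<mu>2 \<delta> \<longleftrightarrow> monad_morphism D T1 \<eta>1 \<mu>1 T2 \<eta>2 \<mu>2 \<delta> \<and>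
    (\<exists>\<delta>'. monad_morphism D T2 \<eta>2 \<mu>2 T1 \<eta>1 \<mu>1 \<delta>' \<and>
      (\<forall>X\<in>Obj D. \<delta>' X \<cdot>\<^bsub>D\<^esub> \<delta> X = Ident D (fo T1 X) \<and> \<delta> X \<cdot>\<^bsub>D\<^esub> \<delta>' X = Ident D (fo T2 X)))"


section \<open>Nakayama functors\<close>

text \<open>The functors \<open>f\<^sub>!\<close>, \<open>f\<^sup>*\<close>, \<open>f\<^sub>*\<close>, \<open>f\<^sup>\<times>\<close> are written \<open>f_sh\<close>, \<open>f_up\<close>, \<open>f_st\<close>, \<open>f_x\<close>.\<close>

text \<open>\<open>nakayama A D f_sh f_up \<nu> \<nu>m l e\<close>: \<open>\<nu>\<close> is a Nakayama functor relative to \<open>f\<^sub>! \<stileturn> f\<^sup>*\<close>,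
  together with a chosen right adjoint \<open>\<nu>m\<close>, unit \<open>l\<close> and counit \<open>e\<close> of \<open>\<nu> \<stileturn> \<nu>m\<close>.\<close>

definition nakayama :: "('o, 'a) cat \<Rightarrow> ('p, 'b) cat \<Rightarrow>
    ('p, 'b, 'o, 'a) func \<Rightarrow> ('o, 'a, 'p, 'b) func \<Rightarrow>
    ('o, 'a, 'o, 'a) func \<Rightarrow> ('o, 'a, 'o, 'a) func \<Rightarrow> ('o \<Rightarrow> 'a) \<Rightarrow> ('o \<Rightarrow> 'a) \<Rightarrow> bool" where
  "nakayama A D f_sh f_up \<nu> \<nu>m l e \<longleftrightarrow>
    adjunction A A \<nu> \<nu>m l e \<and>
    (\<exists>a b. adjunction A D f_up (\<nu> \<odot> f_sh) a b) \<and>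
    nat_iso D A f_sh (\<nu>m \<odot> (\<nu> \<odot> f_sh)) (\<lambda>X. l (fo f_sh X))"

text \<open>
  The identity \<open>\<nu> f\<^sub>! = f\<^sub>*\<close> is recorded by a natural isomorphism \<open>\<theta>\<close> from \<open>\<nu> f\<^sub>!\<close> to \<open>f\<^sub>*\<close>; for a literal
  equality of functors, \<open>\<theta>\<close> is the identity transformation of \<open>f\<^sub>*\<close>. A literal equality of functors
  cannot be achieved in general: it forces \<open>f\<^sub>* X = f\<^sub>* Y\<close> whenever \<open>f\<^sub>! X = f\<^sub>! Y\<close>, and this depends
  on the choice of the adjoints within their isomorphism classes.
\<close>

text \<open>The conjugate \<open>\<chi>\<close> from \<open>f\<^sup>* \<nu>m\<close> to \<open>f\<^sup>\<times>\<close> of \<open>\<theta>\<^sup>-\<^sup>1\<close>, which goes from \<open>f\<^sub>*\<close> to \<open>\<nu> f\<^sub>!\<close>, with respect to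
  \<open>f\<^sub>* \<stileturn> f\<^sup>\<times>\<close> and \<open>\<nu> f\<^sub>! \<stileturn> f\<^sup>* \<nu>m\<close>.\<close>

definition chi_conjugate :: "('o, 'a) cat \<Rightarrow> ('p, 'b) cat \<Rightarrow>
    ('p, 'b, 'o, 'a) func \<Rightarrow> ('o, 'a, 'p, 'b) func \<Rightarrow> ('p \<Rightarrow> 'b) \<Rightarrow>
    ('p, 'b, 'o, 'a) func \<Rightarrow> ('o, 'a, 'p, 'b) func \<Rightarrow> ('p \<Rightarrow> 'b) \<Rightarrow>
    ('o, 'a, 'o, 'a) func \<Rightarrow> ('o, 'a, 'o, 'a) func \<Rightarrow> ('o \<Rightarrow> 'a) \<Rightarrow> ('p \<Rightarrow> 'a) \<Rightarrow>
    ('o \<Rightarrow> 'b) \<Rightarrow> bool" where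
  "chi_conjugate A D f_sh f_up \<alpha>1 f_st f_x \<alpha>3 \<nu> \<nu>m l \<theta> \<chi> \<longleftrightarrow>
    conjugate D A f_st f_x \<alpha>3 (\<nu> \<odot> f_sh) (f_up \<odot> \<nu>m) (comp_unit D f_sh f_up \<alpha>1 l)
      (\<lambda>X. inv_arrow A (\<theta> X)) \<chi>"

definition chi :: "('o, 'a) cat \<Rightarrow> ('p, 'b) cat \<Rightarrow>
    ('p, 'b, 'o, 'a) func \<Rightarrow> ('o, 'a, 'p, 'b) func \<Rightarrow> ('p \<Rightarrow> 'b) \<Rightarrow>
    ('p, 'b, 'o, 'a) func \<Rightarrow> ('o, 'a, 'p, 'b) func \<Rightarrow> ('p \<Rightarrow> 'b) \<Rightarrow>
    ('o, 'a, 'o, 'a) func \<Rightarrow> ('o, 'a, 'o, 'a) func \<Rightarrow> ('o \<Rightarrow> 'a) \<Rightarrow> ('p \<Rightarrow> 'a) \<Rightarrow>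
    'o \<Rightarrow> 'b" where
  "chi A D f_sh f_up \<alpha>1 f_st f_x \<alpha>3 \<nu> \<nu>m l \<theta> =
    (THE \<chi>. \<chi> \<in> extensional (Obj A) \<and> chi_conjugate A D f_sh f_up \<alpha>1 f_st f_x \<alpha>3 \<nu> \<nu>m l \<theta> \<chi>)"

text \<open>The transformation \<open>\<gamma>\<^sub>\<nu>\<close> from \<open>f\<^sup>* f\<^sub>!\<close> to \<open>f\<^sup>\<times> f\<^sub>*\<close>; the factor \<open>\<nu>m \<theta>\<close> identifies \<open>\<nu>m \<nu> f\<^sub>!\<close> with \<open>\<nu>m f\<^sub>*\<close>.\<close>

definition gamma_nu :: "('o, 'a) cat \<Rightarrow> ('p, 'b) cat \<Rightarrow>
    ('p, 'b, 'o, 'a) func \<Rightarrow> ('o, 'a, 'p, 'b) func \<Rightarrow> ('p \<Rightarrow> 'b) \<Rightarrow>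
    ('p, 'b, 'o, 'a) func \<Rightarrow> ('o, 'a, 'p, 'b) func \<Rightarrow> ('p \<Rightarrow> 'b) \<Rightarrow>
    ('o, 'a, 'o, 'a) func \<Rightarrow> ('o, 'a, 'o, 'a) func \<Rightarrow> ('o \<Rightarrow> 'a) \<Rightarrow> ('p \<Rightarrow> 'a) \<Rightarrow>
    'p \<Rightarrow> 'b" where
  "gamma_nu A D f_sh f_up \<alpha>1 f_st f_x \<alpha>3 \<nu> \<nu>m l \<theta> =
    (\<lambda>X. chi A D f_sh f_up \<alpha>1 f_st f_x \<alpha>3 \<nu> \<nu>m l \<theta> (fo f_st X) \<cdot>\<^bsub>D\<^esub>
      fa f_up (fa \<nu>m (\<theta> X) \<cdot>\<^bsub>A\<^esub> l (fo f_sh X)))"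

text \<open>For a literal equality \<open>\<nu> f\<^sub>! = f\<^sub>*\<close>, the identity is an admissible \<open>\<theta>\<close>, is its own inverse,
  and \<open>\<gamma>\<^sub>\<nu>\<close> is \<open>\<chi>\<close> at \<open>f\<^sub>*\<close> composed with \<open>f\<^sup>*\<close> of \<open>l\<close> at \<open>f\<^sub>!\<close>.\<close>

lemma (in preadditive_category) inv_arrow_ident:
  assumes "X \<in> Obj C" shows "inv_arrow C (Ident C X) = Ident C X"
proof -
  have i: "Ident C X \<in> hom_set C X X" using assms by (rule ident_hom)
  hence dc: "Dom C (Ident C X) = X" "Cod C (Ident C X) = X" "Ident C X \<in> Arr C"
    by (auto simp: hom_set_def)
  show ?thesis unfolding inv_arrow_def
  proof (rule the_equality)
    show "inverse_arrows C (Ident C X) (Ident C X)"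
      using i dc comp_ident_left[OF i] by (simp add: inverse_arrows_def)
    show "g = Ident C X" if "inverse_arrows C (Ident C X) g" for g
      using that dc comp_ident_left[of g X X] by (simp add: inverse_arrows_def)
  qed
qed

lemma id_trans_nat_iso:
  assumes "additive_functor D A F" "additive_functor D A G" "func_eq D F G"
  shows "nat_iso D A F G (id_trans A G)"
proof -
  interpret F: additive_functor D A F by fact
  interpret G: additive_functor D A G by fact
  have eo: "\<And>X. X \<in> Obj D \<Longrightarrow> fo F X = fo G X"
    and ea: "\<And>f X Y. f \<in> hom_set D X Y \<Longrightarrow> fa F f = fa G f"
    using assms(3) by (auto simp: func_eq_def hom_set_def)
  have i: "Ident A (fo G X) \<in> hom_set A (fo G X) (fo G X)" if "X \<in> Obj D" for X
    using that by (intro F.D.ident_hom G.fo_obj)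
  have iso: "iso_arrow A (Ident A (fo G X))" if "X \<in> Obj D" for X
    using i[OF that] F.D.comp_ident_left[OF i[OF that]]
    unfolding iso_arrow_def inverse_arrows_def by (auto simp: hom_set_def)
  have nat: "fa G f \<cdot>\<^bsub>A\<^esub> Ident A (fo G X) = Ident A (fo G Y) \<cdot>\<^bsub>A\<^esub> fa F f"
    if "f \<in> hom_set D X Y" for f X Y
    using F.D.comp_ident_left[OF G.fa_hom[OF that]] F.D.comp_ident_right[OF G.fa_hom[OF that]]
    by (simp add: ea[OF that])
  show ?thesis
    using assms(1,2) eo i iso nat by (simp add: nat_iso_def nat_trans_def id_trans_def)
qed

lemma gamma_nu_strict:
  assumes "nakayama A D f_sh f_up \<nu> \<nu>m l e" "func_eq D (\<nu> \<odot> f_sh) f_st" "X \<in> Obj D"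
  shows "gamma_nu A D f_sh f_up \<alpha>1 f_st f_x \<alpha>3 \<nu> \<nu>m l (id_trans A f_st) X =
    chi A D f_sh f_up \<alpha>1 f_st f_x \<alpha>3 \<nu> \<nu>m l (id_trans A f_st) (fo f_st X) \<cdot>\<^bsub>D\<^esub> fa f_up (l (fo f_sh X))"
proof -
  have adj: "adjunction A A \<nu> \<nu>m l e" and iso: "nat_iso D A f_sh (\<nu>m \<odot> (\<nu> \<odot> f_sh)) (\<lambda>X. l (fo f_sh X))"
    using assms(1) by (auto simp: nakayama_def)
  interpret N: additive_functor A A \<nu> using adj by (simp add: adjunction_def)
  interpret M: additive_functor A A \<nu>m using adj by (simp add: adjunction_def)
  have f_sh: "additive_functor D A f_sh" using iso by (simp add: nat_iso_def nat_trans_def)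
  interpret S: additive_functor D A f_sh by (rule f_sh)
  have eq: "fo \<nu> (fo f_sh X) = fo f_st X"
    using assms(2,3) by (simp add: func_eq_def comp_func_def)
  hence ob: "fo f_st X \<in> Obj A" using N.fo_obj[OF S.fo_obj[OF assms(3)]] by simp
  have "l (fo f_sh X) \<in> hom_set A (fo f_sh X) (fo \<nu>m (fo \<nu> (fo f_sh X)))"
    using iso assms(3) by (simp add: nat_iso_def nat_trans_def comp_func_def)
  hence "l (fo f_sh X) \<in> hom_set A (fo f_sh X) (fo \<nu>m (fo f_st X))" by (simp only: eq)
  from N.C.comp_ident_left[OF this] show ?thesis
    by (simp add: gamma_nu_def id_trans_def M.fa_ident[OF ob])
qed

end

theory Submission
  imports Defs
begin

text \<open>
  Write \<open>S \<stileturn> U \<stileturn> T \<stileturn> R\<close> for the four functors \<open>f_sh\<close>, \<open>f_up\<close>, \<open>f_st\<close>, \<open>f_x\<close>. By transposition,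
  a family of arrows \<open>\<gamma> X\<close> from \<open>U (S X)\<close> to \<open>R (T X)\<close> translates an arrow \<open>h\<close> from \<open>S X\<close> to \<open>S Y\<close> into an arrow
  \<open>kl \<gamma> X Y h\<close> from \<open>T X\<close> to \<open>T Y\<close>. The family \<open>\<gamma>\<close> is a morphism of monads precisely when this translation
  respects composition and sends \<open>S f\<close> to \<open>T f\<close>; this is the usual correspondence between monad
  morphisms and functors of Kleisli categories. So the theorem compares such translations with
  functors \<open>\<nu>\<close> on \<open>A\<close>.

  If \<open>\<nu>\<close> has a right adjoint and \<open>\<theta>\<close> identifies \<open>\<nu> S\<close> with \<open>T\<close>, then the translation along \<open>\<gamma>\<^sub>\<nu>\<close> is \<open>h \<mapsto> \<nu> h\<close>, up
  to \<open>\<theta>\<close> (\<open>kl_the_gamma\<close>). Hence \<open>\<gamma>\<^sub>\<nu>\<close> is a morphism of monads, and it is invertible as soon as the unit of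
  \<open>\<nu> \<stileturn> \<nu>m\<close> is invertible on the objects \<open>S X\<close>.

  Conversely, \<open>U\<close> is faithful and \<open>A\<close> is abelian, so every object \<open>M\<close> of \<open>A\<close> is the coequalizer of two
  arrows from \<open>S (U (S (U M)))\<close> to \<open>S (U M)\<close>, naturally in \<open>M\<close> (\<open>counit_coequalizer\<close>). A functor that
  preserves coequalizers, such as a left adjoint, is therefore determined by its action on the arrows
  between objects \<open>S X\<close>. This gives the uniqueness of \<open>\<nu>\<close> (\<open>extended_functor_unique\<close>), and it forces the
  construction: \<open>\<nu> M\<close> is the coequalizer of the two translated arrows. For \<open>M = S X\<close> this coequalizer is
  split, with value \<open>T X\<close>, so that \<open>\<nu> S\<close> is isomorphic to \<open>T\<close>, and equal to \<open>T\<close> if \<open>T X\<close> can be chosen as the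
  coequalizer.

  It remains to find a right adjoint of this \<open>\<nu>\<close>. Transposing along \<open>T \<stileturn> R\<close>, an arrow from \<open>\<nu> M\<close> to \<open>N\<close> is a
  homomorphism from \<open>U M\<close> to \<open>R N\<close> of algebras over the monad \<open>U S\<close>, where \<open>R N\<close> is an algebra over \<open>R T\<close>,
  restricted along \<open>\<gamma>\<close> (\<open>transpose_fork_iff\<close>). Now \<open>U\<close> is monadic: it is faithful, and it preserves
  coequalizers since \<open>T\<close> is right adjoint to it. So the algebra \<open>R N\<close> is \<open>U\<close> of an object \<open>\<nu>m N\<close>, and the
  homomorphisms are the arrows from \<open>M\<close> to \<open>\<nu>m N\<close>. Under these identifications \<open>U\<close> sends the unit at \<open>S X\<close> to
  \<open>\<gamma> X\<close>, which is where the invertibility of \<open>\<gamma>\<close> enters.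
\<close>

section \<open>Preadditive categories and additive functors\<close>

lemma in_hom_set [simp]:
  "f \<in> hom_set C X Y \<longleftrightarrow> f \<in> Arr C \<and> Dom C f = X \<and> Cod C f = Y"
  by (auto simp: hom_set_def)

lemma id_func_simps [simp]: "fo id_func X = X" "fa id_func f = f"
  by (simp_all add: id_func_def)

lemma comp_func_simps [simp]:
  "fo (G \<odot> F) X = fo G (fo F X)" "fa (G \<odot> F) f = fa G (fa F f)"
  by (simp_all add: comp_func_def)

context preadditive_category
begin

lemma comp_simps [simp]:
  assumes "f \<in> Arr C" "g \<in> Arr C" "Dom C g = Cod C f"
  shows "g \<cdot> f \<in> Arr C" "Dom C (g \<cdot> f) = Dom C f" "Cod C (g \<cdot> f) = Cod C g"
  using comp_hom[of f "Dom C f" "Cod C f" g "Cod C g"] assms by simp_all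

lemma ident_simps [simp]:
  assumes "X \<in> Obj C"
  shows "Ident C X \<in> Arr C" "Dom C (Ident C X) = X" "Cod C (Ident C X) = X"
  using ident_hom[OF assms] by simp_all

lemmas obj_simps [simp] = dom_obj cod_obj

lemma comp_assoc_simp [simp]:
  assumes "f \<in> Arr C" "g \<in> Arr C" "h \<in> Arr C" "Dom C g = Cod C f" "Dom C h = Cod C g"
  shows "(h \<cdot> g) \<cdot> f = h \<cdot> (g \<cdot> f)"
  using assms by (intro comp_assoc) auto

lemma comp_ident_simps [simp]:
  assumes "f \<in> Arr C"
  shows "Dom C f = X \<Longrightarrow> f \<cdot> Ident C X = f" "Cod C f = X \<Longrightarrow> Ident C X \<cdot> f = f"
  using comp_ident_right comp_ident_left assms by auto

text \<open>Composites are normalized to the right, so that an equation \<open>g \<cdot> f = k\<close> does not apply to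
  \<open>g \<cdot> (f \<cdot> x)\<close> as it stands.\<close>

lemma reassoc:
  assumes "g \<cdot> f = k" "f \<in> Arr C" "g \<in> Arr C" "Dom C g = Cod C f"
    and "x \<in> Arr C" "Dom C f = Cod C x"
  shows "g \<cdot> (f \<cdot> x) = k \<cdot> x"
  using assms by (metis comp_assoc_simp)

lemma add_simps [simp]:
  assumes "f \<in> Arr C" "g \<in> Arr C" "Dom C f = Dom C g" "Cod C f = Cod C g"
  shows "Add C f g \<in> Arr C" "Dom C (Add C f g) = Dom C g" "Cod C (Add C f g) = Cod C g"
proof -
  interpret H: comm_group "hom_group C (Dom C g) (Cod C g)"
    using assms by (intro hom_comm_group) auto
  have "Add C f g \<in> hom_set C (Dom C g) (Cod C g)"
    using H.m_closed[of f g] assms by (simp add: hom_group_def)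
  then show "Add C f g \<in> Arr C" "Dom C (Add C f g) = Dom C g" "Cod C (Add C f g) = Cod C g"
    by simp_all
qed

lemma zero_simps [simp]:
  assumes "X \<in> Obj C" "Y \<in> Obj C"
  shows "Zer C X Y \<in> Arr C" "Dom C (Zer C X Y) = X" "Cod C (Zer C X Y) = Y"
proof -
  interpret H: comm_group "hom_group C X Y"
    using assms by (intro hom_comm_group) auto
  show "Zer C X Y \<in> Arr C" "Dom C (Zer C X Y) = X" "Cod C (Zer C X Y) = Y"
    using H.one_closed by (simp_all add: hom_group_def)
qed

lemma add_zero: 
  assumes "f \<in> Arr C" "Dom C f = X" "Cod C f = Y"
  shows "Add C f (Zer C X Y) = f"
proof -
  interpret H: comm_group "hom_group C X Y"
    using assms by (intro hom_comm_group) auto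
  show ?thesis using H.r_one[of f] assms by (simp add: hom_group_def)
qed

lemma add_cancel:
  assumes "f \<in> Arr C" "g \<in> Arr C" "h \<in> Arr C"
    and "Dom C f = Dom C h" "Dom C g = Dom C h" "Cod C f = Cod C h" "Cod C g = Cod C h"
  shows "Add C f h = Add C g h \<longleftrightarrow> f = g"
proof -
  interpret H: comm_group "hom_group C (Dom C h) (Cod C h)"
    using assms by (intro hom_comm_group) auto
  show ?thesis using H.right_cancel[of h f g] assms by (auto simp: hom_group_def)
qed

lemma idempotent_zero:
  assumes "f \<in> Arr C" "Add C f f = f"
  shows "f = Zer C (Dom C f) (Cod C f)"
proof -
  interpret H: comm_group "hom_group C (Dom C f) (Cod C f)"
    using assms by (intro hom_comm_group) auto
  show ?thesis using H.r_cancel_one[of f f] assms by (simp add: hom_group_def)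
qed

lemma zero_idempotent: "X \<in> Obj C \<Longrightarrow> Y \<in> Obj C \<Longrightarrow> Add C (Zer C X Y) (Zer C X Y) = Zer C X Y"
  by (simp add: add_zero)

lemma comp_zero:
  assumes "g \<in> Arr C" "X \<in> Obj C" "Dom C g = Y" "Cod C g = Z"
  shows "g \<cdot> Zer C X Y = Zer C X Z"
proof -
  have "Add C (g \<cdot> Zer C X Y) (g \<cdot> Zer C X Y) = g \<cdot> Zer C X Y"
    using assms comp_add_right[of "Zer C X Y" X Y "Zer C X Y" g Z] zero_idempotent[of X Y] by auto
  with assms show ?thesis using idempotent_zero[of "g \<cdot> Zer C X Y"] by auto
qed

lemma zero_comp:
  assumes "f \<in> Arr C" "Z \<in> Obj C" "Cod C f = Y" "Dom C f = X"
  shows "Zer C Y Z \<cdot> f = Zer C X Z"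
proof -
  have "Add C (Zer C Y Z \<cdot> f) (Zer C Y Z \<cdot> f) = Zer C Y Z \<cdot> f"
    using assms comp_add_left[of f X Y "Zer C Y Z" Z "Zer C Y Z"] zero_idempotent[of Y Z] by auto
  with assms show ?thesis using idempotent_zero[of "Zer C Y Z \<cdot> f"] by auto
qed

text \<open>The equation \<open>c \<cdot> f = c \<cdot> g\<close> says that \<open>c\<close> kills the difference of \<open>f\<close> and \<open>g\<close>; this turns
  cokernels into coequalizers.\<close>

lemma ex_difference:
  assumes "f \<in> Arr C" "g \<in> Arr C" "Dom C f = Dom C g" "Cod C f = Cod C g"
  obtains d where "d \<in> hom_set C (Dom C g) (Cod C g)"
    and "\<And>c. c \<in> Arr C \<Longrightarrow> Dom C c = Cod C g \<Longrightarrow>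
      c \<cdot> d = Zer C (Dom C g) (Cod C c) \<longleftrightarrow> c \<cdot> f = c \<cdot> g"
proof -
  interpret H: comm_group "hom_group C (Dom C g) (Cod C g)"
    using assms by (intro hom_comm_group) auto
  define n where "n = inv\<^bsub>hom_group C (Dom C g) (Cod C g)\<^esub> g"
  have n: "n \<in> Arr C" "Dom C n = Dom C g" "Cod C n = Cod C g"
    using H.inv_closed[of g] assms by (auto simp: n_def hom_group_def)
  have gn: "Add C g n = Zer C (Dom C g) (Cod C g)"
    using H.r_inv[of g] assms by (simp add: n_def hom_group_def)
  show thesis
  proof (rule that[of "Add C f n"])
    show "Add C f n \<in> hom_set C (Dom C g) (Cod C g)" using assms n by simp
    fix c assume c: "c \<in> Arr C" "Dom C c = Cod C g"
    have 1: "c \<cdot> Add C f n = Add C (c \<cdot> f) (c \<cdot> n)"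
      using assms n c by (intro comp_add_right) auto
    have "Add C (c \<cdot> g) (c \<cdot> n) = c \<cdot> Add C g n"
      using assms n c by (intro comp_add_right[symmetric]) auto
    hence 2: "Add C (c \<cdot> g) (c \<cdot> n) = Zer C (Dom C g) (Cod C c)"
      using gn assms c by (simp add: comp_zero)
    show "c \<cdot> Add C f n = Zer C (Dom C g) (Cod C c) \<longleftrightarrow> c \<cdot> f = c \<cdot> g"
      unfolding 1 2[symmetric] using assms n c by (intro add_cancel) auto
  qed
qed

lemma inv_arrow_inverse:
  assumes "iso_arrow C f"
  shows "inverse_arrows C f (inv_arrow C f)"
proof -
  obtain g where g: "inverse_arrows C f g" using assms by (auto simp: iso_arrow_def)
  have "g' = g" if g': "inverse_arrows C f g'" for g'
  proof -
    have "g' = g' \<cdot> (f \<cdot> g)" using g g' by (simp add: inverse_arrows_def)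
    also have "\<dots> = (g' \<cdot> f) \<cdot> g" using g g'
      unfolding inverse_arrows_def by (intro comp_assoc_simp[symmetric]) simp_all
    also have "\<dots> = g" using g g' by (simp add: inverse_arrows_def)
    finally show ?thesis .
  qed
  with g show ?thesis unfolding inv_arrow_def by (rule theI[of "inverse_arrows C f"])
qed

lemma iso_comp:
  assumes "iso_arrow C f" "iso_arrow C g" "Dom C g = Cod C f"
  shows "iso_arrow C (g \<cdot> f)"
proof -
  obtain f' g' where *: "inverse_arrows C f f'" "inverse_arrows C g g'"
    using assms by (auto simp: iso_arrow_def)
  then have e: "f' \<cdot> f = Ident C (Dom C f)" "f \<cdot> f' = Ident C (Cod C f)"
      "g' \<cdot> g = Ident C (Dom C g)" "g \<cdot> g' = Ident C (Cod C g)"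
    and t: "f \<in> Arr C" "g \<in> Arr C" "f' \<in> Arr C" "g' \<in> Arr C"
      "Dom C f' = Cod C f" "Cod C f' = Dom C f" "Dom C g' = Cod C g" "Cod C g' = Cod C f"
    using assms by (auto simp: inverse_arrows_def)
  have "inverse_arrows C (g \<cdot> f) (f' \<cdot> g')"
    using t e assms(3) by (simp add: inverse_arrows_def reassoc[OF e(2)] reassoc[OF e(3)])
  then show ?thesis by (auto simp: iso_arrow_def)
qed

end

lemma inverse_arrowsD:
  assumes "inverse_arrows C f g"
  shows "f \<in> Arr C" "g \<in> Arr C" "Dom C g = Cod C f" "Cod C g = Dom C f"
    "g \<cdot>\<^bsub>C\<^esub> f = Ident C (Dom C f)" "f \<cdot>\<^bsub>C\<^esub> g = Ident C (Cod C f)"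
    "inverse_arrows C g f"
  using assms by (auto simp: inverse_arrows_def)

context additive_functor
begin

lemma fo_simp [simp]: "X \<in> Obj C \<Longrightarrow> fo F X \<in> Obj D"
  by (rule fo_obj)

lemma fa_simps [simp]:
  assumes "f \<in> Arr C"
  shows "fa F f \<in> Arr D" "Dom D (fa F f) = fo F (Dom C f)" "Cod D (fa F f) = fo F (Cod C f)"
  using fa_hom[of f "Dom C f" "Cod C f"] assms by simp_all

lemma fa_ident_simp [simp]: "X \<in> Obj C \<Longrightarrow> fa F (Ident C X) = Ident D (fo F X)"
  by (rule fa_ident)

lemma fa_comp_simp [simp]:
  assumes "f \<in> Arr C" "g \<in> Arr C" "Dom C g = Cod C f"
  shows "fa F (g \<cdot>\<^bsub>C\<^esub> f) = fa F g \<cdot>\<^bsub>D\<^esub> fa F f"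
  using assms by (intro fa_comp) auto

lemma fa_zero:
  assumes "X \<in> Obj C" "Y \<in> Obj C"
  shows "fa F (Zer C X Y) = Zer D (fo F X) (fo F Y)"
proof -
  have "Add D (fa F (Zer C X Y)) (fa F (Zer C X Y)) = fa F (Zer C X Y)"
    using fa_add[of "Zer C X Y" X Y "Zer C X Y"] assms by (simp add: C.zero_idempotent)
  then show ?thesis using D.idempotent_zero[of "fa F (Zer C X Y)"] assms by simp
qed

lemma fa_inverse: "inverse_arrows C f g \<Longrightarrow> inverse_arrows D (fa F f) (fa F g)"
  by (auto simp: inverse_arrows_def simp flip: fa_comp_simp)

lemma fa_iso: "iso_arrow C f \<Longrightarrow> iso_arrow D (fa F f)"
  unfolding iso_arrow_def using fa_inverse by blast

end

lemma (in preadditive_category) additive_functor_id: "additive_functor C C id_func"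
  by unfold_locales simp_all

lemma additive_functor_comp:
  assumes "additive_functor C D F" "additive_functor D E G"
  shows "additive_functor C E (G \<odot> F)"
proof -
  interpret F: additive_functor C D F by fact
  interpret G: additive_functor D E G by fact
  show ?thesis
    by unfold_locales (auto simp: F.fa_add[OF _ ] G.fa_add)
qed


section \<open>Coequalizers\<close>

definition coequalizer_of :: "('o, 'a) cat \<Rightarrow> 'a \<Rightarrow> 'a \<Rightarrow> 'a \<Rightarrow> bool" where
  "coequalizer_of C c f g \<longleftrightarrow> c \<in> Arr C \<and> f \<in> Arr C \<and> g \<in> Arr C \<and> Dom C f = Dom C g \<and>
    Cod C f = Dom C c \<and> Cod C g = Dom C c \<and> c \<cdot>\<^bsub>C\<^esub> f = c \<cdot>\<^bsub>C\<^esub> g \<and>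
    (\<forall>h\<in>Arr C. Dom C h = Dom C c \<longrightarrow> h \<cdot>\<^bsub>C\<^esub> f = h \<cdot>\<^bsub>C\<^esub> g \<longrightarrow>
      (\<exists>u\<in>hom_set C (Cod C c) (Cod C h). u \<cdot>\<^bsub>C\<^esub> c = h)) \<and>
    (\<forall>u\<in>Arr C. \<forall>v\<in>hom_set C (Dom C u) (Cod C u). Dom C u = Cod C c \<longrightarrow>
      u \<cdot>\<^bsub>C\<^esub> c = v \<cdot>\<^bsub>C\<^esub> c \<longrightarrow> u = v)"

lemma coequalizerD:
  assumes "coequalizer_of C c f g"
  shows "c \<in> Arr C" "f \<in> Arr C" "g \<in> Arr C" "Dom C f = Dom C g" "Cod C f = Dom C c"
    "Cod C g = Dom C c" "c \<cdot>\<^bsub>C\<^esub> f = c \<cdot>\<^bsub>C\<^esub> g"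
  using assms unfolding coequalizer_of_def by blast+

lemma coequalizer_factor:
  assumes "coequalizer_of C c f g" "h \<in> Arr C" "Dom C h = Dom C c" "h \<cdot>\<^bsub>C\<^esub> f = h \<cdot>\<^bsub>C\<^esub> g"
  obtains u where "u \<in> Arr C" "Dom C u = Cod C c" "Cod C u = Cod C h" "u \<cdot>\<^bsub>C\<^esub> c = h"
proof -
  have "\<exists>u\<in>hom_set C (Cod C c) (Cod C h). u \<cdot>\<^bsub>C\<^esub> c = h"
    using assms unfolding coequalizer_of_def by blast
  with that show thesis by auto
qed

lemma coequalizer_epi:
  assumes "coequalizer_of C c f g" "u \<in> Arr C" "v \<in> Arr C" "Dom C u = Cod C c"
    and "Dom C v = Cod C c" "Cod C u = Cod C v" "u \<cdot>\<^bsub>C\<^esub> c = v \<cdot>\<^bsub>C\<^esub> c"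
  shows "u = v"
proof -
  have "v \<in> hom_set C (Dom C u) (Cod C u)" using assms by simp
  with assms show ?thesis unfolding coequalizer_of_def by blast
qed

lemma coequalizerI:
  assumes "c \<in> Arr C" "f \<in> Arr C" "g \<in> Arr C" "Dom C f = Dom C g" "Cod C f = Dom C c"
    and "Cod C g = Dom C c" "c \<cdot>\<^bsub>C\<^esub> f = c \<cdot>\<^bsub>C\<^esub> g"
    and "\<And>h. \<lbrakk>h \<in> Arr C; Dom C h = Dom C c; h \<cdot>\<^bsub>C\<^esub> f = h \<cdot>\<^bsub>C\<^esub> g\<rbrakk> \<Longrightarrow>
      \<exists>u\<in>hom_set C (Cod C c) (Cod C h). u \<cdot>\<^bsub>C\<^esub> c = h"
    and "\<And>u v. \<lbrakk>u \<in> Arr C; v \<in> Arr C; Dom C u = Cod C c; Dom C v = Cod C c;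
      Cod C u = Cod C v; u \<cdot>\<^bsub>C\<^esub> c = v \<cdot>\<^bsub>C\<^esub> c\<rbrakk> \<Longrightarrow> u = v"
  shows "coequalizer_of C c f g"
  unfolding coequalizer_of_def using assms by simp

context preadditive_category
begin

text \<open>The splittings \<open>s\<close> and \<open>t\<close> yield the factorization: if \<open>h\<close> equalizes \<open>f\<close> and \<open>g\<close>, then
  \<open>h \<cdot> s \<cdot> c = h \<cdot> f \<cdot> t = h \<cdot> g \<cdot> t = h\<close>.\<close>

lemma split_coequalizer:
  assumes "c \<in> Arr C" "f \<in> Arr C" "g \<in> Arr C" "Dom C f = Dom C g" "Cod C f = Dom C c"
    and "Cod C g = Dom C c" "c \<cdot> f = c \<cdot> g"
    and s: "s \<in> hom_set C (Cod C c) (Dom C c)" "c \<cdot> s = Ident C (Cod C c)"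
    and t: "t \<in> hom_set C (Dom C c) (Dom C f)" "f \<cdot> t = s \<cdot> c" "g \<cdot> t = Ident C (Dom C c)"
  shows "coequalizer_of C c f g"
proof (rule coequalizerI)
  fix h assume h: "h \<in> Arr C" "Dom C h = Dom C c" "h \<cdot> f = h \<cdot> g"
  have "(h \<cdot> s) \<cdot> c = (h \<cdot> f) \<cdot> t" using assms h(1,2) by simp
  also have "\<dots> = h" unfolding h(3) using assms h(1,2) by simp
  finally show "\<exists>u\<in>hom_set C (Cod C c) (Cod C h). u \<cdot> c = h"
    using assms h(1,2) by (intro bexI[of _ "h \<cdot> s"]) simp_all
next
  fix u v
  assume uv: "u \<in> Arr C" "v \<in> Arr C" "Dom C u = Cod C c" "Dom C v = Cod C c"
    "Cod C u = Cod C v" and eq: "u \<cdot> c = v \<cdot> c"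
  have "u = (u \<cdot> c) \<cdot> s" using uv assms by simp
  also have "\<dots> = v" unfolding eq using uv assms by simp
  finally show "u = v" .
qed (use assms in auto)

lemma coequalizer_unique_iso:
  assumes "coequalizer_of C c f g" "coequalizer_of C c' f g"
  obtains u v where "inverse_arrows C u v" "Dom C u = Cod C c" "Cod C u = Cod C c'"
    "u \<cdot> c = c'" "v \<cdot> c' = c"
proof -
  note c = coequalizerD[OF assms(1)] and c' = coequalizerD[OF assms(2)]
  have d: "Dom C c' = Dom C c" using c(5) c'(5) by simp
  obtain u where u: "u \<in> Arr C" "Dom C u = Cod C c" "Cod C u = Cod C c'" "u \<cdot> c = c'"
    by (rule coequalizer_factor[OF assms(1) c'(1) d c'(7)])
  obtain v where v: "v \<in> Arr C" "Dom C v = Cod C c'" "Cod C v = Cod C c" "v \<cdot> c' = c"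
    by (rule coequalizer_factor[OF assms(2) c(1) d[symmetric] c(7)])
  have "v \<cdot> u = Ident C (Cod C c)" 
    by (rule coequalizer_epi[OF assms(1)]) (use u v c(1) c'(1) d in simp_all)
  moreover have "u \<cdot> v = Ident C (Cod C c')" 
    by (rule coequalizer_epi[OF assms(2)]) (use u v c(1) c'(1) d in simp_all)
  ultimately have "inverse_arrows C u v" using u v by (simp add: inverse_arrows_def)
  with u v that show thesis by blast
qed

end

lemma (in abelian_category) ex_coequalizer:
  assumes "f \<in> Arr C" "g \<in> Arr C" "Dom C f = Dom C g" "Cod C f = Cod C g"
  shows "\<exists>c. coequalizer_of C c f g"
proof -
  obtain d where d: "d \<in> hom_set C (Dom C g) (Cod C g)"
    and dc: "\<And>c. c \<in> Arr C \<Longrightarrow> Dom C c = Cod C g \<Longrightarrow>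
      c \<cdot> d = Zer C (Dom C g) (Cod C c) \<longleftrightarrow> c \<cdot> f = c \<cdot> g"
    using ex_difference[OF assms] by blast
  obtain c where c: "cokernel_of C c d" using ex_cokernel d by auto
  have ct: "c \<in> Arr C" "Dom C c = Cod C g" and cd: "c \<cdot> d = Zer C (Dom C g) (Cod C c)"
    using c d by (simp_all add: cokernel_of_def)
  have univ: "\<exists>!u. u \<in> hom_set C (Cod C c) W \<and> u \<cdot> c = h"
    if "W \<in> Obj C" "h \<in> hom_set C (Cod C d) W" "h \<cdot> d = Zer C (Dom C d) W" for W h
    using c that unfolding cokernel_of_def by blast
  have "coequalizer_of C c f g"
  proof (rule coequalizerI)
    fix h assume h: "h \<in> Arr C" "Dom C h = Dom C c" "h \<cdot> f = h \<cdot> g"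
    show "\<exists>u\<in>hom_set C (Cod C c) (Cod C h). u \<cdot> c = h"
    proof -
      have "\<exists>!u. u \<in> hom_set C (Cod C c) (Cod C h) \<and> u \<cdot> c = h"
        using h(1,2) dc[of h] h(3) ct d by (intro univ) simp_all
      then show ?thesis by blast
    qed
  next
    fix u v
    assume uv: "u \<in> Arr C" "v \<in> Arr C" "Dom C u = Cod C c" "Dom C v = Cod C c"
      "Cod C u = Cod C v" and eq: "u \<cdot> c = v \<cdot> c"
    have "(v \<cdot> c) \<cdot> d = Zer C (Dom C d) (Cod C v)"
      using uv ct cd d assms by (simp add: comp_zero)
    with univ[of "Cod C v" "v \<cdot> c"] have "\<exists>!w. w \<in> hom_set C (Cod C c) (Cod C v) \<and> w \<cdot> c = v \<cdot> c"
      using uv ct d by simp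
    moreover have "u \<in> hom_set C (Cod C c) (Cod C v)" "v \<in> hom_set C (Cod C c) (Cod C v)"
      using uv by simp_all
    ultimately show "u = v" using eq by blast
  qed (use assms ct dc[of c] cd in simp_all)
  then show ?thesis by blast
qed


section \<open>Adjunctions\<close>

lemma nat_transI:
  assumes "additive_functor C D F" "additive_functor C D G"
    and "\<And>X. X \<in> Obj C \<Longrightarrow> \<eta> X \<in> hom_set D (fo F X) (fo G X)"
    and "\<And>f. f \<in> Arr C \<Longrightarrow> fa G f \<cdot>\<^bsub>D\<^esub> \<eta> (Dom C f) = \<eta> (Cod C f) \<cdot>\<^bsub>D\<^esub> fa F f"
  shows "nat_trans C D F G \<eta>"
  using assms by (auto simp: nat_trans_def)

lemma nat_transD:
  assumes "nat_trans C D F G \<eta>"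
  shows "X \<in> Obj C \<Longrightarrow> \<eta> X \<in> Arr D" "X \<in> Obj C \<Longrightarrow> Dom D (\<eta> X) = fo F X"
    "X \<in> Obj C \<Longrightarrow> Cod D (\<eta> X) = fo G X"
    "f \<in> Arr C \<Longrightarrow> fa G f \<cdot>\<^bsub>D\<^esub> \<eta> (Dom C f) = \<eta> (Cod C f) \<cdot>\<^bsub>D\<^esub> fa F f"
proof -
  assume f: "f \<in> Arr C"
  interpret F: additive_functor C D F using assms by (simp add: nat_trans_def)
  have "\<forall>X\<in>Obj C. \<forall>Y\<in>Obj C. \<forall>f\<in>hom_set C X Y. fa G f \<cdot>\<^bsub>D\<^esub> \<eta> X = \<eta> Y \<cdot>\<^bsub>D\<^esub> fa F f"
    using assms unfolding nat_trans_def by blast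
  then show "fa G f \<cdot>\<^bsub>D\<^esub> \<eta> (Dom C f) = \<eta> (Cod C f) \<cdot>\<^bsub>D\<^esub> fa F f"
    using f by simp
qed (use assms in \<open>auto simp: nat_trans_def\<close>)

lemma nat_iso_inverse:
  assumes "nat_iso C D F G \<eta>" "X \<in> Obj C"
  shows "inverse_arrows D (\<eta> X) (inv_arrow D (\<eta> X))"
proof -
  interpret F: additive_functor C D F using assms by (simp add: nat_iso_def nat_trans_def)
  show ?thesis using assms by (intro F.D.inv_arrow_inverse) (simp add: nat_iso_def)
qed

lemma nat_iso_inv:
  assumes "nat_iso C D F G \<eta>"
  shows "nat_iso C D G F (\<lambda>X. inv_arrow D (\<eta> X))"
proof -
  have nt: "nat_trans C D F G \<eta>" using assms by (simp add: nat_iso_def)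
  interpret F: additive_functor C D F using nt by (simp add: nat_trans_def)
  interpret G: additive_functor C D G using nt by (simp add: nat_trans_def)
  note t [simp] = nat_transD(1-3)[OF nt]
  note i = inverse_arrowsD[OF nat_iso_inverse[OF assms]]
  have "fa F f \<cdot>\<^bsub>D\<^esub> inv_arrow D (\<eta> (Dom C f)) = inv_arrow D (\<eta> (Cod C f)) \<cdot>\<^bsub>D\<^esub> fa G f"
    if f: "f \<in> Arr C" for f
  proof -
    have X: "Dom C f \<in> Obj C" and Y: "Cod C f \<in> Obj C" using f by simp_all
    note X = i[OF X] and Y = i[OF Y]
    have "inv_arrow D (\<eta> (Cod C f)) \<cdot>\<^bsub>D\<^esub> fa G f
      = inv_arrow D (\<eta> (Cod C f)) \<cdot>\<^bsub>D\<^esub> (fa G f \<cdot>\<^bsub>D\<^esub> \<eta> (Dom C f)) \<cdot>\<^bsub>D\<^esub> inv_arrow D (\<eta> (Dom C f))"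
      using f X(1-4) Y(1-4) by (simp add: X(6))
    also have "\<dots> = fa F f \<cdot>\<^bsub>D\<^esub> inv_arrow D (\<eta> (Dom C f))"
      unfolding nat_transD(4)[OF nt f]
      using f X(1-4) Y(1-4) by (simp add: F.D.reassoc[OF Y(5)])
    finally show ?thesis by simp
  qed
  moreover have "iso_arrow D (inv_arrow D (\<eta> X))" if "X \<in> Obj C" for X
    using i(7)[OF that] by (auto simp: iso_arrow_def)
  ultimately show ?thesis unfolding nat_iso_def
    by (intro conjI nat_transI F.additive_functor_axioms G.additive_functor_axioms)
      (use i in auto)
qed

locale adj =
  fixes C :: "('o, 'a) cat" and D :: "('p, 'b) cat"
    and L :: "('o, 'a, 'p, 'b) func" and R :: "('p, 'b, 'o, 'a) func" and \<alpha> \<beta>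
  assumes adj: "adjunction C D L R \<alpha> \<beta>"

sublocale adj \<subseteq> L: additive_functor C D L
  using adj by (simp add: adjunction_def)

sublocale adj \<subseteq> R: additive_functor D C R
  using adj by (simp add: adjunction_def)

context adj
begin

lemma unit_nat_trans: "nat_trans C C id_func (R \<odot> L) \<alpha>"
  and counit_nat_trans: "nat_trans D D (L \<odot> R) id_func \<beta>"
  using adj by (simp_all add: adjunction_def)

lemma unit_simps [simp]:
  assumes "X \<in> Obj C"
  shows "\<alpha> X \<in> Arr C" "Dom C (\<alpha> X) = X" "Cod C (\<alpha> X) = fo R (fo L X)"
  using nat_transD(1-3)[OF unit_nat_trans assms] by simp_all

lemma counit_simps [simp]:
  assumes "Y \<in> Obj D"
  shows "\<beta> Y \<in> Arr D" "Dom D (\<beta> Y) = fo L (fo R Y)" "Cod D (\<beta> Y) = Y"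
  using nat_transD(1-3)[OF counit_nat_trans assms] by simp_all

lemma unit_nat: "f \<in> Arr C \<Longrightarrow> fa R (fa L f) \<cdot>\<^bsub>C\<^esub> \<alpha> (Dom C f) = \<alpha> (Cod C f) \<cdot>\<^bsub>C\<^esub> f"
  using nat_transD(4)[OF unit_nat_trans] by simp

lemma counit_nat: "g \<in> Arr D \<Longrightarrow> \<beta> (Cod D g) \<cdot>\<^bsub>D\<^esub> fa L (fa R g) = g \<cdot>\<^bsub>D\<^esub> \<beta> (Dom D g)"
  using nat_transD(4)[OF counit_nat_trans] by simp

lemma triangles:
  "X \<in> Obj C \<Longrightarrow> \<beta> (fo L X) \<cdot>\<^bsub>D\<^esub> fa L (\<alpha> X) = Ident D (fo L X)"
  "Y \<in> Obj D \<Longrightarrow> fa R (\<beta> Y) \<cdot>\<^bsub>C\<^esub> \<alpha> (fo R Y) = Ident C (fo R Y)"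
  using adj by (simp_all add: adjunction_def)

abbreviation phi :: "'o \<Rightarrow> 'b \<Rightarrow> 'a" where
  "phi \<equiv> adj_iso C R \<alpha>"

text \<open>The inverse of \<open>phi\<close>.\<close>

definition psi :: "'p \<Rightarrow> 'a \<Rightarrow> 'b" where
  "psi Y g = \<beta> Y \<cdot>\<^bsub>D\<^esub> fa L g"

lemma phi_simps [simp]:
  assumes "X \<in> Obj C" "h \<in> Arr D" "Dom D h = fo L X"
  shows "phi X h \<in> Arr C" "Dom C (phi X h) = X" "Cod C (phi X h) = fo R (Cod D h)"
  using assms by (simp_all add: adj_iso_def)

lemma psi_simps [simp]:
  assumes "Y \<in> Obj D" "g \<in> Arr C" "Cod C g = fo R Y"
  shows "psi Y g \<in> Arr D" "Dom D (psi Y g) = fo L (Dom C g)" "Cod D (psi Y g) = Y"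
  using assms by (simp_all add: psi_def)

lemma phi_post:
  assumes "X \<in> Obj C" "h \<in> Arr D" "Dom D h = fo L X" "k \<in> Arr D" "Dom D k = Cod D h"
  shows "phi X (k \<cdot>\<^bsub>D\<^esub> h) = fa R k \<cdot>\<^bsub>C\<^esub> phi X h"
  using assms by (simp add: adj_iso_def)

lemma phi_pre:
  assumes "g \<in> Arr C" "Dom C g = X" "Cod C g = X'" "h \<in> Arr D" "Dom D h = fo L X'"
  shows "phi X (h \<cdot>\<^bsub>D\<^esub> fa L g) = phi X' h \<cdot>\<^bsub>C\<^esub> g"
  using assms unit_nat[OF assms(1)] by (auto simp: adj_iso_def)

lemma psi_pre:
  assumes "Y \<in> Obj D" "g \<in> Arr C" "Cod C g = fo R Y" "f \<in> Arr C" "Dom C g = Cod C f"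
  shows "psi Y (g \<cdot>\<^bsub>C\<^esub> f) = psi Y g \<cdot>\<^bsub>D\<^esub> fa L f"
  using assms by (simp add: psi_def)

lemma psi_post:
  assumes "k \<in> Arr D" "Dom D k = Y" "Cod D k = Y'" "g \<in> Arr C" "Cod C g = fo R Y"
  shows "psi Y' (fa R k \<cdot>\<^bsub>C\<^esub> g) = k \<cdot>\<^bsub>D\<^esub> psi Y g"
proof -
  have "\<beta> Y' \<cdot>\<^bsub>D\<^esub> fa L (fa R k) = k \<cdot>\<^bsub>D\<^esub> \<beta> Y" using counit_nat[OF assms(1)] assms(2,3) by simp
  note e = L.D.reassoc[OF this]
  have "Y \<in> Obj D" "Y' \<in> Obj D" using assms by auto
  then show ?thesis using assms by (simp add: psi_def e)
qed

lemma phi_ident: "X \<in> Obj C \<Longrightarrow> phi X (Ident D (fo L X)) = \<alpha> X"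
  by (simp add: adj_iso_def)

lemma phi_counit: "Y \<in> Obj D \<Longrightarrow> phi (fo R Y) (\<beta> Y) = Ident C (fo R Y)"
  by (simp add: adj_iso_def triangles)

lemma psi_ident: "Y \<in> Obj D \<Longrightarrow> psi Y (Ident C (fo R Y)) = \<beta> Y"
  by (simp add: psi_def)

lemma psi_unit: "X \<in> Obj C \<Longrightarrow> psi (fo L X) (\<alpha> X) = Ident D (fo L X)"
  by (simp add: psi_def triangles)

lemma phi_psi [simp]:
  assumes "Y \<in> Obj D" "g \<in> Arr C" "Cod C g = fo R Y" "Dom C g = X"
  shows "phi X (psi Y g) = g"
  using assms phi_pre[of g X "fo R Y" "\<beta> Y"] by (simp add: psi_def phi_counit)

lemma psi_phi [simp]:
  assumes "X \<in> Obj C" "h \<in> Arr D" "Dom D h = fo L X" "Cod D h = Y"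
  shows "psi Y (phi X h) = h"
  using assms psi_post[of h "fo L X" Y "\<alpha> X"] by (simp add: adj_iso_def psi_unit)

lemma phi_inject:
  assumes "X \<in> Obj C" "h \<in> Arr D" "k \<in> Arr D" "Dom D h = fo L X" "Dom D k = fo L X"
    "Cod D h = Cod D k" "phi X h = phi X k"
  shows "h = k"
  using assms psi_phi by metis

text \<open>Transposition turns the universal property of \<open>L c\<close> into that of \<open>c\<close>.\<close>

lemma left_adjoint_coequalizer:
  assumes "coequalizer_of C c f g"
  shows "coequalizer_of D (fa L c) (fa L f) (fa L g)"
proof -
  note c = coequalizerD[OF assms]
  have fc: "fa L c \<cdot>\<^bsub>D\<^esub> fa L f = fa L c \<cdot>\<^bsub>D\<^esub> fa L g"
    using c by (simp flip: L.fa_comp_simp)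
  show ?thesis
  proof (rule coequalizerI)
    fix h assume h: "h \<in> Arr D" "Dom D h = Dom D (fa L c)" 
      and eq: "h \<cdot>\<^bsub>D\<^esub> fa L f = h \<cdot>\<^bsub>D\<^esub> fa L g"
    have h': "Dom D h = fo L (Dom C c)" using h(2) c(1) by simp
    have "phi (Dom C c) h \<cdot>\<^bsub>C\<^esub> f = phi (Dom C g) (h \<cdot>\<^bsub>D\<^esub> fa L f)"
      by (rule phi_pre[symmetric]) (use c h(1) h' in simp_all)
    also have "\<dots> = phi (Dom C c) h \<cdot>\<^bsub>C\<^esub> g" unfolding eq
      by (rule phi_pre) (use c h(1) h' in simp_all)
    finally obtain u where u: "u \<in> Arr C" "Dom C u = Cod C c"
        "Cod C u = Cod C (phi (Dom C c) h)" "u \<cdot>\<^bsub>C\<^esub> c = phi (Dom C c) h"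
      using coequalizer_factor[OF assms, of "phi (Dom C c) h"] c(1) h(1) h' by auto
    have "psi (Cod D h) u \<cdot>\<^bsub>D\<^esub> fa L c = psi (Cod D h) (u \<cdot>\<^bsub>C\<^esub> c)"
      by (rule psi_pre[symmetric]) (use c(1) h(1) h' u(1-3) in simp_all)
    also have "\<dots> = h" using u(4) h(1) h' c(1) by simp
    finally show "\<exists>u\<in>hom_set D (Cod D (fa L c)) (Cod D h). u \<cdot>\<^bsub>D\<^esub> fa L c = h"
      using c(1) h(1) h' u(1-3) by (intro bexI[of _ "psi (Cod D h) u"]) simp_all
  next
    fix u v
    assume uv: "u \<in> Arr D" "v \<in> Arr D" "Dom D u = Cod D (fa L c)" "Dom D v = Cod D (fa L c)"
      "Cod D u = Cod D v" and eq: "u \<cdot>\<^bsub>D\<^esub> fa L c = v \<cdot>\<^bsub>D\<^esub> fa L c"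
    have d: "Dom D u = fo L (Cod C c)" "Dom D v = fo L (Cod C c)" using uv c(1) by simp_all
    have e: "phi (Cod C c) w \<cdot>\<^bsub>C\<^esub> c = phi (Dom C c) (w \<cdot>\<^bsub>D\<^esub> fa L c)"
      if "w \<in> Arr D" "Dom D w = fo L (Cod C c)" for w
      by (rule phi_pre[symmetric]) (use that c(1) in simp_all)
    have "phi (Cod C c) u = phi (Cod C c) v"
      by (rule coequalizer_epi[OF assms]) (use uv(1,2,5) d c(1) in \<open>simp_all add: e eq\<close>)
    then show "u = v" by (rule phi_inject[rotated -1]) (use uv d c in simp_all)
  qed (use c fc in simp_all)
qed

text \<open>Transposition sends \<open>u \<cdot> \<beta> Y\<close> to \<open>R u\<close>.\<close>

lemma faithful_counit_epi:
  assumes "faithful D R" "Y \<in> Obj D"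
  shows "epi_arrow D (\<beta> Y)"
  unfolding epi_arrow_def
proof (intro conjI ballI impI)
  fix W u v assume W: "W \<in> Obj D"
    and u: "u \<in> hom_set D (Cod D (\<beta> Y)) W" and v: "v \<in> hom_set D (Cod D (\<beta> Y)) W"
    and eq: "u \<cdot>\<^bsub>D\<^esub> \<beta> Y = v \<cdot>\<^bsub>D\<^esub> \<beta> Y"
  have e: "phi (fo R Y) (w \<cdot>\<^bsub>D\<^esub> \<beta> Y) = fa R w" if "w \<in> hom_set D Y W" for w
    using that assms phi_post[of "fo R Y" "\<beta> Y" w] by (auto simp: phi_counit)
  have "u \<in> hom_set D Y W" "v \<in> hom_set D Y W" using u v assms by auto
  moreover from this e eq have "fa R u = fa R v" by metis
  moreover have "inj_on (fa R) (hom_set D Y W)" using assms W by (simp add: faithful_def)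
  ultimately show "u = v" by (simp add: inj_on_def)
qed (use assms in simp)

text \<open>This gives the adjunction \<open>U \<stileturn> \<nu> S\<close> from \<open>U \<stileturn> T\<close> and an isomorphism of \<open>\<nu> S\<close> with \<open>T\<close>.\<close>

lemma right_adjoint_transport:
  assumes "nat_iso D C R' R \<theta>"
  shows "\<exists>a b. adjunction C D L R' a b"
proof -
  let ?i = "\<lambda>Y. inv_arrow C (\<theta> Y)"
  have nt: "nat_trans D C R' R \<theta>" using assms by (simp add: nat_iso_def)
  have nti: "nat_trans D C R R' ?i" using nat_iso_inv[OF assms] by (simp add: nat_iso_def)
  interpret R': additive_functor D C R' using nt by (simp add: nat_trans_def)
  note t [simp] = nat_transD(1-3)[OF nt] nat_transD(1-3)[OF nti]
  note i = inverse_arrowsD(5,6)[OF nat_iso_inverse[OF assms]]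
  have i': "?i Y \<cdot>\<^bsub>C\<^esub> \<theta> Y = Ident C (fo R' Y)" "\<theta> Y \<cdot>\<^bsub>C\<^esub> ?i Y = Ident C (fo R Y)"
    if "Y \<in> Obj D" for Y using i[OF that] that by simp_all
  define a where "a X = ?i (fo L X) \<cdot>\<^bsub>C\<^esub> \<alpha> X" for X
  define b where "b Y = psi Y (\<theta> Y)" for Y
  have [simp]: "a X \<in> Arr C" "Dom C (a X) = X" "Cod C (a X) = fo R' (fo L X)" if "X \<in> Obj C" for X
    using that by (simp_all add: a_def)
  have [simp]: "b Y \<in> Arr D" "Dom D (b Y) = fo L (fo R' Y)" "Cod D (b Y) = Y" if "Y \<in> Obj D" for Y
    using that by (simp_all add: b_def)
  have a_nat: "fa R' (fa L f) \<cdot>\<^bsub>C\<^esub> a (Dom C f) = a (Cod C f) \<cdot>\<^bsub>C\<^esub> f" if f: "f \<in> Arr C" for f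
  proof -
    have "fa R' (fa L f) \<cdot>\<^bsub>C\<^esub> ?i (fo L (Dom C f)) = ?i (fo L (Cod C f)) \<cdot>\<^bsub>C\<^esub> fa R (fa L f)"
      using nat_transD(4)[OF nti, of "fa L f"] f by simp
    note e = L.C.reassoc[OF this]
    show ?thesis using f by (simp add: a_def e unit_nat)
  qed
  have b_nat: "b (Cod D g) \<cdot>\<^bsub>D\<^esub> fa L (fa R' g) = g \<cdot>\<^bsub>D\<^esub> b (Dom D g)" if g: "g \<in> Arr D" for g
  proof -
    have "b (Cod D g) \<cdot>\<^bsub>D\<^esub> fa L (fa R' g) = psi (Cod D g) (\<theta> (Cod D g) \<cdot>\<^bsub>C\<^esub> fa R' g)"
      using g unfolding b_def by (intro psi_pre[symmetric]) simp_all
    also have "\<dots> = psi (Cod D g) (fa R g \<cdot>\<^bsub>C\<^esub> \<theta> (Dom D g))"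
      using nat_transD(4)[OF nt g] by simp
    also have "\<dots> = g \<cdot>\<^bsub>D\<^esub> b (Dom D g)" using g unfolding b_def by (intro psi_post) simp_all
    finally show ?thesis .
  qed
  have tri1: "b (fo L X) \<cdot>\<^bsub>D\<^esub> fa L (a X) = Ident D (fo L X)" if X: "X \<in> Obj C" for X
  proof -
    have "b (fo L X) \<cdot>\<^bsub>D\<^esub> fa L (a X) = psi (fo L X) (\<theta> (fo L X) \<cdot>\<^bsub>C\<^esub> a X)"
      using X unfolding b_def by (intro psi_pre[symmetric]) simp_all
    also have "\<theta> (fo L X) \<cdot>\<^bsub>C\<^esub> a X = \<alpha> X"
      using X by (simp add: a_def L.C.reassoc[OF i'(2)])
    finally show ?thesis using X by (simp add: psi_unit)
  qed
  have tri2: "fa R' (b Y) \<cdot>\<^bsub>C\<^esub> a (fo R' Y) = Ident C (fo R' Y)" if Y: "Y \<in> Obj D" for Y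
  proof -
    have "fa R' (b Y) \<cdot>\<^bsub>C\<^esub> ?i (fo L (fo R' Y)) = ?i Y \<cdot>\<^bsub>C\<^esub> fa R (b Y)"
      using nat_transD(4)[OF nti, of "b Y"] Y by simp
    note e = L.C.reassoc[OF this]
    have "fa R (b Y) \<cdot>\<^bsub>C\<^esub> \<alpha> (fo R' Y) = phi (fo R' Y) (b Y)" by (simp add: adj_iso_def)
    also have "\<dots> = \<theta> Y" using Y by (simp add: b_def)
    finally show ?thesis using Y by (simp add: a_def e i')
  qed
  have "adjunction C D L R' a b" unfolding adjunction_def
    using a_nat b_nat tri1 tri2
    by (intro conjI nat_transI ballI additive_functor_comp[OF L.additive_functor_axioms]
        additive_functor_comp[OF R'.additive_functor_axioms])
      (simp_all add: L.additive_functor_axioms R'.additive_functor_axioms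
        L.C.additive_functor_id L.D.additive_functor_id)
  then show ?thesis by blast
qed

end


locale adj_comp = A: adj C D L R \<alpha> \<beta> + B: adj D E L' R' \<alpha>' \<beta>'
  for C :: "('o, 'a) cat" and D :: "('p, 'b) cat" and E :: "('q, 'c) cat"
    and L R \<alpha> \<beta> L' R' \<alpha>' \<beta>'
begin

lemma comp_unit_phi: "comp_unit C L R \<alpha> \<alpha>' X = A.phi X (\<alpha>' (fo L X))"
  by (simp add: comp_unit_def adj_iso_def)

lemma adjunction_comp:
  "adjunction C E (L' \<odot> L) (R \<odot> R') (comp_unit C L R \<alpha> \<alpha>') (\<lambda>Z. B.psi Z (\<beta> (fo R' Z)))"
proof -
  let ?a = "comp_unit C L R \<alpha> \<alpha>'" and ?b = "\<lambda>Z. B.psi Z (\<beta> (fo R' Z))"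
  interpret LL: additive_functor C E "L' \<odot> L"
    by (rule additive_functor_comp[OF A.L.additive_functor_axioms B.L.additive_functor_axioms])
  interpret RR: additive_functor E C "R \<odot> R'"
    by (rule additive_functor_comp[OF B.R.additive_functor_axioms A.R.additive_functor_axioms])
  have unit_nat: "fa R (fa R' (fa L' (fa L f))) \<cdot>\<^bsub>C\<^esub> ?a (Dom C f) = ?a (Cod C f) \<cdot>\<^bsub>C\<^esub> f"
    if f: "f \<in> Arr C" for f
  proof -
    have "fa R (fa R' (fa L' (fa L f))) \<cdot>\<^bsub>C\<^esub> ?a (Dom C f)
      = A.phi (Dom C f) (fa R' (fa L' (fa L f)) \<cdot>\<^bsub>D\<^esub> \<alpha>' (fo L (Dom C f)))"
      using f unfolding comp_unit_phi by (intro A.phi_post[symmetric]) simp_all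
    also have "\<dots> = A.phi (Dom C f) (\<alpha>' (fo L (Cod C f)) \<cdot>\<^bsub>D\<^esub> fa L f)"
      using B.unit_nat[of "fa L f"] f by simp
    also have "\<dots> = ?a (Cod C f) \<cdot>\<^bsub>C\<^esub> f"
      using f unfolding comp_unit_phi by (intro A.phi_pre) simp_all
    finally show ?thesis .
  qed
  have counit_nat: "?b (Cod E g) \<cdot>\<^bsub>E\<^esub> fa L' (fa L (fa R (fa R' g))) = g \<cdot>\<^bsub>E\<^esub> ?b (Dom E g)"
    if g: "g \<in> Arr E" for g
  proof -
    have "?b (Cod E g) \<cdot>\<^bsub>E\<^esub> fa L' (fa L (fa R (fa R' g)))
      = B.psi (Cod E g) (\<beta> (fo R' (Cod E g)) \<cdot>\<^bsub>D\<^esub> fa L (fa R (fa R' g)))"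
      using g by (intro B.psi_pre[symmetric]) simp_all
    also have "\<dots> = B.psi (Cod E g) (fa R' g \<cdot>\<^bsub>D\<^esub> \<beta> (fo R' (Dom E g)))"
      using A.counit_nat[of "fa R' g"] g by simp
    also have "\<dots> = g \<cdot>\<^bsub>E\<^esub> ?b (Dom E g)"
      using g by (intro B.psi_post) simp_all
    finally show ?thesis .
  qed
  have tri1: "?b (fo L' (fo L X)) \<cdot>\<^bsub>E\<^esub> fa L' (fa L (?a X)) = Ident E (fo L' (fo L X))"
    if X: "X \<in> Obj C" for X
  proof -
    have "?b (fo L' (fo L X)) \<cdot>\<^bsub>E\<^esub> fa L' (fa L (?a X))
      = B.psi (fo L' (fo L X)) (A.psi (fo R' (fo L' (fo L X))) (?a X))"
      using X unfolding A.psi_def comp_unit_phi by (intro B.psi_pre[symmetric]) simp_all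
    also have "\<dots> = Ident E (fo L' (fo L X))"
      using X by (simp add: comp_unit_phi B.psi_unit)
    finally show ?thesis .
  qed
  have tri2: "fa R (fa R' (?b Z)) \<cdot>\<^bsub>C\<^esub> ?a (fo R (fo R' Z)) = Ident C (fo R (fo R' Z))"
    if Z: "Z \<in> Obj E" for Z
  proof -
    have "fa R (fa R' (?b Z)) \<cdot>\<^bsub>C\<^esub> ?a (fo R (fo R' Z))
      = A.phi (fo R (fo R' Z)) (B.phi (fo L (fo R (fo R' Z))) (?b Z))"
      using Z unfolding adj_iso_def[of D] comp_unit_phi by (intro A.phi_post[symmetric]) simp_all
    also have "\<dots> = Ident C (fo R (fo R' Z))"
      using Z by (simp add: A.phi_counit)
    finally show ?thesis .
  qed
  show ?thesis unfolding adjunction_def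
    using unit_nat counit_nat tri1 tri2
    by (intro conjI nat_transI ballI LL.additive_functor_axioms RR.additive_functor_axioms
        additive_functor_comp[OF LL.additive_functor_axioms RR.additive_functor_axioms]
        additive_functor_comp[OF RR.additive_functor_axioms LL.additive_functor_axioms])
      (simp_all add: A.L.C.additive_functor_id B.L.D.additive_functor_id comp_unit_phi)
qed

end

text \<open>The conjugate of \<open>\<sigma>\<close> is forced by the case \<open>h = \<beta>2 Y\<close> of the defining equation, where the
  transpose of \<open>h\<close> is an identity.\<close>

locale adj2 = A1: adj C D L1 R1 \<alpha>1 \<beta>1 + A2: adj C D L2 R2 \<alpha>2 \<beta>2
  for C :: "('o, 'a) cat" and D :: "('p, 'b) cat" and L1 R1 \<alpha>1 \<beta>1 L2 R2 \<alpha>2 \<beta>2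
begin

definition mate :: "('o \<Rightarrow> 'b) \<Rightarrow> 'p \<Rightarrow> 'a" where
  "mate \<sigma> Y = A1.phi (fo R2 Y) (\<beta>2 Y \<cdot>\<^bsub>D\<^esub> \<sigma> (fo R2 Y))"

lemma mate_conjugate:
  assumes "nat_trans C D L1 L2 \<sigma>"
  shows "conjugate C D L1 R1 \<alpha>1 L2 R2 \<alpha>2 \<sigma> (mate \<sigma>)"
proof -
  note t [simp] = nat_transD(1-3)[OF assms]
  have "fa R1 g \<cdot>\<^bsub>C\<^esub> mate \<sigma> (Dom D g) = mate \<sigma> (Cod D g) \<cdot>\<^bsub>C\<^esub> fa R2 g"
    if g: "g \<in> Arr D" for g
  proof -
    have e: "\<sigma> (fo R2 (Cod D g)) \<cdot>\<^bsub>D\<^esub> fa L1 (fa R2 g) = fa L2 (fa R2 g) \<cdot>\<^bsub>D\<^esub> \<sigma> (fo R2 (Dom D g))"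
      using nat_transD(4)[OF assms, of "fa R2 g"] g by simp
    have "mate \<sigma> (Cod D g) \<cdot>\<^bsub>C\<^esub> fa R2 g
      = A1.phi (fo R2 (Dom D g)) ((\<beta>2 (Cod D g) \<cdot>\<^bsub>D\<^esub> \<sigma> (fo R2 (Cod D g))) \<cdot>\<^bsub>D\<^esub> fa L1 (fa R2 g))"
      using g unfolding mate_def by (intro A1.phi_pre[symmetric]) simp_all
    also have "\<dots> = A1.phi (fo R2 (Dom D g)) (g \<cdot>\<^bsub>D\<^esub> \<beta>2 (Dom D g) \<cdot>\<^bsub>D\<^esub> \<sigma> (fo R2 (Dom D g)))"
      using g by (simp add: e A1.L.D.reassoc[OF A2.counit_nat])
    also have "\<dots> = A1.phi (fo R2 (Dom D g)) (g \<cdot>\<^bsub>D\<^esub> (\<beta>2 (Dom D g) \<cdot>\<^bsub>D\<^esub> \<sigma> (fo R2 (Dom D g))))"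
      using g by simp
    also have "\<dots> = fa R1 g \<cdot>\<^bsub>C\<^esub> mate \<sigma> (Dom D g)"
      using g unfolding mate_def by (intro A1.phi_post) simp_all
    finally show ?thesis by simp
  qed
  moreover have "A1.phi X (h \<cdot>\<^bsub>D\<^esub> \<sigma> X) = mate \<sigma> Y \<cdot>\<^bsub>C\<^esub> A2.phi X h"
    if X: "X \<in> Obj C" and h: "h \<in> Arr D" "Dom D h = fo L2 X" "Cod D h = Y" for X Y h
  proof -
    have Y: "Y \<in> Obj D" using h by auto
    let ?g = "A2.phi X h"
    have e: "\<sigma> (fo R2 Y) \<cdot>\<^bsub>D\<^esub> fa L1 ?g = fa L2 ?g \<cdot>\<^bsub>D\<^esub> \<sigma> X"
      using nat_transD(4)[OF assms, of ?g] X h by simp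
    have e2: "\<beta>2 Y \<cdot>\<^bsub>D\<^esub> fa L2 ?g = h"
      using A2.psi_phi[OF X h] by (simp add: A2.psi_def)
    have "mate \<sigma> Y \<cdot>\<^bsub>C\<^esub> ?g = A1.phi X ((\<beta>2 Y \<cdot>\<^bsub>D\<^esub> \<sigma> (fo R2 Y)) \<cdot>\<^bsub>D\<^esub> fa L1 ?g)"
      using X Y h unfolding mate_def by (intro A1.phi_pre[symmetric]) simp_all
    also have "\<dots> = A1.phi X (h \<cdot>\<^bsub>D\<^esub> \<sigma> X)"
      using X Y h by (simp add: e A1.L.D.reassoc[OF e2])
    finally show ?thesis by simp
  qed
  ultimately show ?thesis unfolding conjugate_def
  proof (intro conjI ballI assms)
    show "nat_trans D C R2 R1 (mate \<sigma>)" if nat: "\<And>g. g \<in> Arr D \<Longrightarrow>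
        fa R1 g \<cdot>\<^bsub>C\<^esub> mate \<sigma> (Dom D g) = mate \<sigma> (Cod D g) \<cdot>\<^bsub>C\<^esub> fa R2 g"
      by (rule nat_transI[OF A2.R.additive_functor_axioms A1.R.additive_functor_axioms _ nat])
        (simp_all add: mate_def)
  qed simp
qed

lemma conjugate_unique:
  assumes "conjugate C D L1 R1 \<alpha>1 L2 R2 \<alpha>2 \<sigma> \<tau>" "Y \<in> Obj D"
  shows "\<tau> Y = mate \<sigma> Y"
proof -
  have nt: "nat_trans D C R2 R1 \<tau>" and
    c: "\<forall>X\<in>Obj C. \<forall>Y\<in>Obj D. \<forall>h\<in>hom_set D (fo L2 X) Y.
      A1.phi X (h \<cdot>\<^bsub>D\<^esub> \<sigma> X) = \<tau> Y \<cdot>\<^bsub>C\<^esub> A2.phi X h"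
    using assms unfolding conjugate_def by blast+
  note t [simp] = nat_transD(1-3)[OF nt]
  have "A1.phi (fo R2 Y) (\<beta>2 Y \<cdot>\<^bsub>D\<^esub> \<sigma> (fo R2 Y)) = \<tau> Y \<cdot>\<^bsub>C\<^esub> A2.phi (fo R2 Y) (\<beta>2 Y)"
    using assms(2) c by simp
  with assms(2) show ?thesis by (simp add: mate_def A2.phi_counit)
qed

lemma conjugateD:
  assumes "conjugate C D L1 R1 \<alpha>1 L2 R2 \<alpha>2 \<sigma> \<tau>" "X \<in> Obj C"
    and "h \<in> Arr D" "Dom D h = fo L2 X" "Cod D h = Y"
  shows "A1.phi X (h \<cdot>\<^bsub>D\<^esub> \<sigma> X) = \<tau> Y \<cdot>\<^bsub>C\<^esub> A2.phi X h"
proof -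
  have "h \<in> hom_set D (fo L2 X) Y" "Y \<in> Obj D" using assms by auto
  with assms(1,2) show ?thesis unfolding conjugate_def by blast
qed

end

text \<open>Conjugation is contravariant, so an inverse of \<open>\<sigma>\<close> conjugates to an inverse of \<open>\<tau>\<close>.\<close>

lemma (in adj2) conjugate_iso:
  assumes "conjugate C D L1 R1 \<alpha>1 L2 R2 \<alpha>2 \<sigma> \<tau>" "nat_iso C D L1 L2 \<sigma>"
  shows "nat_iso D C R2 R1 \<tau>"
proof -
  interpret B: adj2 C D L2 R2 \<alpha>2 \<beta>2 L1 R1 \<alpha>1 \<beta>1 ..
  let ?\<sigma>' = "\<lambda>X. inv_arrow D (\<sigma> X)"
  have nt: "nat_trans D C R2 R1 \<tau>" "nat_trans C D L1 L2 \<sigma>" "nat_trans C D L2 L1 ?\<sigma>'"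
    using assms nat_iso_inv[OF assms(2)] by (simp_all add: conjugate_def nat_iso_def)
  define \<tau>' where "\<tau>' = B.mate ?\<sigma>'"
  have c': "conjugate C D L2 R2 \<alpha>2 L1 R1 \<alpha>1 ?\<sigma>' \<tau>'"
    unfolding \<tau>'_def by (rule B.mate_conjugate[OF nt(3)])
  then have nt': "nat_trans D C R1 R2 \<tau>'" by (simp add: conjugate_def)
  note t [simp] = nat_transD(1-3)[OF nt(1)] nat_transD(1-3)[OF nt(2)] nat_transD(1-3)[OF nt(3)]
    nat_transD(1-3)[OF nt']
  have i: "?\<sigma>' X \<cdot>\<^bsub>D\<^esub> \<sigma> X = Ident D (fo L1 X)" "\<sigma> X \<cdot>\<^bsub>D\<^esub> ?\<sigma>' X = Ident D (fo L2 X)"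
    if "X \<in> Obj C" for X
    using inverse_arrowsD(5,6)[OF nat_iso_inverse[OF assms(2) that]] that by simp_all
  have "inverse_arrows C (\<tau> Y) (\<tau>' Y)" if Y: "Y \<in> Obj D" for Y
  proof -
    have "Ident C (fo R1 Y) = A1.phi (fo R1 Y) (\<beta>1 Y)"
      using Y by (simp add: A1.phi_counit)
    also have "\<dots> = A1.phi (fo R1 Y) ((\<beta>1 Y \<cdot>\<^bsub>D\<^esub> ?\<sigma>' (fo R1 Y)) \<cdot>\<^bsub>D\<^esub> \<sigma> (fo R1 Y))"
      using Y by (simp add: i)
    also have "\<dots> = \<tau> Y \<cdot>\<^bsub>C\<^esub> A2.phi (fo R1 Y) (\<beta>1 Y \<cdot>\<^bsub>D\<^esub> ?\<sigma>' (fo R1 Y))"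
      using Y by (intro conjugateD[OF assms(1)]) simp_all
    also have "A2.phi (fo R1 Y) (\<beta>1 Y \<cdot>\<^bsub>D\<^esub> ?\<sigma>' (fo R1 Y)) = \<tau>' Y"
      using B.conjugateD[OF c', of "fo R1 Y" "\<beta>1 Y" Y] Y by (simp add: A1.phi_counit)
    finally have 1: "\<tau> Y \<cdot>\<^bsub>C\<^esub> \<tau>' Y = Ident C (fo R1 Y)" by simp
    have "Ident C (fo R2 Y) = A2.phi (fo R2 Y) (\<beta>2 Y)"
      using Y by (simp add: A2.phi_counit)
    also have "\<dots> = A2.phi (fo R2 Y) ((\<beta>2 Y \<cdot>\<^bsub>D\<^esub> \<sigma> (fo R2 Y)) \<cdot>\<^bsub>D\<^esub> ?\<sigma>' (fo R2 Y))"
      using Y by (simp add: i)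
    also have "\<dots> = \<tau>' Y \<cdot>\<^bsub>C\<^esub> A1.phi (fo R2 Y) (\<beta>2 Y \<cdot>\<^bsub>D\<^esub> \<sigma> (fo R2 Y))"
      using Y by (intro B.conjugateD[OF c']) simp_all
    also have "A1.phi (fo R2 Y) (\<beta>2 Y \<cdot>\<^bsub>D\<^esub> \<sigma> (fo R2 Y)) = \<tau> Y"
      using conjugateD[OF assms(1), of "fo R2 Y" "\<beta>2 Y" Y] Y by (simp add: A2.phi_counit)
    finally have 2: "\<tau>' Y \<cdot>\<^bsub>C\<^esub> \<tau> Y = Ident C (fo R2 Y)" by simp
    from 1 2 Y show ?thesis by (simp add: inverse_arrows_def)
  qed
  then show ?thesis using nt(1) unfolding nat_iso_def iso_arrow_def by blast
qed

text \<open>A functor has a right adjoint as soon as every object of the target admits a universal arrow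
  from the functor: the action of the right adjoint on arrows, its unit and its additivity are all
  forced by the uniqueness of factorizations.\<close>

lemma adjunction_from_universal_arrows:
  fixes C :: "('o, 'a) cat" and D :: "('p, 'b) cat"
  assumes L: "additive_functor C D L"
    and r: "\<And>Y. Y \<in> Obj D \<Longrightarrow> r Y \<in> Obj C"
    and e: "\<And>Y. Y \<in> Obj D \<Longrightarrow> e Y \<in> hom_set D (fo L (r Y)) Y"
    and ex: "\<And>X Y g. X \<in> Obj C \<Longrightarrow> Y \<in> Obj D \<Longrightarrow> g \<in> hom_set D (fo L X) Y \<Longrightarrow>
      \<exists>k\<in>hom_set C X (r Y). e Y \<cdot>\<^bsub>D\<^esub> fa L k = g"
    and un: "\<And>X Y k k'. Y \<in> Obj D \<Longrightarrow> k \<in> hom_set C X (r Y) \<Longrightarrow>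
      k' \<in> hom_set C X (r Y) \<Longrightarrow> e Y \<cdot>\<^bsub>D\<^esub> fa L k = e Y \<cdot>\<^bsub>D\<^esub> fa L k' \<Longrightarrow> k = k'"
  obtains R l where "adjunction C D L R l e" "\<And>Y. fo R Y = r Y"
proof -
  interpret L: additive_functor C D L by fact
  have [simp]: "r Y \<in> Obj C" "e Y \<in> Arr D" "Dom D (e Y) = fo L (r Y)" "Cod D (e Y) = Y"
    if "Y \<in> Obj D" for Y
    using r e that by auto
  define t where "t X Y g = (SOME k. k \<in> hom_set C X (r Y) \<and> e Y \<cdot>\<^bsub>D\<^esub> fa L k = g)" for X Y g
  have t: "t X Y g \<in> hom_set C X (r Y) \<and> e Y \<cdot>\<^bsub>D\<^esub> fa L (t X Y g) = g"
    if "X \<in> Obj C" "Y \<in> Obj D" "g \<in> hom_set D (fo L X) Y" for X Y g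
  proof -
    have "\<exists>k. k \<in> hom_set C X (r Y) \<and> e Y \<cdot>\<^bsub>D\<^esub> fa L k = g" using ex[OF that] by blast
    then show ?thesis unfolding t_def by (rule someI_ex)
  qed
  define R where "R = \<lparr>fo = r, fa = \<lambda>f. t (r (Dom D f)) (Cod D f) (f \<cdot>\<^bsub>D\<^esub> e (Dom D f))\<rparr>"
  define l where "l X = t X (fo L X) (Ident D (fo L X))" for X
  have foR: "fo R Y = r Y" for Y by (simp add: R_def)
  have faR: "fa R f \<in> Arr C" "Dom C (fa R f) = r (Dom D f)" "Cod C (fa R f) = r (Cod D f)"
    and eR: "e (Cod D f) \<cdot>\<^bsub>D\<^esub> fa L (fa R f) = f \<cdot>\<^bsub>D\<^esub> e (Dom D f)" if "f \<in> Arr D" for f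
    using t[of "r (Dom D f)" "Cod D f" "f \<cdot>\<^bsub>D\<^esub> e (Dom D f)"] that by (simp_all add: R_def)
  have l: "l X \<in> Arr C" "Dom C (l X) = X" "Cod C (l X) = r (fo L X)"
    and el: "e (fo L X) \<cdot>\<^bsub>D\<^esub> fa L (l X) = Ident D (fo L X)" if "X \<in> Obj C" for X
    using t[of X "fo L X" "Ident D (fo L X)"] that by (simp_all add: l_def)
  note [simp] = faR l
  have R: "additive_functor D C R"
  proof unfold_locales
    fix f X Y assume "f \<in> hom_set D X Y" then show "fa R f \<in> hom_set C (fo R X) (fo R Y)"
      by (auto simp: foR)
  next
    fix X assume X: "X \<in> Obj D"
    have "fa R (Ident D X) = Ident C (r X)"
      using eR[of "Ident D X"] X by (intro un[of X _ "r X"]) simp_all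
    then show "fa R (Ident D X) = Ident C (fo R X)" by (simp add: foR)
  next
    fix f g X Y Z assume f: "f \<in> hom_set D X Y" and g: "g \<in> hom_set D Y Z"
    have Z: "Z \<in> Obj D" using g by auto
    have e1: "e Y \<cdot>\<^bsub>D\<^esub> fa L (fa R f) = f \<cdot>\<^bsub>D\<^esub> e X" using eR[of f] f by simp
    have e2: "e Z \<cdot>\<^bsub>D\<^esub> fa L (fa R g) = g \<cdot>\<^bsub>D\<^esub> e Y" using eR[of g] g by simp
    have e3: "e Z \<cdot>\<^bsub>D\<^esub> fa L (fa R (g \<cdot>\<^bsub>D\<^esub> f)) = (g \<cdot>\<^bsub>D\<^esub> f) \<cdot>\<^bsub>D\<^esub> e X"
      using eR[of "g \<cdot>\<^bsub>D\<^esub> f"] f g by simp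
    have O: "X \<in> Obj D" "Y \<in> Obj D" using f g by auto
    show "fa R (g \<cdot>\<^bsub>D\<^esub> f) = fa R g \<cdot>\<^bsub>C\<^esub> fa R f"
      using f g Z O by (intro un[of Z _ "r X"])
        (simp_all add: e3 L.D.reassoc[OF e2] e1)
  next
    fix f g X Y assume f: "f \<in> hom_set D X Y" and g: "g \<in> hom_set D X Y"
    have O: "X \<in> Obj D" "Y \<in> Obj D" using f by auto
    have e1: "e Y \<cdot>\<^bsub>D\<^esub> fa L (fa R h) = h \<cdot>\<^bsub>D\<^esub> e X" if "h \<in> hom_set D X Y" for h
      using eR[of h] that by auto
    have a: "Add D f g \<in> hom_set D X Y" using f g by simp
    have "e Y \<cdot>\<^bsub>D\<^esub> fa L (Add C (fa R f) (fa R g))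
      = e Y \<cdot>\<^bsub>D\<^esub> Add D (fa L (fa R f)) (fa L (fa R g))"
      using f g L.fa_add[of "fa R f" "r X" "r Y" "fa R g"] by simp
    also have "\<dots> = Add D (e Y \<cdot>\<^bsub>D\<^esub> fa L (fa R f)) (e Y \<cdot>\<^bsub>D\<^esub> fa L (fa R g))"
      using f g O by (intro L.D.comp_add_right) auto
    also have "\<dots> = Add D f g \<cdot>\<^bsub>D\<^esub> e X"
      unfolding e1[OF f] e1[OF g] using f g O by (intro L.D.comp_add_left[symmetric]) auto
    finally show "fa R (Add D f g) = Add C (fa R f) (fa R g)"
      using f g O e1[OF a] by (intro un[of Y _ "r X"]) simp_all
  qed (simp add: foR)
  interpret R: additive_functor D C R by (rule R)
  have l_nat: "fa R (fa L f) \<cdot>\<^bsub>C\<^esub> l (Dom C f) = l (Cod C f) \<cdot>\<^bsub>C\<^esub> f" if f: "f \<in> Arr C" for f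
  proof (rule un[of "fo L (Cod C f)" _ "Dom C f"])
    have e1: "e (fo L (Cod C f)) \<cdot>\<^bsub>D\<^esub> fa L (fa R (fa L f)) = fa L f \<cdot>\<^bsub>D\<^esub> e (fo L (Dom C f))"
      using eR[of "fa L f"] f by simp
    show "e (fo L (Cod C f)) \<cdot>\<^bsub>D\<^esub> fa L (fa R (fa L f) \<cdot>\<^bsub>C\<^esub> l (Dom C f)) =
      e (fo L (Cod C f)) \<cdot>\<^bsub>D\<^esub> fa L (l (Cod C f) \<cdot>\<^bsub>C\<^esub> f)"
      using f by (simp add: L.D.reassoc[OF e1] L.D.reassoc[OF el] el foR)
  qed (use f in \<open>simp_all add: foR\<close>)
  have tri: "fa R (e Y) \<cdot>\<^bsub>C\<^esub> l (r Y) = Ident C (r Y)" if Y: "Y \<in> Obj D" for Y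
  proof (rule un[of Y _ "r Y"])
    have e1: "e Y \<cdot>\<^bsub>D\<^esub> fa L (fa R (e Y)) = e Y \<cdot>\<^bsub>D\<^esub> e (fo L (r Y))"
      using eR[of "e Y"] Y by simp
    show "e Y \<cdot>\<^bsub>D\<^esub> fa L (fa R (e Y) \<cdot>\<^bsub>C\<^esub> l (r Y)) = e Y \<cdot>\<^bsub>D\<^esub> fa L (Ident C (r Y))"
      using Y by (simp add: L.D.reassoc[OF e1] el foR)
  qed (use Y in \<open>simp_all add: foR\<close>)
  have "adjunction C D L R l e" unfolding adjunction_def
    using l_nat tri el eR
    by (intro conjI nat_transI ballI L R additive_functor_comp[OF L R] additive_functor_comp[OF R L])
      (simp_all add: L.C.additive_functor_id L.D.additive_functor_id foR)
  then show thesis using foR by (rule that)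
qed


section \<open>Monads of adjunctions\<close>

lemma (in adj) monad_of_adjunction: "monad C (R \<odot> L) \<alpha> (\<lambda>X. fa R (\<beta> (fo L X)))"
proof -
  interpret RL: additive_functor C C "R \<odot> L"
    by (rule additive_functor_comp[OF L.additive_functor_axioms R.additive_functor_axioms])
  have n: "fa R (fa L f) \<cdot>\<^bsub>C\<^esub> fa R (\<beta> (fo L (Dom C f)))
      = fa R (\<beta> (fo L (Cod C f))) \<cdot>\<^bsub>C\<^esub> fa R (fa L (fa R (fa L f)))" if f: "f \<in> Arr C" for f
  proof -
    have "fa L f \<cdot>\<^bsub>D\<^esub> \<beta> (fo L (Dom C f)) = \<beta> (fo L (Cod C f)) \<cdot>\<^bsub>D\<^esub> fa L (fa R (fa L f))"
      using counit_nat[of "fa L f"] f by simp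
    then show ?thesis using f by (simp flip: R.fa_comp_simp)
  qed
  have assoc: "fa R (\<beta> (fo L X)) \<cdot>\<^bsub>C\<^esub> fa R (fa L (fa R (\<beta> (fo L X))))
      = fa R (\<beta> (fo L X)) \<cdot>\<^bsub>C\<^esub> fa R (\<beta> (fo L (fo R (fo L X))))" if X: "X \<in> Obj C" for X
    using counit_nat[of "\<beta> (fo L X)"] X by (simp flip: R.fa_comp_simp)
  have unit: "fa R (\<beta> (fo L X)) \<cdot>\<^bsub>C\<^esub> fa R (fa L (\<alpha> X)) = Ident C (fo R (fo L X))"
    if X: "X \<in> Obj C" for X
    using triangles(1)[OF X] X by (simp flip: R.fa_comp_simp)
  show ?thesis unfolding monad_def
    using n assoc unit
    by (intro conjI nat_transI ballI unit_nat_trans RL.additive_functor_axioms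
        additive_functor_comp[OF RL.additive_functor_axioms RL.additive_functor_axioms])
      (simp_all add: triangles)
qed

text \<open>The componentwise inverses automatically form a morphism of monads.\<close>

lemma monad_isoI:
  assumes "monad_morphism D T1 \<eta>1 \<mu>1 T2 \<eta>2 \<mu>2 \<delta>" "\<And>X. X \<in> Obj D \<Longrightarrow> iso_arrow D (\<delta> X)"
  shows "monad_iso D T1 \<eta>1 \<mu>1 T2 \<eta>2 \<mu>2 \<delta>"
proof -
  have m: "monad D T1 \<eta>1 \<mu>1" "monad D T2 \<eta>2 \<mu>2" and nt: "nat_trans D D T1 T2 \<delta>"
    and unit: "\<And>X. X \<in> Obj D \<Longrightarrow> \<eta>2 X = \<delta> X \<cdot>\<^bsub>D\<^esub> \<eta>1 X"
    and mult: "\<And>X. X \<in> Obj D \<Longrightarrow>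
      \<mu>2 X \<cdot>\<^bsub>D\<^esub> (fa T2 (\<delta> X) \<cdot>\<^bsub>D\<^esub> \<delta> (fo T1 X)) = \<delta> X \<cdot>\<^bsub>D\<^esub> \<mu>1 X"
    using assms(1) by (simp_all add: monad_morphism_def)
  have ni: "nat_iso D D T1 T2 \<delta>" using nt assms(2) by (simp add: nat_iso_def)
  interpret T1: additive_functor D D T1 using nt by (simp add: nat_trans_def)
  interpret T2: additive_functor D D T2 using nt by (simp add: nat_trans_def)
  define d where "d X = inv_arrow D (\<delta> X)" for X
  have nti: "nat_trans D D T2 T1 d"
    using nat_iso_inv[OF ni] unfolding nat_iso_def d_def by blast
  have ntm: "nat_trans D D id_func T1 \<eta>1" "nat_trans D D (T1 \<odot> T1) T1 \<mu>1"
     "nat_trans D D id_func T2 \<eta>2" "nat_trans D D (T2 \<odot> T2) T2 \<mu>2"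
    using m by (simp_all add: monad_def)
  note [simp] = nat_transD(1-3)[OF nt] nat_transD(1-3)[OF nti] nat_transD(1-3)[OF ntm(1)]
    nat_transD(1-3)[OF ntm(2)] nat_transD(1-3)[OF ntm(3)] nat_transD(1-3)[OF ntm(4)]
  have i: "d X \<cdot>\<^bsub>D\<^esub> \<delta> X = Ident D (fo T1 X)" "\<delta> X \<cdot>\<^bsub>D\<^esub> d X = Ident D (fo T2 X)"
    if "X \<in> Obj D" for X
    using inverse_arrowsD(5,6)[OF nat_iso_inverse[OF ni that]] that by (simp_all add: d_def)
  have unit': "\<eta>1 X = d X \<cdot>\<^bsub>D\<^esub> \<eta>2 X" if X: "X \<in> Obj D" for X
    using X by (simp add: unit T1.C.reassoc[OF i(1)])
  have mult': "\<mu>1 X \<cdot>\<^bsub>D\<^esub> (fa T1 (d X) \<cdot>\<^bsub>D\<^esub> d (fo T2 X)) = d X \<cdot>\<^bsub>D\<^esub> \<mu>2 X" if X: "X \<in> Obj D" for X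
  proof -
    have n: "\<delta> (fo T1 X) \<cdot>\<^bsub>D\<^esub> fa T1 (d X) = fa T2 (d X) \<cdot>\<^bsub>D\<^esub> \<delta> (fo T2 X)"
      using nat_transD(4)[OF nt, of "d X"] X by simp
    have n': "fa T2 (\<delta> X) \<cdot>\<^bsub>D\<^esub> fa T2 (d X) = Ident D (fo T2 (fo T2 X))"
      using i(2)[OF X] X by (simp flip: T2.fa_comp_simp)
    have "\<mu>1 X = d X \<cdot>\<^bsub>D\<^esub> (\<delta> X \<cdot>\<^bsub>D\<^esub> \<mu>1 X)"
      using X by (simp add: T1.C.reassoc[OF i(1)])
    then have e: "\<mu>1 X = d X \<cdot>\<^bsub>D\<^esub> (\<mu>2 X \<cdot>\<^bsub>D\<^esub> (fa T2 (\<delta> X) \<cdot>\<^bsub>D\<^esub> \<delta> (fo T1 X)))"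
      using mult[OF X] by simp
    show ?thesis unfolding e
      using X by (simp add: T1.C.reassoc[OF n] T1.C.reassoc[OF n'] n' i(2))
  qed
  have "monad_morphism D T2 \<eta>2 \<mu>2 T1 \<eta>1 \<mu>1 d"
    unfolding monad_morphism_def using m nti unit' mult' by blast
  with assms(1) i show ?thesis unfolding monad_iso_def by blast
qed

lemma monad_iso_component:
  assumes "monad_iso D T1 \<eta>1 \<mu>1 T2 \<eta>2 \<mu>2 \<delta>" "X \<in> Obj D"
  shows "iso_arrow D (\<delta> X)"
proof -
  obtain \<delta>' where d: "monad_morphism D T2 \<eta>2 \<mu>2 T1 \<eta>1 \<mu>1 \<delta>'"
    "\<And>X. X \<in> Obj D \<Longrightarrow> \<delta>' X \<cdot>\<^bsub>D\<^esub> \<delta> X = Ident D (fo T1 X) \<and> \<delta> X \<cdot>\<^bsub>D\<^esub> \<delta>' X = Ident D (fo T2 X)"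
    using assms(1) unfolding monad_iso_def by blast
  have nt: "nat_trans D D T1 T2 \<delta>" "nat_trans D D T2 T1 \<delta>'"
    using assms(1) d(1) by (simp_all add: monad_iso_def monad_morphism_def)
  have "inverse_arrows D (\<delta> X) (\<delta>' X)"
    using d(2)[OF assms(2)] nat_transD(1-3)[OF nt(1) assms(2)] nat_transD(1-3)[OF nt(2) assms(2)]
    by (simp add: inverse_arrows_def)
  then show ?thesis by (auto simp: iso_arrow_def)
qed


section \<open>Faithful right adjoints out of abelian categories\<close>

locale faithful_adj = adj C D L R \<alpha> \<beta> + DA: abelian_category D
  for C :: "('o, 'a) cat" and D :: "('p, 'b) cat" and L R \<alpha> \<beta> +
  assumes faithful_right: "faithful D R"
begin

lemma R_inject:
  assumes "f \<in> Arr D" "g \<in> Arr D" "Dom D f = Dom D g" "Cod D f = Cod D g" "fa R f = fa R g"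
  shows "f = g"
proof -
  have "inj_on (fa R) (hom_set D (Dom D g) (Cod D g))"
    using faithful_right assms(2) by (simp add: faithful_def)
  with assms show ?thesis by (simp add: inj_on_def)
qed

lemma counit_fork:
  assumes "Y \<in> Obj D"
  shows "\<beta> Y \<cdot>\<^bsub>D\<^esub> \<beta> (fo L (fo R Y)) = \<beta> Y \<cdot>\<^bsub>D\<^esub> fa L (fa R (\<beta> Y))"
  using counit_nat[of "\<beta> Y"] assms by simp

text \<open>The counit \<open>\<beta> Y\<close> is epi, hence the cokernel of some \<open>k\<close>. An arrow that equalizes the two parallel
  arrows kills \<open>k \<cdot> \<beta> K\<close>, where \<open>K\<close> is the domain of \<open>k\<close>, and then kills \<open>k\<close>, as \<open>\<beta> K\<close> is epi too.\<close>

lemma counit_coequalizer: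
  assumes Y: "Y \<in> Obj D"
  shows "coequalizer_of D (\<beta> Y) (\<beta> (fo L (fo R Y))) (fa L (fa R (\<beta> Y)))"
proof -
  have epi: "epi_arrow D (\<beta> Y)" by (rule faithful_counit_epi[OF faithful_right Y])
  then obtain k where k: "cokernel_of D (\<beta> Y) k" using DA.epi_is_cokernel by blast
  have kt: "k \<in> Arr D" "Cod D k = fo L (fo R Y)"
    and bk: "\<beta> Y \<cdot>\<^bsub>D\<^esub> k = Zer D (Dom D k) Y"
    using k Y by (simp_all add: cokernel_of_def)
  have univ: "\<exists>!u. u \<in> hom_set D Y W \<and> u \<cdot>\<^bsub>D\<^esub> \<beta> Y = h"
    if "W \<in> Obj D" "h \<in> hom_set D (fo L (fo R Y)) W" "h \<cdot>\<^bsub>D\<^esub> k = Zer D (Dom D k) W" for W h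
    using k that kt Y unfolding cokernel_of_def by simp
  let ?K = "Dom D k"
  have K: "?K \<in> Obj D" using kt by simp
  show ?thesis
  proof (rule coequalizerI)
    fix h assume h: "h \<in> Arr D" "Dom D h = Dom D (\<beta> Y)"
      and eq: "h \<cdot>\<^bsub>D\<^esub> \<beta> (fo L (fo R Y)) = h \<cdot>\<^bsub>D\<^esub> fa L (fa R (\<beta> Y))"
    have h': "Dom D h = fo L (fo R Y)" using h(2) Y by simp
    have n: "k \<cdot>\<^bsub>D\<^esub> \<beta> ?K = \<beta> (fo L (fo R Y)) \<cdot>\<^bsub>D\<^esub> fa L (fa R k)"
      using counit_nat[OF kt(1)] kt by simp
    have "h \<cdot>\<^bsub>D\<^esub> k \<cdot>\<^bsub>D\<^esub> \<beta> ?K = (h \<cdot>\<^bsub>D\<^esub> \<beta> (fo L (fo R Y))) \<cdot>\<^bsub>D\<^esub> fa L (fa R k)"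
      using h(1) h' kt K Y by (simp add: n)
    also have "\<dots> = h \<cdot>\<^bsub>D\<^esub> fa L (fa R (\<beta> Y \<cdot>\<^bsub>D\<^esub> k))"
      unfolding eq using h(1) h' kt K Y by simp
    also have "\<dots> = Zer D ?K (Cod D h) \<cdot>\<^bsub>D\<^esub> \<beta> ?K"
      using h(1) h' kt K Y
      by (simp add: bk L.fa_zero R.fa_zero L.D.comp_zero L.D.zero_comp)
    finally have eq': "(h \<cdot>\<^bsub>D\<^esub> k) \<cdot>\<^bsub>D\<^esub> \<beta> ?K = Zer D ?K (Cod D h) \<cdot>\<^bsub>D\<^esub> \<beta> ?K"
      using h(1) h' kt K by simp
    have "Cod D h \<in> Obj D" "h \<cdot>\<^bsub>D\<^esub> k \<in> hom_set D (Cod D (\<beta> ?K)) (Cod D h)"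
      "Zer D ?K (Cod D h) \<in> hom_set D (Cod D (\<beta> ?K)) (Cod D h)"
      using h(1) h' kt K by simp_all
    with eq' have "h \<cdot>\<^bsub>D\<^esub> k = Zer D ?K (Cod D h)"
      using faithful_counit_epi[OF faithful_right K] unfolding epi_arrow_def by blast
    then have "\<exists>!u. u \<in> hom_set D Y (Cod D h) \<and> u \<cdot>\<^bsub>D\<^esub> \<beta> Y = h"
      using h(1) h' \<open>Cod D h \<in> Obj D\<close> by (intro univ) simp_all
    moreover have "Cod D (\<beta> Y) = Y" using Y by simp
    ultimately show "\<exists>u\<in>hom_set D (Cod D (\<beta> Y)) (Cod D h). u \<cdot>\<^bsub>D\<^esub> \<beta> Y = h"
      unfolding Bex_def by (simp only:) (erule ex1E, blast)
  next
    fix u v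
    assume uv: "u \<in> Arr D" "v \<in> Arr D" "Dom D u = Cod D (\<beta> Y)" "Dom D v = Cod D (\<beta> Y)"
      "Cod D u = Cod D v" and eq: "u \<cdot>\<^bsub>D\<^esub> \<beta> Y = v \<cdot>\<^bsub>D\<^esub> \<beta> Y"
    have "Cod D v \<in> Obj D" "u \<in> hom_set D (Cod D (\<beta> Y)) (Cod D v)"
      "v \<in> hom_set D (Cod D (\<beta> Y)) (Cod D v)" using uv by simp_all
    with epi eq show "u = v" unfolding epi_arrow_def by blast
  qed (use Y counit_fork in simp_all)
qed

text \<open>An arrow between objects \<open>R M\<close> and \<open>R N\<close> that respects the actions of the monad \<open>R L\<close> comes
  from \<open>D\<close>: the comparison functor to the algebras of \<open>R L\<close> is full.\<close>

lemma comparison_full: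
  assumes M: "M \<in> Obj D" and N: "N \<in> Obj D" and h: "h \<in> Arr C" "Dom C h = fo R M" "Cod C h = fo R N"
    and alg: "h \<cdot>\<^bsub>C\<^esub> fa R (\<beta> M) = fa R (\<beta> N) \<cdot>\<^bsub>C\<^esub> fa R (fa L h)"
  shows "\<exists>k\<in>hom_set D M N. fa R k = h"
proof -
  have f: "psi N h \<in> Arr D" "Dom D (psi N h) = fo L (fo R M)" "Cod D (psi N h) = N"
    using N h by simp_all
  have "psi N h \<cdot>\<^bsub>D\<^esub> \<beta> (fo L (fo R M)) = psi N (fa R (psi N h))"
    using psi_post[of "psi N h" "fo L (fo R M)" N "Ident C (fo R (fo L (fo R M)))"] f M N h
    by (simp add: psi_ident)
  also have "\<dots> = psi N (h \<cdot>\<^bsub>C\<^esub> fa R (\<beta> M))"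
    using M N h by (simp add: psi_def alg)
  also have "\<dots> = psi N h \<cdot>\<^bsub>D\<^esub> fa L (fa R (\<beta> M))"
    using M N h by (intro psi_pre) simp_all
  finally obtain k where k: "k \<in> Arr D" "Dom D k = M" "Cod D k = N" "k \<cdot>\<^bsub>D\<^esub> \<beta> M = psi N h"
    using coequalizer_factor[OF counit_coequalizer[OF M], of "psi N h"] f M by auto
  have "fa R k = phi (fo R M) (k \<cdot>\<^bsub>D\<^esub> \<beta> M)"
    using M k(1-3) by (simp add: phi_post phi_counit)
  also have "\<dots> = h" unfolding k(4) using N h by simp
  finally show ?thesis using k by auto
qed

text \<open>An inverse of a homomorphism of algebras is a homomorphism, so it comes from \<open>D\<close> as well.\<close>

lemma R_reflects_iso:
  assumes k: "k \<in> Arr D" and iso: "iso_arrow C (fa R k)"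
  shows "iso_arrow D k"
proof -
  let ?M = "Dom D k" and ?N = "Cod D k"
  obtain h where h: "inverse_arrows C (fa R k) h" using iso by (auto simp: iso_arrow_def)
  have ht: "h \<in> Arr C" "Dom C h = fo R ?N" "Cod C h = fo R ?M"
    and hk: "h \<cdot>\<^bsub>C\<^esub> fa R k = Ident C (fo R ?M)" and kh: "fa R k \<cdot>\<^bsub>C\<^esub> h = Ident C (fo R ?N)"
    using inverse_arrowsD[OF h] k by simp_all
  have n: "fa R (\<beta> ?N) \<cdot>\<^bsub>C\<^esub> fa R (fa L (fa R k)) = fa R k \<cdot>\<^bsub>C\<^esub> fa R (\<beta> ?M)"
    using counit_nat[OF k] k by (simp flip: R.fa_comp_simp)
  have l: "fa R (fa L (fa R k)) \<cdot>\<^bsub>C\<^esub> fa R (fa L h) = Ident C (fo R (fo L (fo R ?N)))"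
    using kh ht k by (simp flip: R.fa_comp_simp L.fa_comp_simp)
  have "h \<cdot>\<^bsub>C\<^esub> fa R (\<beta> ?N) = h \<cdot>\<^bsub>C\<^esub> fa R (\<beta> ?N) \<cdot>\<^bsub>C\<^esub> (fa R (fa L (fa R k)) \<cdot>\<^bsub>C\<^esub> fa R (fa L h))"
    unfolding l using ht k by simp
  also have "\<dots> = fa R (\<beta> ?M) \<cdot>\<^bsub>C\<^esub> fa R (fa L h)"
    using ht k by (simp add: L.C.reassoc[OF n] L.C.reassoc[OF hk])
  finally obtain k' where k': "k' \<in> hom_set D ?N ?M" "fa R k' = h"
    using comparison_full[of ?N ?M h] ht k by auto
  have "k' \<cdot>\<^bsub>D\<^esub> k = Ident D ?M" by (rule R_inject) (use k k' hk in simp_all)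
  moreover have "k \<cdot>\<^bsub>D\<^esub> k' = Ident D ?N" by (rule R_inject) (use k k' kh in simp_all)
  ultimately have "inverse_arrows D k k'" using k k' by (simp add: inverse_arrows_def)
  then show ?thesis by (auto simp: iso_arrow_def)
qed

text \<open>Every object of \<open>D\<close> is a coequalizer of arrows between objects \<open>L X\<close>. If a functor preserves these
  coequalizers, then a transformation out of it is determined by its components at the objects \<open>L X\<close>.\<close>

lemma nat_trans_determined:
  assumes nt: "nat_trans D E F F' \<zeta>" "nat_trans D E F F' \<zeta>'"
    and pres: "\<And>M. M \<in> Obj D \<Longrightarrow>
      coequalizer_of E (fa F (\<beta> M)) (fa F (\<beta> (fo L (fo R M)))) (fa F (fa L (fa R (\<beta> M))))"
    and eq: "\<And>X. X \<in> Obj C \<Longrightarrow> \<zeta> (fo L X) = \<zeta>' (fo L X)"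
    and M: "M \<in> Obj D"
  shows "\<zeta> M = \<zeta>' M"
proof -
  interpret F: additive_functor D E F using nt(1) by (simp add: nat_trans_def)
  interpret F': additive_functor D E F' using nt(1) by (simp add: nat_trans_def)
  note t = nat_transD(1-3)[OF nt(1)] nat_transD(1-3)[OF nt(2)]
  have "\<zeta> M \<cdot>\<^bsub>E\<^esub> fa F (\<beta> M) = \<zeta>' M \<cdot>\<^bsub>E\<^esub> fa F (\<beta> M)"
    using nat_transD(4)[OF nt(1), of "\<beta> M"] nat_transD(4)[OF nt(2), of "\<beta> M"] eq[of "fo R M"] M
    by simp
  then show ?thesis by (rule coequalizer_epi[OF pres[OF M], rotated -1]) (use t M in simp_all)
qed

text \<open>A family \<open>w\<close> on the objects \<open>L X\<close> that is natural for all arrows between them, including the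
  counits, induces an arrow between the coequalizers at every \<open>M\<close>.\<close>

lemma nat_trans_extension:
  assumes F: "additive_functor D E F" and F': "additive_functor D E F'"
    and pres: "\<And>M. M \<in> Obj D \<Longrightarrow>
      coequalizer_of E (fa F (\<beta> M)) (fa F (\<beta> (fo L (fo R M)))) (fa F (fa L (fa R (\<beta> M))))"
    and w: "\<And>X. X \<in> Obj C \<Longrightarrow> w X \<in> hom_set E (fo F (fo L X)) (fo F' (fo L X))"
    and w_nat: "\<And>X Y h. X \<in> Obj C \<Longrightarrow> Y \<in> Obj C \<Longrightarrow> h \<in> hom_set D (fo L X) (fo L Y) \<Longrightarrow>
      w Y \<cdot>\<^bsub>E\<^esub> fa F h = fa F' h \<cdot>\<^bsub>E\<^esub> w X"
  obtains \<zeta> where "nat_trans D E F F' \<zeta>" "\<And>X. X \<in> Obj C \<Longrightarrow> \<zeta> (fo L X) = w X"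
proof -
  interpret F: additive_functor D E F by fact
  interpret F': additive_functor D E F' by fact
  have [simp]: "w X \<in> Arr E" "Dom E (w X) = fo F (fo L X)" "Cod E (w X) = fo F' (fo L X)"
    if "X \<in> Obj C" for X using w[OF that] by simp_all
  have ex: "\<exists>u. u \<in> hom_set E (fo F M) (fo F' M) \<and>
      u \<cdot>\<^bsub>E\<^esub> fa F (\<beta> M) = fa F' (\<beta> M) \<cdot>\<^bsub>E\<^esub> w (fo R M)" if M: "M \<in> Obj D" for M
  proof -
    let ?h = "fa F' (\<beta> M) \<cdot>\<^bsub>E\<^esub> w (fo R M)"
    have 1: "w (fo R M) \<cdot>\<^bsub>E\<^esub> fa F (\<beta> (fo L (fo R M)))
        = fa F' (\<beta> (fo L (fo R M))) \<cdot>\<^bsub>E\<^esub> w (fo R (fo L (fo R M)))"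
      using M by (intro w_nat) simp_all
    have 2: "w (fo R M) \<cdot>\<^bsub>E\<^esub> fa F (fa L (fa R (\<beta> M)))
        = fa F' (fa L (fa R (\<beta> M))) \<cdot>\<^bsub>E\<^esub> w (fo R (fo L (fo R M)))"
      using M by (intro w_nat) simp_all
    have 3: "fa F' (\<beta> M) \<cdot>\<^bsub>E\<^esub> fa F' (\<beta> (fo L (fo R M)))
        = fa F' (\<beta> M) \<cdot>\<^bsub>E\<^esub> fa F' (fa L (fa R (\<beta> M)))"
      using counit_fork[OF M] M by (simp flip: F'.fa_comp_simp)
    have "?h \<cdot>\<^bsub>E\<^esub> fa F (\<beta> (fo L (fo R M))) = ?h \<cdot>\<^bsub>E\<^esub> fa F (fa L (fa R (\<beta> M)))"
      using M by (simp add: 1 2 F.D.reassoc[OF 3])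
    then obtain u where "u \<in> Arr E" "Dom E u = Cod E (fa F (\<beta> M))" "Cod E u = Cod E ?h"
        "u \<cdot>\<^bsub>E\<^esub> fa F (\<beta> M) = ?h"
      using M by (elim coequalizer_factor[OF pres[OF M], rotated 2]) simp_all
    then show ?thesis using M by (intro exI[of _ u]) simp
  qed
  define \<zeta> where "\<zeta> M = (SOME u. u \<in> hom_set E (fo F M) (fo F' M) \<and>
      u \<cdot>\<^bsub>E\<^esub> fa F (\<beta> M) = fa F' (\<beta> M) \<cdot>\<^bsub>E\<^esub> w (fo R M))" for M
  have z: "\<zeta> M \<in> hom_set E (fo F M) (fo F' M) \<and>
      \<zeta> M \<cdot>\<^bsub>E\<^esub> fa F (\<beta> M) = fa F' (\<beta> M) \<cdot>\<^bsub>E\<^esub> w (fo R M)" if "M \<in> Obj D" for M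
    unfolding \<zeta>_def by (rule someI_ex[OF ex[OF that]])
  have [simp]: "\<zeta> M \<in> Arr E" "Dom E (\<zeta> M) = fo F M" "Cod E (\<zeta> M) = fo F' M"
    and zb: "\<zeta> M \<cdot>\<^bsub>E\<^esub> fa F (\<beta> M) = fa F' (\<beta> M) \<cdot>\<^bsub>E\<^esub> w (fo R M)" if "M \<in> Obj D" for M
    using z[OF that] by simp_all
  have nat: "fa F' f \<cdot>\<^bsub>E\<^esub> \<zeta> (Dom D f) = \<zeta> (Cod D f) \<cdot>\<^bsub>E\<^esub> fa F f" if f: "f \<in> Arr D" for f
  proof (rule coequalizer_epi[OF pres[of "Dom D f"]])
    let ?M = "Dom D f" and ?N = "Cod D f"
    have 1: "fa F' f \<cdot>\<^bsub>E\<^esub> fa F' (\<beta> ?M) = fa F' (\<beta> ?N) \<cdot>\<^bsub>E\<^esub> fa F' (fa L (fa R f))"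
      using counit_nat[OF f] f by (simp flip: F'.fa_comp_simp)
    have 2: "fa F f \<cdot>\<^bsub>E\<^esub> fa F (\<beta> ?M) = fa F (\<beta> ?N) \<cdot>\<^bsub>E\<^esub> fa F (fa L (fa R f))"
      using counit_nat[OF f] f by (simp flip: F.fa_comp_simp)
    have 3: "w (fo R ?N) \<cdot>\<^bsub>E\<^esub> fa F (fa L (fa R f)) = fa F' (fa L (fa R f)) \<cdot>\<^bsub>E\<^esub> w (fo R ?M)"
      using f by (intro w_nat) simp_all
    show "(fa F' f \<cdot>\<^bsub>E\<^esub> \<zeta> ?M) \<cdot>\<^bsub>E\<^esub> fa F (\<beta> ?M) = (\<zeta> ?N \<cdot>\<^bsub>E\<^esub> fa F f) \<cdot>\<^bsub>E\<^esub> fa F (\<beta> ?M)"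
      using f by (simp add: zb 2 3 F.D.reassoc[OF 1] F.D.reassoc[OF zb])
  qed (use f in simp_all)
  have ext: "\<zeta> (fo L X) = w X" if X: "X \<in> Obj C" for X
  proof (rule coequalizer_epi[OF pres[of "fo L X"]])
    have "w X \<cdot>\<^bsub>E\<^esub> fa F (\<beta> (fo L X)) = fa F' (\<beta> (fo L X)) \<cdot>\<^bsub>E\<^esub> w (fo R (fo L X))"
      using X by (intro w_nat) simp_all
    then show "\<zeta> (fo L X) \<cdot>\<^bsub>E\<^esub> fa F (\<beta> (fo L X)) = w X \<cdot>\<^bsub>E\<^esub> fa F (\<beta> (fo L X))"
      using X by (simp add: zb)
  qed (use X in simp_all)
  have "nat_trans D E F F' \<zeta>"
    by (rule nat_transI[OF F F' _ nat]) simp_all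
  then show thesis using ext by (rule that)
qed

lemma nat_iso_extension:
  assumes F: "additive_functor D E F" and F': "additive_functor D E F'"
    and pres: "\<And>M. M \<in> Obj D \<Longrightarrow>
      coequalizer_of E (fa F (\<beta> M)) (fa F (\<beta> (fo L (fo R M)))) (fa F (fa L (fa R (\<beta> M))))"
    and pres': "\<And>M. M \<in> Obj D \<Longrightarrow>
      coequalizer_of E (fa F' (\<beta> M)) (fa F' (\<beta> (fo L (fo R M)))) (fa F' (fa L (fa R (\<beta> M))))"
    and w: "\<And>X. X \<in> Obj C \<Longrightarrow> w X \<in> hom_set E (fo F (fo L X)) (fo F' (fo L X))"
    and w_iso: "\<And>X. X \<in> Obj C \<Longrightarrow> iso_arrow E (w X)"
    and w_nat: "\<And>X Y h. X \<in> Obj C \<Longrightarrow> Y \<in> Obj C \<Longrightarrow> h \<in> hom_set D (fo L X) (fo L Y) \<Longrightarrow>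
      w Y \<cdot>\<^bsub>E\<^esub> fa F h = fa F' h \<cdot>\<^bsub>E\<^esub> w X"
  obtains \<zeta> where "nat_iso D E F F' \<zeta>" "\<And>X. X \<in> Obj C \<Longrightarrow> \<zeta> (fo L X) = w X"
proof -
  interpret F: additive_functor D E F by fact
  interpret F': additive_functor D E F' by fact
  define w' where "w' X = inv_arrow E (w X)" for X
  have [simp]: "w X \<in> Arr E" "Dom E (w X) = fo F (fo L X)" "Cod E (w X) = fo F' (fo L X)"
    if "X \<in> Obj C" for X using w[OF that] by simp_all
  have [simp]: "w' X \<in> Arr E" "Dom E (w' X) = fo F' (fo L X)" "Cod E (w' X) = fo F (fo L X)"
    and i: "w' X \<cdot>\<^bsub>E\<^esub> w X = Ident E (fo F (fo L X))" "w X \<cdot>\<^bsub>E\<^esub> w' X = Ident E (fo F' (fo L X))"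
    if "X \<in> Obj C" for X
    using inverse_arrowsD[OF F.D.inv_arrow_inverse[OF w_iso[OF that]]] that
    by (simp_all add: w'_def)
  have w'_nat: "w' Y \<cdot>\<^bsub>E\<^esub> fa F' h = fa F h \<cdot>\<^bsub>E\<^esub> w' X"
    if X: "X \<in> Obj C" and Y: "Y \<in> Obj C" and h: "h \<in> hom_set D (fo L X) (fo L Y)" for X Y h
  proof -
    have "w' Y \<cdot>\<^bsub>E\<^esub> fa F' h = w' Y \<cdot>\<^bsub>E\<^esub> (fa F' h \<cdot>\<^bsub>E\<^esub> w X) \<cdot>\<^bsub>E\<^esub> w' X"
      using X Y h by (simp add: i)
    also have "\<dots> = fa F h \<cdot>\<^bsub>E\<^esub> w' X"
      unfolding w_nat[OF that, symmetric] using X Y h by (simp add: F.D.reassoc[OF i(1)])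
    finally show ?thesis .
  qed
  obtain \<zeta> where z: "nat_trans D E F F' \<zeta>" "\<And>X. X \<in> Obj C \<Longrightarrow> \<zeta> (fo L X) = w X"
    using nat_trans_extension[OF F F' pres w w_nat] by blast
  obtain \<zeta>' where z': "nat_trans D E F' F \<zeta>'" "\<And>X. X \<in> Obj C \<Longrightarrow> \<zeta>' (fo L X) = w' X"
    using nat_trans_extension[OF F' F pres', of w'] w'_nat by auto
  note [simp] = nat_transD(1-3)[OF z(1)] nat_transD(1-3)[OF z'(1)]
  have comp: "nat_trans D E G G (\<lambda>M. \<tau>' M \<cdot>\<^bsub>E\<^esub> \<tau> M)"
    if nt: "nat_trans D E G G' \<tau>" "nat_trans D E G' G \<tau>'" for G G' \<tau> \<tau>'
  proof -
    interpret G: additive_functor D E G using nt(1) by (simp add: nat_trans_def)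
    interpret G': additive_functor D E G' using nt(1) by (simp add: nat_trans_def)
    note [simp] = nat_transD(1-3)[OF nt(1)] nat_transD(1-3)[OF nt(2)]
    show ?thesis
    proof (rule nat_transI[OF G.additive_functor_axioms G.additive_functor_axioms])
      fix f assume f: "f \<in> Arr D"
      show "fa G f \<cdot>\<^bsub>E\<^esub> (\<tau>' (Dom D f) \<cdot>\<^bsub>E\<^esub> \<tau> (Dom D f))
        = (\<tau>' (Cod D f) \<cdot>\<^bsub>E\<^esub> \<tau> (Cod D f)) \<cdot>\<^bsub>E\<^esub> fa G f"
        using f nat_transD(4)[OF nt(1) f, symmetric]
        by (simp add: F.D.reassoc[OF nat_transD(4)[OF nt(2) f]])
    qed simp
  qed
  have idn: "nat_trans D E G G (id_trans E G)" if "additive_functor D E G" for G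
  proof -
    interpret G: additive_functor D E G by fact
    show ?thesis by (rule nat_transI[OF that that]) (simp_all add: id_trans_def)
  qed
  have "inverse_arrows E (\<zeta> M) (\<zeta>' M)" if M: "M \<in> Obj D" for M
  proof -
    have "\<zeta>' M \<cdot>\<^bsub>E\<^esub> \<zeta> M = id_trans E F M"
      by (rule nat_trans_determined[OF comp[OF z(1) z'(1)] idn[OF F] pres _ M])
        (simp_all add: z z' i id_trans_def)
    moreover have "\<zeta> M \<cdot>\<^bsub>E\<^esub> \<zeta>' M = id_trans E F' M"
      by (rule nat_trans_determined[OF comp[OF z'(1) z(1)] idn[OF F'] pres' _ M])
        (simp_all add: z z' i id_trans_def)
    ultimately show ?thesis using M by (simp add: inverse_arrows_def id_trans_def)
  qed
  then have "nat_iso D E F F' \<zeta>" using z(1) unfolding nat_iso_def iso_arrow_def by blast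
  then show thesis using z(2) by (rule that)
qed

end


section \<open>Monad morphisms as functors between Kleisli categories\<close>

locale two_adj = S: adj D A S U \<alpha>1 \<beta>1 + T: adj D A T R \<alpha>3 \<beta>3
  for D :: "('p, 'b) cat" and A :: "('o, 'a) cat" and S U \<alpha>1 \<beta>1 T R \<alpha>3 \<beta>3
begin

text \<open>The composite
  \<open>A(S X, S Y) \<cong> D(X, U S Y) \<rightarrow> D(X, R T Y) \<cong> A(T X, T Y)\<close> of the two transpositions and \<open>\<gamma> Y\<close>.
  It depends on \<open>X\<close> and \<open>Y\<close> and not just on the arrow, as \<open>S\<close> need not be injective on objects.\<close>

definition kl :: "('p \<Rightarrow> 'b) \<Rightarrow> 'p \<Rightarrow> 'p \<Rightarrow> 'a \<Rightarrow> 'a" where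
  "kl \<gamma> X Y h = T.psi (fo T Y) (\<gamma> Y \<cdot>\<^bsub>D\<^esub> S.phi X h)"

text \<open>The component \<open>\<gamma> X\<close> is the transpose of the translation \<open>b X\<close> of \<open>\<beta>1 (S X)\<close>. Naturality and the
  multiplication law are transposes of the translations of \<open>S f \<cdot> \<beta>1 (S X)\<close> and of
  \<open>\<beta>1 (S X) \<cdot> \<beta>1 (S (U (S X)))\<close>, and the unit law is that of an identity.\<close>

lemma monad_morphismI:
  assumes g: "\<And>X. X \<in> Obj D \<Longrightarrow> \<gamma> X \<in> hom_set D (fo U (fo S X)) (fo R (fo T X))"
    and kl_S: "\<And>f. f \<in> Arr D \<Longrightarrow> kl \<gamma> (Dom D f) (Cod D f) (fa S f) = fa T f"
    and kl_comp: "\<And>X Y Z h k. X \<in> Obj D \<Longrightarrow> Y \<in> Obj D \<Longrightarrow> Z \<in> Obj D \<Longrightarrow>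
      h \<in> hom_set A (fo S X) (fo S Y) \<Longrightarrow> k \<in> hom_set A (fo S Y) (fo S Z) \<Longrightarrow>
      kl \<gamma> X Z (k \<cdot>\<^bsub>A\<^esub> h) = kl \<gamma> Y Z k \<cdot>\<^bsub>A\<^esub> kl \<gamma> X Y h"
  shows "monad_morphism D
    (U \<odot> S) \<alpha>1 (\<lambda>X. fa U (\<beta>1 (fo S X))) (R \<odot> T) \<alpha>3 (\<lambda>X. fa R (\<beta>3 (fo T X))) \<gamma>"
proof -
  have [simp]: "\<gamma> X \<in> Arr D" "Dom D (\<gamma> X) = fo U (fo S X)" "Cod D (\<gamma> X) = fo R (fo T X)"
    if "X \<in> Obj D" for X using g[OF that] by simp_all
  have [simp]: "kl \<gamma> X Y h \<in> Arr A" "Dom A (kl \<gamma> X Y h) = fo T X" "Cod A (kl \<gamma> X Y h) = fo T Y"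
    and phi_kl: "T.phi X (kl \<gamma> X Y h) = \<gamma> Y \<cdot>\<^bsub>D\<^esub> S.phi X h"
    if "X \<in> Obj D" "Y \<in> Obj D" "h \<in> Arr A" "Dom A h = fo S X" "Cod A h = fo S Y" for X Y h
    using that by (simp_all add: kl_def)
  define b where "b X = kl \<gamma> (fo U (fo S X)) X (\<beta>1 (fo S X))" for X
  have [simp]: "b X \<in> Arr A" "Dom A (b X) = fo T (fo U (fo S X))" "Cod A (b X) = fo T X"
    and phi_b: "T.phi (fo U (fo S X)) (b X) = \<gamma> X"
    and b_psi: "b X = \<beta>3 (fo T X) \<cdot>\<^bsub>A\<^esub> fa T (\<gamma> X)" if "X \<in> Obj D" for X
    using that by (simp_all add: b_def phi_kl S.phi_counit) (simp add: kl_def S.phi_counit T.psi_def)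
  have nat: "fa R (fa T f) \<cdot>\<^bsub>D\<^esub> \<gamma> (Dom D f) = \<gamma> (Cod D f) \<cdot>\<^bsub>D\<^esub> fa U (fa S f)"
    if f: "f \<in> Arr D" for f
  proof -
    let ?X = "Dom D f" and ?Y = "Cod D f"
    have "fa R (fa T f) \<cdot>\<^bsub>D\<^esub> \<gamma> ?X = T.phi (fo U (fo S ?X)) (fa T f \<cdot>\<^bsub>A\<^esub> b ?X)"
      using f by (simp add: T.phi_post phi_b)
    also have "fa T f \<cdot>\<^bsub>A\<^esub> b ?X = kl \<gamma> (fo U (fo S ?X)) ?Y (fa S f \<cdot>\<^bsub>A\<^esub> \<beta>1 (fo S ?X))"
      using f kl_comp[of "fo U (fo S ?X)" ?X ?Y "\<beta>1 (fo S ?X)" "fa S f"] by (simp add: b_def kl_S)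
    also have "fa S f \<cdot>\<^bsub>A\<^esub> \<beta>1 (fo S ?X) = \<beta>1 (fo S ?Y) \<cdot>\<^bsub>A\<^esub> fa S (fa U (fa S f))"
      using S.counit_nat[of "fa S f"] f by simp
    also have "kl \<gamma> (fo U (fo S ?X)) ?Y \<dots> = b ?Y \<cdot>\<^bsub>A\<^esub> fa T (fa U (fa S f))"
      using f kl_comp[of "fo U (fo S ?X)" "fo U (fo S ?Y)" ?Y "fa S (fa U (fa S f))" "\<beta>1 (fo S ?Y)"]
        kl_S[of "fa U (fa S f)"] by (simp add: b_def)
    also have "T.phi (fo U (fo S ?X)) \<dots> = \<gamma> ?Y \<cdot>\<^bsub>D\<^esub> fa U (fa S f)"
      using f T.phi_pre[of "fa U (fa S f)" "fo U (fo S ?X)" "fo U (fo S ?Y)" "b ?Y"]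
      by (simp add: phi_b)
    finally show ?thesis .
  qed
  have unit: "\<alpha>3 X = \<gamma> X \<cdot>\<^bsub>D\<^esub> \<alpha>1 X" if X: "X \<in> Obj D" for X
  proof -
    have "\<alpha>3 X = T.phi X (kl \<gamma> X X (fa S (Ident D X)))"
      using X kl_S[of "Ident D X"] by (simp add: T.phi_ident)
    also have "\<dots> = \<gamma> X \<cdot>\<^bsub>D\<^esub> \<alpha>1 X" using X by (simp add: phi_kl S.phi_ident)
    finally show ?thesis .
  qed
  have mult: "fa R (\<beta>3 (fo T X)) \<cdot>\<^bsub>D\<^esub> (fa R (fa T (\<gamma> X)) \<cdot>\<^bsub>D\<^esub> \<gamma> (fo U (fo S X)))
      = \<gamma> X \<cdot>\<^bsub>D\<^esub> fa U (\<beta>1 (fo S X))" if X: "X \<in> Obj D" for X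
  proof -
    let ?Y = "fo U (fo S X)" and ?Z = "fo U (fo S (fo U (fo S X)))"
    have "fa R (\<beta>3 (fo T X)) \<cdot>\<^bsub>D\<^esub> (fa R (fa T (\<gamma> X)) \<cdot>\<^bsub>D\<^esub> \<gamma> ?Y) = fa R (b X) \<cdot>\<^bsub>D\<^esub> \<gamma> ?Y"
      using X by (simp add: b_psi)
    also have "\<dots> = T.phi ?Z (b X \<cdot>\<^bsub>A\<^esub> b ?Y)"
      using X by (simp add: T.phi_post phi_b)
    also have "b X \<cdot>\<^bsub>A\<^esub> b ?Y = kl \<gamma> ?Z X (\<beta>1 (fo S X) \<cdot>\<^bsub>A\<^esub> \<beta>1 (fo S ?Y))"
      using X kl_comp[of ?Z ?Y X "\<beta>1 (fo S ?Y)" "\<beta>1 (fo S X)"] by (simp add: b_def)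
    also have "T.phi ?Z \<dots> = \<gamma> X \<cdot>\<^bsub>D\<^esub> fa U (\<beta>1 (fo S X))"
      using X by (simp add: phi_kl S.phi_post S.phi_counit)
    finally show ?thesis .
  qed
  note US = additive_functor_comp[OF S.L.additive_functor_axioms S.R.additive_functor_axioms]
  note RT = additive_functor_comp[OF T.L.additive_functor_axioms T.R.additive_functor_axioms]
  have "nat_trans D D (U \<odot> S) (R \<odot> T) \<gamma>"
    by (rule nat_transI[OF US RT]) (simp_all add: nat)
  with unit mult show ?thesis unfolding monad_morphism_def
    by (simp add: S.monad_of_adjunction T.monad_of_adjunction)
qed

end

locale kleisli_morphism = two_adj D A S U \<alpha>1 \<beta>1 T R \<alpha>3 \<beta>3
  for D :: "('p, 'b) cat" and A :: "('o, 'a) cat" and S U \<alpha>1 \<beta>1 T R \<alpha>3 \<beta>3 +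
  fixes \<gamma>
  assumes morphism: "monad_morphism D
    (U \<odot> S) \<alpha>1 (\<lambda>X. fa U (\<beta>1 (fo S X))) (R \<odot> T) \<alpha>3 (\<lambda>X. fa R (\<beta>3 (fo T X))) \<gamma>"
begin

lemma gamma_nat_trans: "nat_trans D D (U \<odot> S) (R \<odot> T) \<gamma>"
  using morphism by (simp add: monad_morphism_def)

lemma gamma_simps [simp]:
  assumes "X \<in> Obj D"
  shows "\<gamma> X \<in> Arr D" "Dom D (\<gamma> X) = fo U (fo S X)" "Cod D (\<gamma> X) = fo R (fo T X)"
  using nat_transD(1-3)[OF gamma_nat_trans assms] by simp_all

lemma gamma_nat:
  "f \<in> Arr D \<Longrightarrow> fa R (fa T f) \<cdot>\<^bsub>D\<^esub> \<gamma> (Dom D f) = \<gamma> (Cod D f) \<cdot>\<^bsub>D\<^esub> fa U (fa S f)"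
  using nat_transD(4)[OF gamma_nat_trans] by simp

lemma gamma_unit: "X \<in> Obj D \<Longrightarrow> \<gamma> X \<cdot>\<^bsub>D\<^esub> \<alpha>1 X = \<alpha>3 X"
  using morphism by (simp add: monad_morphism_def)

lemma gamma_mult: "X \<in> Obj D \<Longrightarrow>
  fa R (\<beta>3 (fo T X)) \<cdot>\<^bsub>D\<^esub> (fa R (fa T (\<gamma> X)) \<cdot>\<^bsub>D\<^esub> \<gamma> (fo U (fo S X))) = \<gamma> X \<cdot>\<^bsub>D\<^esub> fa U (\<beta>1 (fo S X))"
  using morphism unfolding monad_morphism_def comp_func_simps by blast

lemma kl_simps [simp]:
  assumes "X \<in> Obj D" "Y \<in> Obj D" "h \<in> Arr A" "Dom A h = fo S X" "Cod A h = fo S Y"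
  shows "kl \<gamma> X Y h \<in> Arr A" "Dom A (kl \<gamma> X Y h) = fo T X" "Cod A (kl \<gamma> X Y h) = fo T Y"
  using assms by (simp_all add: kl_def)

lemma kl_S: "f \<in> Arr D \<Longrightarrow> Dom D f = X \<Longrightarrow> Cod D f = Y \<Longrightarrow> kl \<gamma> X Y (fa S f) = fa T f"
proof -
  assume f: "f \<in> Arr D" "Dom D f = X" "Cod D f = Y"
  then have O: "X \<in> Obj D" "Y \<in> Obj D" by auto
  have "S.phi X (fa S f) = \<alpha>1 Y \<cdot>\<^bsub>D\<^esub> f" using f S.unit_nat[of f] by (simp add: adj_iso_def)
  then have "kl \<gamma> X Y (fa S f) = T.psi (fo T Y) (\<alpha>3 Y \<cdot>\<^bsub>D\<^esub> f)"
    using f O by (simp add: kl_def S.L.C.reassoc[OF gamma_unit])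
  also have "\<dots> = fa T f" using f O by (simp add: T.psi_pre T.psi_unit)
  finally show ?thesis .
qed

lemma kl_ident: "X \<in> Obj D \<Longrightarrow> kl \<gamma> X X (Ident A (fo S X)) = Ident A (fo T X)"
  using kl_S[of "Ident D X" X X] by simp

text \<open>The compatibility of \<open>\<gamma>\<close> with the multiplications is the case of the counit. Any \<open>h\<close> is
  \<open>\<beta>1 (S Y) \<cdot> S g\<close> for its transpose \<open>g\<close>, so the general case follows by naturality of \<open>\<gamma>\<close>.\<close>

lemma kl_action:
  assumes X: "X \<in> Obj D" and Y: "Y \<in> Obj D"
    and h: "h \<in> Arr A" "Dom A h = fo S X" "Cod A h = fo S Y"
  shows "\<gamma> Y \<cdot>\<^bsub>D\<^esub> fa U h = fa R (kl \<gamma> X Y h) \<cdot>\<^bsub>D\<^esub> \<gamma> X"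
proof -
  let ?g = "S.phi X h"
  have g: "?g \<in> Arr D" "Dom D ?g = X" "Cod D ?g = fo U (fo S Y)" using X h by simp_all
  have hg: "h = \<beta>1 (fo S Y) \<cdot>\<^bsub>A\<^esub> fa S ?g" using X h S.psi_phi[of X h "fo S Y"] by (simp add: S.psi_def)
  have "fa U h = fa U (\<beta>1 (fo S Y)) \<cdot>\<^bsub>D\<^esub> fa U (fa S ?g)"
    using Y g hg by (metis S.R.fa_comp_simp S.counit_simps(1,2) S.L.fa_simps(1,3) S.L.fo_simp)
  then have "\<gamma> Y \<cdot>\<^bsub>D\<^esub> fa U h = (\<gamma> Y \<cdot>\<^bsub>D\<^esub> fa U (\<beta>1 (fo S Y))) \<cdot>\<^bsub>D\<^esub> fa U (fa S ?g)"
    using Y g by simp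
  also have "\<dots> = fa R (\<beta>3 (fo T Y)) \<cdot>\<^bsub>D\<^esub> (fa R (fa T (\<gamma> Y)) \<cdot>\<^bsub>D\<^esub> (\<gamma> (fo U (fo S Y)) \<cdot>\<^bsub>D\<^esub> fa U (fa S ?g)))"
    unfolding gamma_mult[OF Y, symmetric] using Y g by simp
  also have "\<gamma> (fo U (fo S Y)) \<cdot>\<^bsub>D\<^esub> fa U (fa S ?g) = fa R (fa T ?g) \<cdot>\<^bsub>D\<^esub> \<gamma> X"
    using gamma_nat[OF g(1)] g by simp
  also have "fa R (\<beta>3 (fo T Y)) \<cdot>\<^bsub>D\<^esub> (fa R (fa T (\<gamma> Y)) \<cdot>\<^bsub>D\<^esub> (fa R (fa T ?g) \<cdot>\<^bsub>D\<^esub> \<gamma> X))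
    = fa R (kl \<gamma> X Y h) \<cdot>\<^bsub>D\<^esub> \<gamma> X"
    using X Y g by (simp add: kl_def T.psi_def)
  finally show ?thesis .
qed

lemma kl_comp:
  assumes X: "X \<in> Obj D" and Y: "Y \<in> Obj D" and Z: "Z \<in> Obj D"
    and h: "h \<in> Arr A" "Dom A h = fo S X" "Cod A h = fo S Y"
    and k: "k \<in> Arr A" "Dom A k = fo S Y" "Cod A k = fo S Z"
  shows "kl \<gamma> X Z (k \<cdot>\<^bsub>A\<^esub> h) = kl \<gamma> Y Z k \<cdot>\<^bsub>A\<^esub> kl \<gamma> X Y h"
proof -
  have "kl \<gamma> X Z (k \<cdot>\<^bsub>A\<^esub> h) = T.psi (fo T Z) (fa R (kl \<gamma> Y Z k) \<cdot>\<^bsub>D\<^esub> (\<gamma> Y \<cdot>\<^bsub>D\<^esub> S.phi X h))"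
    using assms by (simp add: kl_def[of \<gamma> X Z] S.phi_post S.L.C.reassoc[OF kl_action])
  also have "\<dots> = kl \<gamma> Y Z k \<cdot>\<^bsub>A\<^esub> T.psi (fo T Y) (\<gamma> Y \<cdot>\<^bsub>D\<^esub> S.phi X h)"
    using assms by (intro T.psi_post) simp_all
  finally show ?thesis by (simp add: kl_def[of \<gamma> X Y])
qed

end


section \<open>The monad morphism of a Nakayama functor\<close>

text \<open>The data from which \<open>\<chi>\<close> and \<open>\<gamma>\<^sub>\<nu>\<close> are formed.\<close>

locale extended_functor = two_adj D A S U \<alpha>1 \<beta>1 T R \<alpha>3 \<beta>3 + N: adj A A \<nu> \<nu>m l e
  for D :: "('p, 'b) cat" and A :: "('o, 'a) cat" and S U \<alpha>1 \<beta>1 T R \<alpha>3 \<beta>3 \<nu> \<nu>m l e +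
  fixes \<theta>
  assumes theta: "nat_iso D A (\<nu> \<odot> S) T \<theta>"

sublocale extended_functor \<subseteq> M: adj_comp D A A S U \<alpha>1 \<beta>1 \<nu> \<nu>m l e ..

sublocale extended_functor \<subseteq> J: adj2 D A T R \<alpha>3 \<beta>3 "\<nu> \<odot> S" "U \<odot> \<nu>m"
    "comp_unit D S U \<alpha>1 l" "\<lambda>Z. N.psi Z (\<beta>1 (fo \<nu>m Z))"
  by (intro adj2.intro T.adj_axioms adj.intro M.adjunction_comp)

context extended_functor
begin

abbreviation theta_inv where "theta_inv X \<equiv> inv_arrow A (\<theta> X)"

abbreviation the_chi where "the_chi \<equiv> chi A D S U \<alpha>1 T R \<alpha>3 \<nu> \<nu>m l \<theta>"

abbreviation the_gamma where "the_gamma \<equiv> gamma_nu A D S U \<alpha>1 T R \<alpha>3 \<nu> \<nu>m l \<theta>"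

lemma theta_nat_trans: "nat_trans D A (\<nu> \<odot> S) T \<theta>"
  using theta by (simp add: nat_iso_def)

lemma theta_inv_nat_iso: "nat_iso D A T (\<nu> \<odot> S) theta_inv"
  using nat_iso_inv[OF theta] .

lemma theta_simps [simp]:
  assumes "X \<in> Obj D"
  shows "\<theta> X \<in> Arr A" "Dom A (\<theta> X) = fo \<nu> (fo S X)" "Cod A (\<theta> X) = fo T X"
    "theta_inv X \<in> Arr A" "Dom A (theta_inv X) = fo T X" "Cod A (theta_inv X) = fo \<nu> (fo S X)"
  using nat_transD(1-3)[OF theta_nat_trans assms] inverse_arrowsD[OF nat_iso_inverse[OF theta assms]]
  by simp_all

lemma theta_inverse:
  assumes "X \<in> Obj D"
  shows "theta_inv X \<cdot>\<^bsub>A\<^esub> \<theta> X = Ident A (fo \<nu> (fo S X))" "\<theta> X \<cdot>\<^bsub>A\<^esub> theta_inv X = Ident A (fo T X)"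
  using inverse_arrowsD(5,6)[OF nat_iso_inverse[OF theta assms]] assms by simp_all

lemma theta_nat: "f \<in> Arr D \<Longrightarrow> fa T f \<cdot>\<^bsub>A\<^esub> \<theta> (Dom D f) = \<theta> (Cod D f) \<cdot>\<^bsub>A\<^esub> fa \<nu> (fa S f)"
  using nat_transD(4)[OF theta_nat_trans] by simp

text \<open>The definite description in \<open>chi\<close> has a unique solution, as a conjugate is determined on the objects
  of \<open>A\<close> and extensionality fixes its values elsewhere.\<close>

lemma chi_conjugate: "chi_conjugate A D S U \<alpha>1 T R \<alpha>3 \<nu> \<nu>m l \<theta> the_chi"
proof -
  have c: "conjugate D A T R \<alpha>3 (\<nu> \<odot> S) (U \<odot> \<nu>m) (comp_unit D S U \<alpha>1 l) theta_inv (J.mate theta_inv)"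
    using theta_inv_nat_iso by (intro J.mate_conjugate) (simp add: nat_iso_def)
  let ?c = "restrict (J.mate theta_inv) (Obj A)"
  have "nat_trans A D (U \<odot> \<nu>m) R ?c"
    using c by (intro nat_transI) (auto simp: conjugate_def nat_trans_def)
  then have c': "chi_conjugate A D S U \<alpha>1 T R \<alpha>3 \<nu> \<nu>m l \<theta> ?c"
    using c by (simp add: chi_conjugate_def conjugate_def)
  have "\<tau> = ?c" if "\<tau> \<in> extensional (Obj A) \<and> chi_conjugate A D S U \<alpha>1 T R \<alpha>3 \<nu> \<nu>m l \<theta> \<tau>" for \<tau>
  proof (rule extensionalityI[of _ "Obj A"])
    show "\<tau> Y = ?c Y" if "Y \<in> Obj A" for Y
      using J.conjugate_unique[of theta_inv \<tau> Y] that
        \<open>\<tau> \<in> extensional (Obj A) \<and> chi_conjugate A D S U \<alpha>1 T R \<alpha>3 \<nu> \<nu>m l \<theta> \<tau>\<close>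
      by (simp add: chi_conjugate_def)
  qed (use that in auto)
  then have "the_chi = ?c" unfolding chi_def
    by (intro the_equality) (use c' in auto)
  with c' show ?thesis by simp
qed

lemma chi_nat_iso: "nat_iso A D (U \<odot> \<nu>m) R the_chi"
  using J.conjugate_iso[OF _ theta_inv_nat_iso] chi_conjugate by (simp add: chi_conjugate_def)

lemma chi_simps [simp]:
  assumes "Y \<in> Obj A"
  shows "the_chi Y \<in> Arr D" "Dom D (the_chi Y) = fo U (fo \<nu>m Y)" "Cod D (the_chi Y) = fo R Y"
  using chi_nat_iso nat_transD(1-3)[of A D "U \<odot> \<nu>m" R the_chi Y] assms by (simp_all add: nat_iso_def)

lemma the_gamma_simps [simp]:
  assumes "X \<in> Obj D"
  shows "the_gamma X \<in> Arr D" "Dom D (the_gamma X) = fo U (fo S X)" "Cod D (the_gamma X) = fo R (fo T X)"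
  using assms by (simp_all add: gamma_nu_def)

text \<open>Transposing along \<open>\<nu> S \<stileturn> U \<nu>m\<close> is transposing along \<open>\<nu> \<stileturn> \<nu>m\<close> and then along \<open>S \<stileturn> U\<close>. So the
  conjugacy of \<open>\<chi>\<close>, evaluated at \<open>\<theta> Y \<cdot> \<nu> h\<close>, says that \<open>\<gamma>\<^sub>\<nu>\<close> translates \<open>h\<close> to \<open>\<nu> h\<close>, up to \<open>\<theta>\<close>.\<close>

lemma kl_the_gamma:
  assumes X: "X \<in> Obj D" and Y: "Y \<in> Obj D"
    and h: "h \<in> Arr A" "Dom A h = fo S X" "Cod A h = fo S Y"
  shows "kl the_gamma X Y h = \<theta> Y \<cdot>\<^bsub>A\<^esub> (fa \<nu> h \<cdot>\<^bsub>A\<^esub> theta_inv X)"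
proof -
  let ?k = "\<theta> Y \<cdot>\<^bsub>A\<^esub> fa \<nu> h"
  have k: "?k \<in> Arr A" "Dom A ?k = fo \<nu> (fo S X)" "Cod A ?k = fo T Y" using X Y h by simp_all
  have nk: "N.phi (fo S X) ?k = (fa \<nu>m (\<theta> Y) \<cdot>\<^bsub>A\<^esub> l (fo S Y)) \<cdot>\<^bsub>A\<^esub> h"
    using X Y h N.phi_pre[of h "fo S X" "fo S Y" "\<theta> Y"] by (simp add: adj_iso_def)
  have "adj_iso D (U \<odot> \<nu>m) (comp_unit D S U \<alpha>1 l) X ?k = S.phi X (N.phi (fo S X) ?k)"
    unfolding adj_iso_def[of A] adj_iso_def[of D "U \<odot> \<nu>m"] M.comp_unit_phi
    using X Y h by (simp add: S.phi_post)
  also have "\<dots> = fa U (fa \<nu>m (\<theta> Y) \<cdot>\<^bsub>A\<^esub> l (fo S Y)) \<cdot>\<^bsub>D\<^esub> S.phi X h"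
    unfolding nk using X Y h by (intro S.phi_post) simp_all
  finally have e: "adj_iso D (U \<odot> \<nu>m) (comp_unit D S U \<alpha>1 l) X ?k
    = fa U (fa \<nu>m (\<theta> Y) \<cdot>\<^bsub>A\<^esub> l (fo S Y)) \<cdot>\<^bsub>D\<^esub> S.phi X h" .
  have "T.phi X (?k \<cdot>\<^bsub>A\<^esub> theta_inv X)
    = the_chi (fo T Y) \<cdot>\<^bsub>D\<^esub> adj_iso D (U \<odot> \<nu>m) (comp_unit D S U \<alpha>1 l) X ?k"
    by (rule J.conjugateD[OF chi_conjugate[unfolded chi_conjugate_def] X]) (use k in simp_all)
  also have "\<dots> = the_gamma Y \<cdot>\<^bsub>D\<^esub> S.phi X h"
    unfolding e gamma_nu_def using X Y h by simp
  finally have "kl the_gamma X Y h = T.psi (fo T Y) (T.phi X (?k \<cdot>\<^bsub>A\<^esub> theta_inv X))"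
    by (simp add: kl_def)
  also have "\<dots> = ?k \<cdot>\<^bsub>A\<^esub> theta_inv X" using X k by (intro T.psi_phi) simp_all
  also have "\<dots> = \<theta> Y \<cdot>\<^bsub>A\<^esub> (fa \<nu> h \<cdot>\<^bsub>A\<^esub> theta_inv X)" using X Y h by simp
  finally show ?thesis .
qed

lemma the_gamma_morphism: "monad_morphism D
    (U \<odot> S) \<alpha>1 (\<lambda>X. fa U (\<beta>1 (fo S X))) (R \<odot> T) \<alpha>3 (\<lambda>X. fa R (\<beta>3 (fo T X))) the_gamma"
proof (rule monad_morphismI)
  fix f assume f: "f \<in> Arr D"
  have "\<theta> (Cod D f) \<cdot>\<^bsub>A\<^esub> (fa \<nu> (fa S f) \<cdot>\<^bsub>A\<^esub> theta_inv (Dom D f)) = fa T f"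
    using f by (simp add: S.L.D.reassoc[OF theta_nat[OF f, symmetric]] theta_inverse)
  then show "kl the_gamma (Dom D f) (Cod D f) (fa S f) = fa T f"
    using f by (simp add: kl_the_gamma)
next
  fix X Y Z h k
  assume "X \<in> Obj D" "Y \<in> Obj D" "Z \<in> Obj D"
    "h \<in> hom_set A (fo S X) (fo S Y)" "k \<in> hom_set A (fo S Y) (fo S Z)"
  then show "kl the_gamma X Z (k \<cdot>\<^bsub>A\<^esub> h) = kl the_gamma Y Z k \<cdot>\<^bsub>A\<^esub> kl the_gamma X Y h"
    by (simp add: kl_the_gamma S.L.D.reassoc[OF theta_inverse(1)])
qed simp

lemma the_gamma_monad_iso:
  assumes "\<And>X. X \<in> Obj D \<Longrightarrow> iso_arrow A (l (fo S X))"
  shows "monad_iso D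
    (U \<odot> S) \<alpha>1 (\<lambda>X. fa U (\<beta>1 (fo S X))) (R \<odot> T) \<alpha>3 (\<lambda>X. fa R (\<beta>3 (fo T X))) the_gamma"
proof (rule monad_isoI[OF the_gamma_morphism])
  fix X assume X: "X \<in> Obj D"
  have "iso_arrow A (\<theta> X)" "iso_arrow D (the_chi (fo T X))"
    using X theta chi_nat_iso by (simp_all add: nat_iso_def)
  then show "iso_arrow D (the_gamma X)" unfolding gamma_nu_def using X assms[OF X]
    by (intro S.L.C.iso_comp S.R.fa_iso S.L.D.iso_comp N.R.fa_iso) simp_all
qed

end


section \<open>Essential surjectivity of the comparison functor\<close>

text \<open>When \<open>R\<close> preserves coequalizers, the comparison functor is essentially surjective as well: the
  structure arrow of an algebra \<open>a\<close> on \<open>Y\<close> is the split coequalizer of \<open>R (L a)\<close> and \<open>R (\<beta> (L Y))\<close>,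
  and these two arrows already live in \<open>D\<close>, where they have a coequalizer \<open>M\<close>. The left adjointness
  of \<open>R\<close> then identifies \<open>R M\<close> with \<open>Y\<close>.\<close>

lemma (in faithful_adj) comparison_essentially_surjective:
  assumes V: "adj D C R V \<alpha>' \<beta>'"
    and Y: "Y \<in> Obj C" and a: "a \<in> Arr C" "Dom C a = fo R (fo L Y)" "Cod C a = Y"
    and unit: "a \<cdot>\<^bsub>C\<^esub> \<alpha> Y = Ident C Y"
    and assoc: "a \<cdot>\<^bsub>C\<^esub> fa R (fa L a) = a \<cdot>\<^bsub>C\<^esub> fa R (\<beta> (fo L Y))"
  shows "\<exists>M\<in>Obj D. \<exists>i\<in>hom_set C (fo R M) Y.
    iso_arrow C i \<and> i \<cdot>\<^bsub>C\<^esub> fa R (\<beta> M) = a \<cdot>\<^bsub>C\<^esub> fa R (fa L i)"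
proof -
  interpret V: adj D C R V \<alpha>' \<beta>' by fact
  obtain \<rho> where \<rho>: "coequalizer_of D \<rho> (fa L a) (\<beta> (fo L Y))"
    using DA.ex_coequalizer[of "fa L a" "\<beta> (fo L Y)"] Y a by auto
  have \<rho>t: "\<rho> \<in> Arr D" "Dom D \<rho> = fo L Y"
    and \<rho>e: "\<rho> \<cdot>\<^bsub>D\<^esub> fa L a = \<rho> \<cdot>\<^bsub>D\<^esub> \<beta> (fo L Y)"
    using coequalizerD[OF \<rho>] Y by simp_all
  have R\<rho>: "coequalizer_of C (fa R \<rho>) (fa R (fa L a)) (fa R (\<beta> (fo L Y)))"
    by (rule V.left_adjoint_coequalizer[OF \<rho>])
  have "coequalizer_of C a (fa R (fa L a)) (fa R (\<beta> (fo L Y)))"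
  proof (rule L.C.split_coequalizer)
    show "fa R (fa L a) \<cdot>\<^bsub>C\<^esub> \<alpha> (fo R (fo L Y)) = \<alpha> Y \<cdot>\<^bsub>C\<^esub> a"
      using unit_nat[OF a(1)] a by simp
  qed (use Y a unit assoc in \<open>simp_all add: triangles\<close>)
  then obtain i j where ij: "inverse_arrows C i j" "Dom C i = Cod C (fa R \<rho>)" "Cod C i = Cod C a"
      and i\<rho>: "i \<cdot>\<^bsub>C\<^esub> fa R \<rho> = a"
    using L.C.coequalizer_unique_iso[OF R\<rho>] by blast
  define M where "M = Cod D \<rho>"
  have M: "M \<in> Obj D" "Cod D \<rho> = M" using \<rho>t by (simp_all add: M_def)
  have i: "i \<in> Arr C" "Dom C i = fo R M" "Cod C i = Y"
    using inverse_arrowsD(1)[OF ij(1)] ij(2,3) \<rho>t a M by simp_all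
  have epi: "coequalizer_of C (fa R (fa L (fa R \<rho>))) (fa R (fa L (fa R (fa L a))))
      (fa R (fa L (fa R (\<beta> (fo L Y)))))"
    by (intro V.left_adjoint_coequalizer left_adjoint_coequalizer R\<rho>)
  have "i \<cdot>\<^bsub>C\<^esub> fa R (\<beta> M) = a \<cdot>\<^bsub>C\<^esub> fa R (fa L i)"
  proof (rule coequalizer_epi[OF epi])
    have 1: "fa R (\<beta> M) \<cdot>\<^bsub>C\<^esub> fa R (fa L (fa R \<rho>)) = fa R \<rho> \<cdot>\<^bsub>C\<^esub> fa R (\<beta> (fo L Y))"
      using counit_nat[OF \<rho>t(1)] \<rho>t M Y by (simp flip: R.fa_comp_simp)
    have 2: "fa R (fa L i) \<cdot>\<^bsub>C\<^esub> fa R (fa L (fa R \<rho>)) = fa R (fa L a)"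
      using i\<rho> i \<rho>t M by (simp flip: R.fa_comp_simp L.fa_comp_simp)
    show "(i \<cdot>\<^bsub>C\<^esub> fa R (\<beta> M)) \<cdot>\<^bsub>C\<^esub> fa R (fa L (fa R \<rho>))
      = (a \<cdot>\<^bsub>C\<^esub> fa R (fa L i)) \<cdot>\<^bsub>C\<^esub> fa R (fa L (fa R \<rho>))"
      using i \<rho>t M Y a by (simp add: 1 2 assoc L.C.reassoc[OF i\<rho>])
  qed (use i \<rho>t M Y a in simp_all)
  moreover have "i \<in> hom_set C (fo R M) Y" "iso_arrow C i"
    using i ij(1) by (auto simp: iso_arrow_def)
  ultimately show ?thesis using M(1) by blast
qed


section \<open>The Nakayama functor of a monad isomorphism\<close>

text \<open>An object \<open>M\<close> is presented by the fork of \<open>\<beta>1 M\<close>, whose arrows lie between objects \<open>S X\<close>;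
  \<open>\<pi> M\<close> is a chosen coequalizer of the translated parallel arrows.\<close>

locale presentation = kleisli_morphism D A S U \<alpha>1 \<beta>1 T R \<alpha>3 \<beta>3 \<gamma> +
    F: faithful_adj D A S U \<alpha>1 \<beta>1 + V: adj A D U T \<alpha>2 \<beta>2
  for D :: "('p, 'b) cat" and A :: "('o, 'a) cat" and S U \<alpha>1 \<beta>1 T R \<alpha>3 \<beta>3 \<gamma> \<alpha>2 \<beta>2 +
  fixes \<pi>
  assumes presentation: "M \<in> Obj A \<Longrightarrow> coequalizer_of A (\<pi> M)
    (kl \<gamma> (fo U (fo S (fo U M))) (fo U M) (\<beta>1 (fo S (fo U M)))) (fa T (fa U (\<beta>1 M)))"
begin

definition \<nu> :: "('o, 'a, 'o, 'a) func" where
  "\<nu> = \<lparr>fo = \<lambda>M. Cod A (\<pi> M),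
    fa = \<lambda>f. SOME u. u \<in> hom_set A (Cod A (\<pi> (Dom A f))) (Cod A (\<pi> (Cod A f))) \<and>
      u \<cdot>\<^bsub>A\<^esub> \<pi> (Dom A f) = \<pi> (Cod A f) \<cdot>\<^bsub>A\<^esub> fa T (fa U f)\<rparr>"

lemma fo_nu: "fo \<nu> M = Cod A (\<pi> M)"
  by (simp add: \<nu>_def)

lemma pi_simps [simp]:
  assumes "M \<in> Obj A"
  shows "\<pi> M \<in> Arr A" "Dom A (\<pi> M) = fo T (fo U M)" "Cod A (\<pi> M) = fo \<nu> M" "fo \<nu> M \<in> Obj A"
  using coequalizerD(1,6)[OF presentation[OF assms]] assms by (simp_all add: fo_nu)

lemma pi_fork:
  assumes "M \<in> Obj A"
  shows "\<pi> M \<cdot>\<^bsub>A\<^esub> kl \<gamma> (fo U (fo S (fo U M))) (fo U M) (\<beta>1 (fo S (fo U M)))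
    = \<pi> M \<cdot>\<^bsub>A\<^esub> fa T (fa U (\<beta>1 M))"
  using coequalizerD(7)[OF presentation[OF assms]] .

lemma pi_epi:
  assumes "M \<in> Obj A" "u \<in> Arr A" "v \<in> Arr A" "Dom A u = fo \<nu> M" "Dom A v = fo \<nu> M"
    and "Cod A u = Cod A v" "u \<cdot>\<^bsub>A\<^esub> \<pi> M = v \<cdot>\<^bsub>A\<^esub> \<pi> M"
  shows "u = v"
  by (rule coequalizer_epi[OF presentation[OF assms(1)]]) (use assms in simp_all)

text \<open>The translated fork is natural in \<open>M\<close>, because \<open>\<beta>1\<close> is and the translation is functorial.\<close>

lemma fa_nu:
  assumes f: "f \<in> Arr A"
  shows "fa \<nu> f \<in> Arr A" "Dom A (fa \<nu> f) = fo \<nu> (Dom A f)" "Cod A (fa \<nu> f) = fo \<nu> (Cod A f)"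
    and nu_pi: "fa \<nu> f \<cdot>\<^bsub>A\<^esub> \<pi> (Dom A f) = \<pi> (Cod A f) \<cdot>\<^bsub>A\<^esub> fa T (fa U f)"
proof -
  let ?M = "Dom A f" and ?N = "Cod A f"
  let ?b = "\<lambda>M. kl \<gamma> (fo U (fo S (fo U M))) (fo U M) (\<beta>1 (fo S (fo U M)))"
  let ?h = "\<pi> ?N \<cdot>\<^bsub>A\<^esub> fa T (fa U f)"
  have 1: "fa T (fa U f) \<cdot>\<^bsub>A\<^esub> ?b ?M = ?b ?N \<cdot>\<^bsub>A\<^esub> fa T (fa U (fa S (fa U f)))"
  proof -
    have "fa T (fa U f) \<cdot>\<^bsub>A\<^esub> ?b ?M = kl \<gamma> (fo U (fo S (fo U ?M))) (fo U ?N)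
        (fa S (fa U f) \<cdot>\<^bsub>A\<^esub> \<beta>1 (fo S (fo U ?M)))"
      using f by (simp add: kl_comp[where Y = "fo U ?M"] kl_S)
    also have "fa S (fa U f) \<cdot>\<^bsub>A\<^esub> \<beta>1 (fo S (fo U ?M))
        = \<beta>1 (fo S (fo U ?N)) \<cdot>\<^bsub>A\<^esub> fa S (fa U (fa S (fa U f)))"
      using S.counit_nat[of "fa S (fa U f)"] f by simp
    also have "kl \<gamma> (fo U (fo S (fo U ?M))) (fo U ?N) \<dots> = ?b ?N \<cdot>\<^bsub>A\<^esub> fa T (fa U (fa S (fa U f)))"
      using f by (simp add: kl_comp[where Y = "fo U (fo S (fo U ?N))"] kl_S)
    finally show ?thesis .
  qed
  have 2: "fa T (fa U (\<beta>1 ?N)) \<cdot>\<^bsub>A\<^esub> fa T (fa U (fa S (fa U f)))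
      = fa T (fa U f) \<cdot>\<^bsub>A\<^esub> fa T (fa U (\<beta>1 ?M))"
    using S.counit_nat[OF f] f by (simp flip: T.L.fa_comp_simp S.R.fa_comp_simp)
  have "?h \<cdot>\<^bsub>A\<^esub> ?b ?M = ?h \<cdot>\<^bsub>A\<^esub> fa T (fa U (\<beta>1 ?M))"
    using f by (simp add: 1 2 S.L.D.reassoc[OF pi_fork])
  then obtain u where u: "u \<in> Arr A" "Dom A u = Cod A (\<pi> ?M)" "Cod A u = Cod A ?h"
      "u \<cdot>\<^bsub>A\<^esub> \<pi> ?M = ?h"
    using f by (elim coequalizer_factor[OF presentation[of ?M], rotated 3]) simp_all
  let ?P = "\<lambda>u. u \<in> hom_set A (Cod A (\<pi> ?M)) (Cod A (\<pi> ?N)) \<and> u \<cdot>\<^bsub>A\<^esub> \<pi> ?M = ?h"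
  have "?P u" using u f by simp
  then have "?P (SOME u. ?P u)" by (rule someI)
  then have "fa \<nu> f \<in> hom_set A (Cod A (\<pi> ?M)) (Cod A (\<pi> ?N)) \<and> fa \<nu> f \<cdot>\<^bsub>A\<^esub> \<pi> ?M = ?h"
    by (simp only: \<nu>_def func.simps)
  then show "fa \<nu> f \<in> Arr A" "Dom A (fa \<nu> f) = fo \<nu> ?M" "Cod A (fa \<nu> f) = fo \<nu> ?N"
    "fa \<nu> f \<cdot>\<^bsub>A\<^esub> \<pi> ?M = ?h"
    using f by simp_all
qed

lemma nu_pi':
  assumes "f \<in> Arr A" "Dom A f = M" "Cod A f = N"
  shows "fa \<nu> f \<cdot>\<^bsub>A\<^esub> \<pi> M = \<pi> N \<cdot>\<^bsub>A\<^esub> fa T (fa U f)"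
  using nu_pi[OF assms(1)] assms(2,3) by simp

lemma nu_functor: "additive_functor A A \<nu>"
proof unfold_locales
  note [simp] = fa_nu
  fix f X Y assume "f \<in> hom_set A X Y" then show "fa \<nu> f \<in> hom_set A (fo \<nu> X) (fo \<nu> Y)"
    by auto
next
  note [simp] = fa_nu
  fix X assume X: "X \<in> Obj A" show "fa \<nu> (Ident A X) = Ident A (fo \<nu> X)"
    by (rule pi_epi[OF X]) (use X in \<open>simp_all add: nu_pi'\<close>)
next
  note [simp] = fa_nu
  fix f g X Y Z assume f: "f \<in> hom_set A X Y" and g: "g \<in> hom_set A Y Z"
  have O: "X \<in> Obj A" "Y \<in> Obj A" "Z \<in> Obj A" using f g by auto
  have e: "fa \<nu> g \<cdot>\<^bsub>A\<^esub> \<pi> Y = \<pi> Z \<cdot>\<^bsub>A\<^esub> fa T (fa U g)" using g by (intro nu_pi') simp_all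
  show "fa \<nu> (g \<cdot>\<^bsub>A\<^esub> f) = fa \<nu> g \<cdot>\<^bsub>A\<^esub> fa \<nu> f"
    by (rule pi_epi[OF O(1)]) (use f g O in \<open>simp_all add: nu_pi' S.L.D.reassoc[OF e]\<close>)
next
  note [simp] = fa_nu
  fix f g X Y assume f: "f \<in> hom_set A X Y" and g: "g \<in> hom_set A X Y"
  have O: "X \<in> Obj A" "Y \<in> Obj A" using f by auto
  have a: "Add A f g \<in> hom_set A X Y" "Add A (fa \<nu> f) (fa \<nu> g) \<in> hom_set A (fo \<nu> X) (fo \<nu> Y)"
    using f g by simp_all
  have "Add A (fa \<nu> f) (fa \<nu> g) \<cdot>\<^bsub>A\<^esub> \<pi> X
      = Add A (\<pi> Y \<cdot>\<^bsub>A\<^esub> fa T (fa U f)) (\<pi> Y \<cdot>\<^bsub>A\<^esub> fa T (fa U g))"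
    using f g O S.L.D.comp_add_left[of "\<pi> X" "fo T (fo U X)" "fo \<nu> X" "fa \<nu> f" "fo \<nu> Y" "fa \<nu> g"]
    by (simp add: nu_pi')
  also have "\<dots> = \<pi> Y \<cdot>\<^bsub>A\<^esub> Add A (fa T (fa U f)) (fa T (fa U g))"
    using f g O by (intro S.L.D.comp_add_right[symmetric]) auto
  also have "Add A (fa T (fa U f)) (fa T (fa U g)) = fa T (fa U (Add A f g))"
    using f g S.R.fa_add[OF f g] T.L.fa_add[of "fa U f" "fo U X" "fo U Y" "fa U g"] by simp
  finally have e: "Add A (fa \<nu> f) (fa \<nu> g) \<cdot>\<^bsub>A\<^esub> \<pi> X = \<pi> Y \<cdot>\<^bsub>A\<^esub> fa T (fa U (Add A f g))" .
  show "fa \<nu> (Add A f g) = Add A (fa \<nu> f) (fa \<nu> g)"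
    by (rule pi_epi[OF O(1)]) (use e a O in \<open>simp_all add: nu_pi'\<close>)
qed simp

end

sublocale presentation \<subseteq> NU: additive_functor A A \<nu>
  by (rule nu_functor)

context presentation
begin

definition b where "b X = kl \<gamma> (fo U (fo S X)) X (\<beta>1 (fo S X))"

lemma b_simps [simp]:
  assumes "X \<in> Obj D"
  shows "b X \<in> Arr A" "Dom A (b X) = fo T (fo U (fo S X))" "Cod A (b X) = fo T X"
  using assms by (simp_all add: b_def)

lemma phi_b: "X \<in> Obj D \<Longrightarrow> T.phi (fo U (fo S X)) (b X) = \<gamma> X"
  by (simp add: b_def kl_def S.phi_counit)

lemma b_fork:
  assumes X: "X \<in> Obj D"
  shows "b X \<cdot>\<^bsub>A\<^esub> b (fo U (fo S X)) = b X \<cdot>\<^bsub>A\<^esub> fa T (fa U (\<beta>1 (fo S X)))"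
proof -
  let ?Y = "fo U (fo S X)"
  have "b X \<cdot>\<^bsub>A\<^esub> b ?Y = kl \<gamma> (fo U (fo S ?Y)) X (\<beta>1 (fo S X) \<cdot>\<^bsub>A\<^esub> \<beta>1 (fo S ?Y))"
    using X by (simp add: b_def kl_comp[where Y = ?Y])
  also have "\<dots> = kl \<gamma> (fo U (fo S ?Y)) X (\<beta>1 (fo S X) \<cdot>\<^bsub>A\<^esub> fa S (fa U (\<beta>1 (fo S X))))"
    using X F.counit_fork by simp
  also have "\<dots> = b X \<cdot>\<^bsub>A\<^esub> fa T (fa U (\<beta>1 (fo S X)))"
    using X by (simp add: b_def kl_comp[where Y = ?Y] kl_S)
  finally show ?thesis .
qed

text \<open>The splittings are the translations of \<open>S (\<alpha>1 X)\<close> and \<open>S (U (S (\<alpha>1 X)))\<close>, which split the fork of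
  \<open>\<beta>1 (S X)\<close> itself. For \<open>M = S X\<close>, this coequalizer is the presentation of \<open>M\<close>, which is why \<open>\<nu> S\<close> is \<open>T\<close>.\<close>

lemma b_coequalizer:
  assumes X: "X \<in> Obj D"
  shows "coequalizer_of A (b X) (b (fo U (fo S X))) (fa T (fa U (\<beta>1 (fo S X))))"
proof (rule S.L.D.split_coequalizer)
  let ?Y = "fo U (fo S X)"
  have "b X \<cdot>\<^bsub>A\<^esub> fa T (\<alpha>1 X) = kl \<gamma> X X (\<beta>1 (fo S X) \<cdot>\<^bsub>A\<^esub> fa S (\<alpha>1 X))"
    using X by (simp add: b_def kl_comp[where Y = ?Y] kl_S)
  then show "b X \<cdot>\<^bsub>A\<^esub> fa T (\<alpha>1 X) = Ident A (Cod A (b X))"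
    using X by (simp add: S.triangles kl_ident)
  have "b ?Y \<cdot>\<^bsub>A\<^esub> fa T (fa U (fa S (\<alpha>1 X)))
      = kl \<gamma> ?Y ?Y (\<beta>1 (fo S ?Y) \<cdot>\<^bsub>A\<^esub> fa S (fa U (fa S (\<alpha>1 X))))"
    using X by (simp add: b_def kl_comp[where Y = "fo U (fo S ?Y)"] kl_S)
  also have "\<beta>1 (fo S ?Y) \<cdot>\<^bsub>A\<^esub> fa S (fa U (fa S (\<alpha>1 X))) = fa S (\<alpha>1 X) \<cdot>\<^bsub>A\<^esub> \<beta>1 (fo S X)"
    using S.counit_nat[of "fa S (\<alpha>1 X)"] X by simp
  also have "kl \<gamma> ?Y ?Y \<dots> = fa T (\<alpha>1 X) \<cdot>\<^bsub>A\<^esub> b X"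
    using X by (simp add: b_def kl_comp[where Y = X] kl_S)
  finally show "b ?Y \<cdot>\<^bsub>A\<^esub> fa T (fa U (fa S (\<alpha>1 X))) = fa T (\<alpha>1 X) \<cdot>\<^bsub>A\<^esub> b X" .
  have "fa U (\<beta>1 (fo S X)) \<cdot>\<^bsub>D\<^esub> fa U (fa S (\<alpha>1 X)) = Ident D ?Y"
    using S.triangles(1)[OF X] X by (simp flip: S.R.fa_comp_simp)
  then show "fa T (fa U (\<beta>1 (fo S X))) \<cdot>\<^bsub>A\<^esub> fa T (fa U (fa S (\<alpha>1 X))) = Ident A (Dom A (b X))"
    using X by (simp flip: T.L.fa_comp_simp)
qed (use X b_fork in simp_all)

lemma ex_theta:
  assumes X: "X \<in> Obj D"
  shows "\<exists>t\<in>hom_set A (fo \<nu> (fo S X)) (fo T X). t \<cdot>\<^bsub>A\<^esub> \<pi> (fo S X) = b X"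
proof -
  have "coequalizer_of A (\<pi> (fo S X)) (b (fo U (fo S X))) (fa T (fa U (\<beta>1 (fo S X))))"
    using presentation[of "fo S X"] X by (simp add: b_def)
  from coequalizer_factor[OF this, of "b X"] b_fork[OF X] X show ?thesis by force
qed

lemma theta_nat_iso:
  assumes t: "\<And>X. X \<in> Obj D \<Longrightarrow> \<theta> X \<in> hom_set A (fo \<nu> (fo S X)) (fo T X)"
    and t_pi: "\<And>X. X \<in> Obj D \<Longrightarrow> \<theta> X \<cdot>\<^bsub>A\<^esub> \<pi> (fo S X) = b X"
  shows "nat_iso D A (\<nu> \<odot> S) T \<theta>"
proof -
  have [simp]: "\<theta> X \<in> Arr A" "Dom A (\<theta> X) = fo \<nu> (fo S X)" "Cod A (\<theta> X) = fo T X"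
    if "X \<in> Obj D" for X using t[OF that] by simp_all
  have nat: "fa T f \<cdot>\<^bsub>A\<^esub> \<theta> (Dom D f) = \<theta> (Cod D f) \<cdot>\<^bsub>A\<^esub> fa \<nu> (fa S f)" if f: "f \<in> Arr D" for f
  proof (rule pi_epi[of "fo S (Dom D f)"])
    let ?X = "Dom D f" and ?Y = "Cod D f"
    have "fa T f \<cdot>\<^bsub>A\<^esub> b ?X = kl \<gamma> (fo U (fo S ?X)) ?Y (fa S f \<cdot>\<^bsub>A\<^esub> \<beta>1 (fo S ?X))"
      using f by (simp add: b_def kl_comp[where Y = ?X] kl_S)
    also have "fa S f \<cdot>\<^bsub>A\<^esub> \<beta>1 (fo S ?X) = \<beta>1 (fo S ?Y) \<cdot>\<^bsub>A\<^esub> fa S (fa U (fa S f))"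
      using S.counit_nat[of "fa S f"] f by simp
    also have "kl \<gamma> (fo U (fo S ?X)) ?Y \<dots> = b ?Y \<cdot>\<^bsub>A\<^esub> fa T (fa U (fa S f))"
      using f by (simp add: b_def kl_comp[where Y = "fo U (fo S ?Y)"] kl_S)
    finally show "(fa T f \<cdot>\<^bsub>A\<^esub> \<theta> ?X) \<cdot>\<^bsub>A\<^esub> \<pi> (fo S ?X) = (\<theta> ?Y \<cdot>\<^bsub>A\<^esub> fa \<nu> (fa S f)) \<cdot>\<^bsub>A\<^esub> \<pi> (fo S ?X)"
      using f by (simp add: t_pi nu_pi' S.L.D.reassoc[OF t_pi])
  qed (use f in simp_all)
  have iso: "iso_arrow A (\<theta> X)" if X: "X \<in> Obj D" for X
  proof -
    have "coequalizer_of A (\<pi> (fo S X)) (b (fo U (fo S X))) (fa T (fa U (\<beta>1 (fo S X))))"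
      using presentation[of "fo S X"] X by (simp add: b_def)
    then obtain u v where uv: "inverse_arrows A u v" "Dom A u = Cod A (\<pi> (fo S X))"
        "Cod A u = Cod A (b X)" "u \<cdot>\<^bsub>A\<^esub> \<pi> (fo S X) = b X"
      by (rule S.L.D.coequalizer_unique_iso[OF _ b_coequalizer[OF X]])
    have "\<theta> X = u"
      by (rule pi_epi[of "fo S X"]) (use uv inverse_arrowsD(1)[OF uv(1)] X t_pi in simp_all)
    with uv(1) show ?thesis by (auto simp: iso_arrow_def)
  qed
  have "nat_trans D A (\<nu> \<odot> S) T \<theta>"
    by (rule nat_transI[OF additive_functor_comp[OF S.L.additive_functor_axioms nu_functor]
          T.L.additive_functor_axioms]) (simp_all add: nat)
  with iso show ?thesis by (simp add: nat_iso_def)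
qed

text \<open>The canonical structure of an algebra over \<open>R T\<close> on \<open>R N\<close>, restricted along \<open>\<gamma>\<close> to \<open>U S\<close>.\<close>

definition act where "act N = fa R (\<beta>3 N) \<cdot>\<^bsub>D\<^esub> \<gamma> (fo R N)"

lemma act_simps [simp]:
  assumes "N \<in> Obj A"
  shows "act N \<in> Arr D" "Dom D (act N) = fo U (fo S (fo R N))" "Cod D (act N) = fo R N"
  using assms by (simp_all add: act_def)

lemma act_comp:
  assumes N: "N \<in> Obj A" and g: "g \<in> Arr D" "Dom D g = Y" "Cod D g = fo R N"
  shows "act N \<cdot>\<^bsub>D\<^esub> fa U (fa S g) = fa R (T.psi N g) \<cdot>\<^bsub>D\<^esub> \<gamma> Y"
proof -
  have Y: "Y \<in> Obj D" using g by auto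
  have "\<gamma> (fo R N) \<cdot>\<^bsub>D\<^esub> fa U (fa S g) = fa R (fa T g) \<cdot>\<^bsub>D\<^esub> \<gamma> Y"
    using gamma_nat[OF g(1)] g by simp
  then show ?thesis using N Y g by (simp add: act_def T.psi_def)
qed

text \<open>Arrows \<open>\<nu> M \<rightarrow> N\<close> are arrows \<open>T (U M) \<rightarrow> N\<close> that equalize the presentation of \<open>M\<close>; transposed
  along \<open>T \<stileturn> R\<close>, these are the algebra homomorphisms from \<open>U M\<close> to \<open>R N\<close>.\<close>

lemma transpose_fork_iff:
  assumes M: "M \<in> Obj A" and N: "N \<in> Obj A"
    and g: "g \<in> Arr D" "Dom D g = fo U M" "Cod D g = fo R N"
  shows "T.psi N g \<cdot>\<^bsub>A\<^esub> b (fo U M) = T.psi N g \<cdot>\<^bsub>A\<^esub> fa T (fa U (\<beta>1 M)) \<longleftrightarrow>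
    act N \<cdot>\<^bsub>D\<^esub> fa U (fa S g) = g \<cdot>\<^bsub>D\<^esub> fa U (\<beta>1 M)" (is "?l = ?r \<longleftrightarrow> _")
proof -
  let ?Z = "fo U (fo S (fo U M))"
  have l: "T.phi ?Z ?l = act N \<cdot>\<^bsub>D\<^esub> fa U (fa S g)"
    using M N g by (simp add: T.phi_post phi_b act_comp)
  have r: "T.phi ?Z ?r = g \<cdot>\<^bsub>D\<^esub> fa U (\<beta>1 M)"
    using M N g T.phi_pre[of "fa U (\<beta>1 M)" ?Z "fo U M" "T.psi N g"] by simp
  have "?l = ?r \<longleftrightarrow> T.phi ?Z ?l = T.phi ?Z ?r"
  proof
    assume "T.phi ?Z ?l = T.phi ?Z ?r"
    then show "?l = ?r" by (rule T.phi_inject[rotated -1]) (use M N g in simp_all)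
  qed simp
  then show ?thesis by (simp only: l r)
qed

lemma ex_algebra_object:
  assumes N: "N \<in> Obj A"
  shows "\<exists>M\<in>Obj A. \<exists>i\<in>hom_set D (fo U M) (fo R N).
    iso_arrow D i \<and> i \<cdot>\<^bsub>D\<^esub> fa U (\<beta>1 M) = act N \<cdot>\<^bsub>D\<^esub> fa U (fa S i)"
proof (rule F.comparison_essentially_surjective[OF V.adj_axioms])
  let ?Y = "fo R N"
  show "act N \<cdot>\<^bsub>D\<^esub> \<alpha>1 ?Y = Ident D ?Y"
    using N by (simp add: act_def gamma_unit T.triangles)
  have "act N \<cdot>\<^bsub>D\<^esub> fa U (fa S (act N)) = fa R (T.psi N (act N)) \<cdot>\<^bsub>D\<^esub> \<gamma> (fo U (fo S ?Y))"
    using N by (intro act_comp) simp_all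
  also have "T.psi N (act N) = \<beta>3 N \<cdot>\<^bsub>A\<^esub> b ?Y"
    using N T.psi_post[of "\<beta>3 N" "fo T ?Y" N "\<gamma> ?Y"]
    by (simp add: act_def b_def kl_def S.phi_counit)
  also have "fa R (\<beta>3 N \<cdot>\<^bsub>A\<^esub> b ?Y) \<cdot>\<^bsub>D\<^esub> \<gamma> (fo U (fo S ?Y)) = act N \<cdot>\<^bsub>D\<^esub> fa U (\<beta>1 (fo S ?Y))"
    using N kl_action[of "fo U (fo S ?Y)" ?Y "\<beta>1 (fo S ?Y)"] by (simp add: act_def b_def)
  finally show "act N \<cdot>\<^bsub>D\<^esub> fa U (fa S (act N)) = act N \<cdot>\<^bsub>D\<^esub> fa U (\<beta>1 (fo S ?Y))" .
qed (use N in simp_all)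

text \<open>The object \<open>\<nu>m N\<close> realizes the algebra \<open>R N\<close>, by way of an isomorphism \<open>i N\<close>, and the counit at \<open>N\<close>
  corresponds to \<open>i N\<close>. An arrow \<open>g\<close> from \<open>\<nu> M\<close> to \<open>N\<close> corresponds to a homomorphism \<open>g'\<close>; composing with the
  inverse of \<open>i N\<close> gives a homomorphism between values of \<open>U\<close>, and this comes from a unique arrow \<open>k\<close>.\<close>

lemma ex_right_adjoint:
  obtains \<nu>m l e i where "adjunction A A \<nu> \<nu>m l e"
    and "\<And>N. N \<in> Obj A \<Longrightarrow> i N \<in> hom_set D (fo U (fo \<nu>m N)) (fo R N)"
    and "\<And>N. N \<in> Obj A \<Longrightarrow> iso_arrow D (i N)"
    and "\<And>N. N \<in> Obj A \<Longrightarrow> e N \<cdot>\<^bsub>A\<^esub> \<pi> (fo \<nu>m N) = T.psi N (i N)"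
proof -
  have "\<exists>m i. \<forall>N\<in>Obj A. m N \<in> Obj A \<and> i N \<in> hom_set D (fo U (m N)) (fo R N) \<and>
    iso_arrow D (i N) \<and> i N \<cdot>\<^bsub>D\<^esub> fa U (\<beta>1 (m N)) = act N \<cdot>\<^bsub>D\<^esub> fa U (fa S (i N))"
    using ex_algebra_object by metis
  then obtain m i where mi: "\<And>N. N \<in> Obj A \<Longrightarrow> m N \<in> Obj A \<and> i N \<in> hom_set D (fo U (m N)) (fo R N) \<and>
    iso_arrow D (i N) \<and> i N \<cdot>\<^bsub>D\<^esub> fa U (\<beta>1 (m N)) = act N \<cdot>\<^bsub>D\<^esub> fa U (fa S (i N))" by blast
  have [simp]: "m N \<in> Obj A" "i N \<in> Arr D" "Dom D (i N) = fo U (m N)" "Cod D (i N) = fo R N"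
    and i_iso: "iso_arrow D (i N)"
    and i_alg: "act N \<cdot>\<^bsub>D\<^esub> fa U (fa S (i N)) = i N \<cdot>\<^bsub>D\<^esub> fa U (\<beta>1 (m N))" if "N \<in> Obj A" for N
    using mi[OF that] by simp_all
  have factor: "\<exists>u\<in>hom_set A (fo \<nu> M) N. u \<cdot>\<^bsub>A\<^esub> \<pi> M = T.psi N g"
    if M: "M \<in> Obj A" and N: "N \<in> Obj A" and g: "g \<in> Arr D" "Dom D g = fo U M" "Cod D g = fo R N"
      and alg: "act N \<cdot>\<^bsub>D\<^esub> fa U (fa S g) = g \<cdot>\<^bsub>D\<^esub> fa U (\<beta>1 M)" for M N g
  proof -
    have "T.psi N g \<cdot>\<^bsub>A\<^esub> b (fo U M) = T.psi N g \<cdot>\<^bsub>A\<^esub> fa T (fa U (\<beta>1 M))"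
      using transpose_fork_iff[OF M N g] alg by simp
    from coequalizer_factor[OF presentation[OF M, folded b_def] _ _ this] M N g
    show ?thesis by force
  qed
  have "\<exists>e. \<forall>N\<in>Obj A. e N \<in> hom_set A (fo \<nu> (m N)) N \<and> e N \<cdot>\<^bsub>A\<^esub> \<pi> (m N) = T.psi N (i N)"
  proof (intro bchoice ballI)
    fix N assume N: "N \<in> Obj A"
    then have "\<exists>u\<in>hom_set A (fo \<nu> (m N)) N. u \<cdot>\<^bsub>A\<^esub> \<pi> (m N) = T.psi N (i N)"
      by (intro factor i_alg) simp_all
    then show "\<exists>u. u \<in> hom_set A (fo \<nu> (m N)) N \<and> u \<cdot>\<^bsub>A\<^esub> \<pi> (m N) = T.psi N (i N)" by blast
  qed
  then obtain e where e: "\<And>N. N \<in> Obj A \<Longrightarrow> e N \<in> hom_set A (fo \<nu> (m N)) N"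
      and e_pi: "\<And>N. N \<in> Obj A \<Longrightarrow> e N \<cdot>\<^bsub>A\<^esub> \<pi> (m N) = T.psi N (i N)" by blast
  have [simp]: "e N \<in> Arr A" "Dom A (e N) = fo \<nu> (m N)" "Cod A (e N) = N" if "N \<in> Obj A" for N
    using e[OF that] by simp_all
  have e_nu: "(e N \<cdot>\<^bsub>A\<^esub> fa \<nu> k) \<cdot>\<^bsub>A\<^esub> \<pi> M = T.psi N (i N \<cdot>\<^bsub>D\<^esub> fa U k)"
    if "N \<in> Obj A" "k \<in> hom_set A M (m N)" for M N k
    using that T.psi_pre[of N "i N" "fa U k"]
    by (auto simp: nu_pi' S.L.D.reassoc[OF e_pi])
  obtain \<nu>m l where a: "adjunction A A \<nu> \<nu>m l e" and m: "\<And>N. fo \<nu>m N = m N"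
  proof (rule adjunction_from_universal_arrows[OF nu_functor, of m e])
    fix M N g assume M: "M \<in> Obj A" and N: "N \<in> Obj A" and g: "g \<in> hom_set A (fo \<nu> M) N"
    define g' where "g' = T.phi (fo U M) (g \<cdot>\<^bsub>A\<^esub> \<pi> M)"
    have g't: "g' \<in> Arr D" "Dom D g' = fo U M" "Cod D g' = fo R N"
      and psi_g': "T.psi N g' = g \<cdot>\<^bsub>A\<^esub> \<pi> M"
      using M N g by (simp_all add: g'_def)
    have alg: "act N \<cdot>\<^bsub>D\<^esub> fa U (fa S g') = g' \<cdot>\<^bsub>D\<^esub> fa U (\<beta>1 M)"
      using transpose_fork_iff[OF M N g't] M N g pi_fork[OF M] by (simp add: psi_g' b_def)
    define j where "j = inv_arrow D (i N)"
    have j: "j \<in> Arr D" "Dom D j = fo R N" "Cod D j = fo U (m N)"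
      and ji: "j \<cdot>\<^bsub>D\<^esub> i N = Ident D (fo U (m N))" and ij: "i N \<cdot>\<^bsub>D\<^esub> j = Ident D (fo R N)"
      using inverse_arrowsD[OF S.L.C.inv_arrow_inverse[OF i_iso[OF N]]] N by (simp_all add: j_def)
    have USij: "fa U (fa S (i N)) \<cdot>\<^bsub>D\<^esub> fa U (fa S j) = Ident D (fo U (fo S (fo R N)))"
      using ij j N by (simp flip: S.R.fa_comp_simp S.L.fa_comp_simp)
    have "j \<cdot>\<^bsub>D\<^esub> act N = j \<cdot>\<^bsub>D\<^esub> (act N \<cdot>\<^bsub>D\<^esub> fa U (fa S (i N))) \<cdot>\<^bsub>D\<^esub> fa U (fa S j)"
      using j N by (simp add: USij)
    also have "\<dots> = fa U (\<beta>1 (m N)) \<cdot>\<^bsub>D\<^esub> fa U (fa S j)"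
      unfolding i_alg[OF N] using j N by (simp add: S.L.C.reassoc[OF ji])
    finally have j_alg: "fa U (\<beta>1 (m N)) \<cdot>\<^bsub>D\<^esub> fa U (fa S j) = j \<cdot>\<^bsub>D\<^esub> act N" by simp
    have "(j \<cdot>\<^bsub>D\<^esub> g') \<cdot>\<^bsub>D\<^esub> fa U (\<beta>1 M) = fa U (\<beta>1 (m N)) \<cdot>\<^bsub>D\<^esub> fa U (fa S (j \<cdot>\<^bsub>D\<^esub> g'))"
      using j g't M N by (simp add: alg[symmetric] S.L.C.reassoc[OF j_alg])
    then obtain k where k: "k \<in> hom_set A M (m N)" "fa U k = j \<cdot>\<^bsub>D\<^esub> g'"
      using F.comparison_full[of M "m N" "j \<cdot>\<^bsub>D\<^esub> g'"] j g't M N by auto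
    have "e N \<cdot>\<^bsub>A\<^esub> fa \<nu> k = g"
    proof (rule pi_epi[OF M])
      show "(e N \<cdot>\<^bsub>A\<^esub> fa \<nu> k) \<cdot>\<^bsub>A\<^esub> \<pi> M = g \<cdot>\<^bsub>A\<^esub> \<pi> M"
        unfolding e_nu[OF N k(1)] k(2) psi_g'[symmetric]
        using j g't N by (simp add: S.L.C.reassoc[OF ij])
    qed (use k N g in simp_all)
    with k(1) show "\<exists>k\<in>hom_set A M (m N). e N \<cdot>\<^bsub>A\<^esub> fa \<nu> k = g" by blast
  next
    fix M N k k' assume N: "N \<in> Obj A" and k: "k \<in> hom_set A M (m N)" and k': "k' \<in> hom_set A M (m N)"
      and eq: "e N \<cdot>\<^bsub>A\<^esub> fa \<nu> k = e N \<cdot>\<^bsub>A\<^esub> fa \<nu> k'"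
    have M: "M \<in> Obj A" using k by auto
    obtain j where j: "inverse_arrows D (i N) j" using i_iso[OF N] by (auto simp: iso_arrow_def)
    have ji: "j \<cdot>\<^bsub>D\<^esub> i N = Ident D (fo U (m N))" and jt: "j \<in> Arr D" "Dom D j = fo R N"
      using inverse_arrowsD[OF j] N by simp_all
    have "T.phi (fo U M) (T.psi N (i N \<cdot>\<^bsub>D\<^esub> fa U k)) = T.phi (fo U M) (T.psi N (i N \<cdot>\<^bsub>D\<^esub> fa U k'))"
      using e_nu[OF N k] e_nu[OF N k'] eq by simp
    then have "i N \<cdot>\<^bsub>D\<^esub> fa U k = i N \<cdot>\<^bsub>D\<^esub> fa U k'" using M N k k' by simp
    then have "j \<cdot>\<^bsub>D\<^esub> (i N \<cdot>\<^bsub>D\<^esub> fa U k) = j \<cdot>\<^bsub>D\<^esub> (i N \<cdot>\<^bsub>D\<^esub> fa U k')" by simp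
    then have "fa U k = fa U k'" using M N k k' jt by (simp add: S.L.C.reassoc[OF ji])
    then show "k = k'" by (rule F.R_inject[rotated -1]) (use k k' in simp_all)
  qed (use e in simp_all)
  show thesis by (rule that[OF a, of i]) (simp_all add: m i_iso e_pi)
qed

text \<open>Transposing the triangle identity at \<open>S X\<close> shows that \<open>U\<close> of the unit at \<open>S X\<close> is \<open>\<gamma> X\<close>, up to the
  isomorphisms \<open>i\<close> and \<open>\<theta>\<close>; as \<open>U\<close> reflects isomorphisms, the unit is invertible there. The equation
  \<open>\<gamma>\<^sub>\<nu> = \<gamma>\<close> may be checked on the translations of \<open>\<beta>1 (S X)\<close>, from which both sides are recovered by
  transposition.\<close>

lemma nakayama_of_presentation:
  assumes gamma_iso: "\<And>X. X \<in> Obj D \<Longrightarrow> iso_arrow D (\<gamma> X)"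
    and t: "\<And>X. X \<in> Obj D \<Longrightarrow> \<theta> X \<in> hom_set A (fo \<nu> (fo S X)) (fo T X)"
    and t_pi: "\<And>X. X \<in> Obj D \<Longrightarrow> \<theta> X \<cdot>\<^bsub>A\<^esub> \<pi> (fo S X) = b X"
  shows "\<exists>\<nu>m l e. nakayama A D S U \<nu> \<nu>m l e \<and> nat_iso D A (\<nu> \<odot> S) T \<theta> \<and>
    trans_eq D (gamma_nu A D S U \<alpha>1 T R \<alpha>3 \<nu> \<nu>m l \<theta>) \<gamma>"
proof -
  have theta: "nat_iso D A (\<nu> \<odot> S) T \<theta>" by (rule theta_nat_iso[OF t t_pi])
  obtain \<nu>m l e i where adj: "adjunction A A \<nu> \<nu>m l e"
    and i: "\<And>N. N \<in> Obj A \<Longrightarrow> i N \<in> hom_set D (fo U (fo \<nu>m N)) (fo R N)"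
    and i_iso: "\<And>N. N \<in> Obj A \<Longrightarrow> iso_arrow D (i N)"
    and e_pi: "\<And>N. N \<in> Obj A \<Longrightarrow> e N \<cdot>\<^bsub>A\<^esub> \<pi> (fo \<nu>m N) = T.psi N (i N)"
    using ex_right_adjoint by blast
  interpret E: extended_functor D A S U \<alpha>1 \<beta>1 T R \<alpha>3 \<beta>3 \<nu> \<nu>m l e \<theta>
    by unfold_locales (use adj theta in simp_all)
  have [simp]: "i N \<in> Arr D" "Dom D (i N) = fo U (fo \<nu>m N)" "Cod D (i N) = fo R N" if "N \<in> Obj A" for N
    using i[OF that] by simp_all
  have l_iso: "iso_arrow A (l (fo S X))" if X: "X \<in> Obj D" for X
  proof -
    let ?N = "fo \<nu> (fo S X)" and ?l = "l (fo S X)"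
    have N: "?N \<in> Obj A" using X by simp
    \<comment> \<open>The transpose of \<open>\<pi> (S X)\<close> is \<open>U ?l\<close>, up to the isomorphism \<open>i ?N\<close>.\<close>
    have "T.psi ?N (i ?N \<cdot>\<^bsub>D\<^esub> fa U ?l) = T.psi ?N (i ?N) \<cdot>\<^bsub>A\<^esub> fa T (fa U ?l)"
      using X by (intro T.psi_pre) simp_all
    also have "\<dots> = e ?N \<cdot>\<^bsub>A\<^esub> (fa \<nu> ?l \<cdot>\<^bsub>A\<^esub> \<pi> (fo S X))"
      using X by (simp add: e_pi[symmetric] nu_pi')
    also have "\<dots> = \<pi> (fo S X)"
      using X by (simp add: S.L.D.reassoc[OF E.N.triangles(1)])
    finally have p: "T.psi ?N (i ?N \<cdot>\<^bsub>D\<^esub> fa U ?l) = \<pi> (fo S X)" .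
    have "fa R (\<theta> X) \<cdot>\<^bsub>D\<^esub> (i ?N \<cdot>\<^bsub>D\<^esub> fa U ?l)
        = fa R (\<theta> X) \<cdot>\<^bsub>D\<^esub> T.phi (fo U (fo S X)) (T.psi ?N (i ?N \<cdot>\<^bsub>D\<^esub> fa U ?l))"
      using X by simp
    also have "\<dots> = T.phi (fo U (fo S X)) (\<theta> X \<cdot>\<^bsub>A\<^esub> \<pi> (fo S X))"
      unfolding p using X by (intro T.phi_post[symmetric]) simp_all
    also have "\<dots> = \<gamma> X" using X by (simp add: t_pi phi_b)
    finally have q: "(fa R (\<theta> X) \<cdot>\<^bsub>D\<^esub> i ?N) \<cdot>\<^bsub>D\<^esub> fa U ?l = \<gamma> X" using X by simp
    let ?p = "fa R (\<theta> X) \<cdot>\<^bsub>D\<^esub> i ?N"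
    have "iso_arrow A (\<theta> X)" using theta X by (simp add: nat_iso_def)
    then have "iso_arrow D ?p" using X i_iso[OF N] by (intro S.L.C.iso_comp T.R.fa_iso) simp_all
    then obtain p' where p': "inverse_arrows D ?p p'" by (auto simp: iso_arrow_def)
    note p'D = inverse_arrowsD[OF p']
    have pt: "p' \<in> Arr D" "Dom D p' = fo R (fo T X)" "Cod D p' = fo U (fo \<nu>m ?N)"
      and pp: "p' \<cdot>\<^bsub>D\<^esub> ?p = Ident D (fo U (fo \<nu>m ?N))"
      using p'D(2-5) X by simp_all
    have "fa U ?l = (p' \<cdot>\<^bsub>D\<^esub> ?p) \<cdot>\<^bsub>D\<^esub> fa U ?l" unfolding pp using X by simp
    also have "\<dots> = p' \<cdot>\<^bsub>D\<^esub> (?p \<cdot>\<^bsub>D\<^esub> fa U ?l)" using X pt by simp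
    also have "\<dots> = p' \<cdot>\<^bsub>D\<^esub> \<gamma> X" by (simp only: q)
    finally have "fa U ?l = p' \<cdot>\<^bsub>D\<^esub> \<gamma> X" .
    moreover have "iso_arrow D p'" using p'D(7) by (auto simp: iso_arrow_def)
    ultimately have "iso_arrow D (fa U ?l)"
      using S.L.C.iso_comp[OF gamma_iso[OF X]] pt X by simp
    then show ?thesis using X by (intro F.R_reflects_iso) simp_all
  qed
  have "nat_iso D A S (\<nu>m \<odot> (\<nu> \<odot> S)) (\<lambda>X. l (fo S X))"
    unfolding nat_iso_def
  proof (intro conjI ballI l_iso nat_transI S.L.additive_functor_axioms
      additive_functor_comp[OF additive_functor_comp[OF S.L.additive_functor_axioms
          nu_functor] E.N.R.additive_functor_axioms])
    show "fa (\<nu>m \<odot> (\<nu> \<odot> S)) f \<cdot>\<^bsub>A\<^esub> l (fo S (Dom D f)) = l (fo S (Cod D f)) \<cdot>\<^bsub>A\<^esub> fa S f"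
      if "f \<in> Arr D" for f using E.N.unit_nat[of "fa S f"] that by simp
  qed simp_all
  then have nak: "nakayama A D S U \<nu> \<nu>m l e"
    unfolding nakayama_def using adj V.right_adjoint_transport[OF theta] by blast
  have "E.the_gamma X = \<gamma> X" if X: "X \<in> Obj D" for X
  proof -
    let ?Y = "fo U (fo S X)"
    have e1: "\<theta> X \<cdot>\<^bsub>A\<^esub> fa \<nu> (\<beta>1 (fo S X)) = b X \<cdot>\<^bsub>A\<^esub> \<theta> ?Y"
    proof (rule pi_epi[of "fo S ?Y"])
      show "(\<theta> X \<cdot>\<^bsub>A\<^esub> fa \<nu> (\<beta>1 (fo S X))) \<cdot>\<^bsub>A\<^esub> \<pi> (fo S ?Y) = (b X \<cdot>\<^bsub>A\<^esub> \<theta> ?Y) \<cdot>\<^bsub>A\<^esub> \<pi> (fo S ?Y)"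
        using X by (simp add: nu_pi' t_pi S.L.D.reassoc[OF t_pi] b_fork)
    qed (use X in simp_all)
    have "kl E.the_gamma ?Y X (\<beta>1 (fo S X)) = b X"
      using X by (simp add: E.kl_the_gamma S.L.D.reassoc[OF e1] E.theta_inverse)
    then have "T.phi ?Y (kl E.the_gamma ?Y X (\<beta>1 (fo S X))) = \<gamma> X" using X by (simp add: phi_b)
    then show ?thesis using X by (simp add: kl_def S.phi_counit)
  qed
  with nak theta show ?thesis unfolding trans_eq_def by blast
qed

end


section \<open>Monad isomorphisms and Nakayama functors\<close>

text \<open>Both \<open>\<nu>\<close> and \<open>\<nu>'\<close> act on the arrows between objects \<open>S X\<close> as the translation along the common
  monad morphism, so \<open>\<theta>'\<^sup>-\<^sup>1 \<cdot> \<theta>\<close> is natural for all these arrows and not just for those in the image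
  of \<open>S\<close>. Left adjoints preserve the coequalizers that present the objects of \<open>A\<close>, and hence this
  transformation extends to all of \<open>A\<close> in a unique way.\<close>

lemma (in two_adj) extended_functor_unique:
  fixes \<nu> \<nu>m l e \<theta> \<nu>' \<nu>m' l' e' \<theta>'
  assumes faithful: "faithful_adj D A S U \<alpha>1 \<beta>1"
    and E: "extended_functor D A S U \<alpha>1 \<beta>1 T R \<alpha>3 \<beta>3 \<nu> \<nu>m l e \<theta>"
    and E': "extended_functor D A S U \<alpha>1 \<beta>1 T R \<alpha>3 \<beta>3 \<nu>' \<nu>m' l' e' \<theta>'"
    and same: "trans_eq D (gamma_nu A D S U \<alpha>1 T R \<alpha>3 \<nu> \<nu>m l \<theta>)
      (gamma_nu A D S U \<alpha>1 T R \<alpha>3 \<nu>' \<nu>m' l' \<theta>')"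
  shows "\<exists>\<zeta>. (nat_iso A A \<nu> \<nu>' \<zeta> \<and> (\<forall>X\<in>Obj D. \<theta>' X \<cdot>\<^bsub>A\<^esub> \<zeta> (fo S X) = \<theta> X)) \<and>
    (\<forall>\<zeta>'. nat_iso A A \<nu> \<nu>' \<zeta>' \<and> (\<forall>X\<in>Obj D. \<theta>' X \<cdot>\<^bsub>A\<^esub> \<zeta>' (fo S X) = \<theta> X) \<longrightarrow> trans_eq A \<zeta>' \<zeta>)"
proof -
  interpret F: faithful_adj D A S U \<alpha>1 \<beta>1 by fact
  interpret E: extended_functor D A S U \<alpha>1 \<beta>1 T R \<alpha>3 \<beta>3 \<nu> \<nu>m l e \<theta> by fact
  interpret E': extended_functor D A S U \<alpha>1 \<beta>1 T R \<alpha>3 \<beta>3 \<nu>' \<nu>m' l' e' \<theta>' by fact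
  define w where "w X = E'.theta_inv X \<cdot>\<^bsub>A\<^esub> \<theta> X" for X
  have w: "w X \<in> hom_set A (fo \<nu> (fo S X)) (fo \<nu>' (fo S X))" if "X \<in> Obj D" for X
    using that by (simp add: w_def)
  have w_iso: "iso_arrow A (w X)" if X: "X \<in> Obj D" for X
  proof -
    have "iso_arrow A (\<theta> X)" "iso_arrow A (E'.theta_inv X)"
      using X E.theta E'.theta_inv_nat_iso by (simp_all add: nat_iso_def)
    then show ?thesis unfolding w_def using X by (intro S.L.D.iso_comp) simp_all
  qed
  have w_nat: "w Y \<cdot>\<^bsub>A\<^esub> fa \<nu> h = fa \<nu>' h \<cdot>\<^bsub>A\<^esub> w X"
    if X: "X \<in> Obj D" and Y: "Y \<in> Obj D" and h: "h \<in> hom_set A (fo S X) (fo S Y)" for X Y h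
  proof -
    have "kl E.the_gamma X Y h = kl E'.the_gamma X Y h"
      using same Y by (simp add: kl_def trans_eq_def)
    then have e: "\<theta> Y \<cdot>\<^bsub>A\<^esub> (fa \<nu> h \<cdot>\<^bsub>A\<^esub> E.theta_inv X)
        = \<theta>' Y \<cdot>\<^bsub>A\<^esub> (fa \<nu>' h \<cdot>\<^bsub>A\<^esub> E'.theta_inv X)"
      using X Y h by (simp add: E.kl_the_gamma E'.kl_the_gamma)
    have "w Y \<cdot>\<^bsub>A\<^esub> fa \<nu> h
        = E'.theta_inv Y \<cdot>\<^bsub>A\<^esub> (\<theta> Y \<cdot>\<^bsub>A\<^esub> (fa \<nu> h \<cdot>\<^bsub>A\<^esub> E.theta_inv X)) \<cdot>\<^bsub>A\<^esub> \<theta> X"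
      using X Y h by (simp add: w_def E.theta_inverse)
    also have "\<dots> = fa \<nu>' h \<cdot>\<^bsub>A\<^esub> w X"
      unfolding e using X Y h by (simp add: w_def S.L.D.reassoc[OF E'.theta_inverse(1)])
    finally show ?thesis .
  qed
  have pres: "coequalizer_of A (fa \<nu> (\<beta>1 M)) (fa \<nu> (\<beta>1 (fo S (fo U M))))
      (fa \<nu> (fa S (fa U (\<beta>1 M))))"
    and pres': "coequalizer_of A (fa \<nu>' (\<beta>1 M)) (fa \<nu>' (\<beta>1 (fo S (fo U M))))
      (fa \<nu>' (fa S (fa U (\<beta>1 M))))" if "M \<in> Obj A" for M
    by (intro E.N.left_adjoint_coequalizer E'.N.left_adjoint_coequalizer
        F.counit_coequalizer that)+
  obtain \<zeta> where \<zeta>: "nat_iso A A \<nu> \<nu>' \<zeta>" "\<And>X. X \<in> Obj D \<Longrightarrow> \<zeta> (fo S X) = w X"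
    using F.nat_iso_extension[OF E.N.L.additive_functor_axioms E'.N.L.additive_functor_axioms
        pres pres' w w_iso w_nat] by blast
  have restr: "\<theta>' X \<cdot>\<^bsub>A\<^esub> \<zeta>' (fo S X) = \<theta> X \<longleftrightarrow> \<zeta>' (fo S X) = w X"
    if X: "X \<in> Obj D" and nt: "nat_iso A A \<nu> \<nu>' \<zeta>'" for X \<zeta>'
  proof
    have t: "nat_trans A A \<nu> \<nu>' \<zeta>'" using nt by (simp add: nat_iso_def)
    note [simp] = nat_transD(1-3)[OF t]
    have "\<zeta>' (fo S X) = E'.theta_inv X \<cdot>\<^bsub>A\<^esub> (\<theta>' X \<cdot>\<^bsub>A\<^esub> \<zeta>' (fo S X))"
      using X by (simp add: S.L.D.reassoc[OF E'.theta_inverse(1)])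
    then show "\<zeta>' (fo S X) = w X" if "\<theta>' X \<cdot>\<^bsub>A\<^esub> \<zeta>' (fo S X) = \<theta> X"
      using that by (simp add: w_def)
    show "\<theta>' X \<cdot>\<^bsub>A\<^esub> \<zeta>' (fo S X) = \<theta> X" if "\<zeta>' (fo S X) = w X"
      using X that by (simp add: w_def S.L.D.reassoc[OF E'.theta_inverse(2)])
  qed
  show "\<exists>\<zeta>. (nat_iso A A \<nu> \<nu>' \<zeta> \<and> (\<forall>X\<in>Obj D. \<theta>' X \<cdot>\<^bsub>A\<^esub> \<zeta> (fo S X) = \<theta> X)) \<and>
      (\<forall>\<zeta>'. nat_iso A A \<nu> \<nu>' \<zeta>' \<and> (\<forall>X\<in>Obj D. \<theta>' X \<cdot>\<^bsub>A\<^esub> \<zeta>' (fo S X) = \<theta> X)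
        \<longrightarrow> trans_eq A \<zeta>' \<zeta>)"
  proof (intro exI[of _ \<zeta>] conjI allI impI ballI)
    fix \<zeta>' assume z': "nat_iso A A \<nu> \<nu>' \<zeta>' \<and> (\<forall>X\<in>Obj D. \<theta>' X \<cdot>\<^bsub>A\<^esub> \<zeta>' (fo S X) = \<theta> X)"
    have nt: "nat_trans A A \<nu> \<nu>' \<zeta>'" "nat_trans A A \<nu> \<nu>' \<zeta>"
      using z' \<zeta>(1) by (simp_all add: nat_iso_def)
    have "\<zeta>' (fo S X) = \<zeta> (fo S X)" if "X \<in> Obj D" for X
      using restr[OF that, of \<zeta>'] z' \<zeta>(2) that by simp
    then show "trans_eq A \<zeta>' \<zeta>"
      unfolding trans_eq_def using F.nat_trans_determined[OF nt pres] by blast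
  qed (use \<zeta> restr[of _ \<zeta>] in simp_all)
qed

theorem theorem3p3p3:
  fixes A :: "('o, 'a) cat" and D :: "('p, 'b) cat"
    and f_up :: "('o, 'a, 'p, 'b) func"
    and f_sh f_st :: "('p, 'b, 'o, 'a) func"
    and f_x :: "('o, 'a, 'p, 'b) func"
  assumes A: "abelian_category A" and D: "additive_category D"
    and f_up: "additive_functor A D f_up" and faith: "faithful A f_up"
    and adj1: "adjunction D A f_sh f_up \<alpha>1 \<beta>1"
    and adj2: "adjunction A D f_up f_st \<alpha>2 \<beta>2"
    and adj3: "adjunction D A f_st f_x \<alpha>3 \<beta>3"
  shows
    \<comment> \<open>(1), including that \<open>\<chi>\<close> is well defined and an isomorphism\<close>
    "(\<forall>\<nu> \<nu>m l e \<theta>.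
        nakayama A D f_sh f_up \<nu> \<nu>m l e \<and> nat_iso D A (\<nu> \<odot> f_sh) f_st \<theta> \<longrightarrow>
        chi_conjugate A D f_sh f_up \<alpha>1 f_st f_x \<alpha>3 \<nu> \<nu>m l \<theta>
          (chi A D f_sh f_up \<alpha>1 f_st f_x \<alpha>3 \<nu> \<nu>m l \<theta>) \<and>
        nat_iso A D (f_up \<odot> \<nu>m) f_x (chi A D f_sh f_up \<alpha>1 f_st f_x \<alpha>3 \<nu> \<nu>m l \<theta>) \<and>
        monad_iso D
          (f_up \<odot> f_sh) \<alpha>1 (\<lambda>X. fa f_up (\<beta>1 (fo f_sh X)))
          (f_x \<odot> f_st) \<alpha>3 (\<lambda>X. fa f_x (\<beta>3 (fo f_st X)))
          (gamma_nu A D f_sh f_up \<alpha>1 f_st f_x \<alpha>3 \<nu> \<nu>m l \<theta>))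
     \<and>
     (\<forall>\<gamma>. monad_iso D
          (f_up \<odot> f_sh) \<alpha>1 (\<lambda>X. fa f_up (\<beta>1 (fo f_sh X)))
          (f_x \<odot> f_st) \<alpha>3 (\<lambda>X. fa f_x (\<beta>3 (fo f_st X)))
          \<gamma> \<longrightarrow>
        \<comment> \<open>(2), existence, with \<open>\<nu> f\<^sub>!\<close> identified with \<open>f\<^sub>*\<close> by a natural isomorphism\<close>
        (\<exists>\<nu> \<nu>m l e \<theta>.
          nakayama A D f_sh f_up \<nu> \<nu>m l e \<and> nat_iso D A (\<nu> \<odot> f_sh) f_st \<theta> \<and>
          trans_eq D (gamma_nu A D f_sh f_up \<alpha>1 f_st f_x \<alpha>3 \<nu> \<nu>m l \<theta>) \<gamma>) \<and>
        \<comment> \<open>(2), existence, with \<open>\<nu> f\<^sub>!\<close> literally equal to \<open>f\<^sub>*\<close>, whenever that is not excluded by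
           two objects with the same image under \<open>f\<^sub>!\<close>\<close>
        ((\<forall>X\<in>Obj D. \<forall>Y\<in>Obj D. fo f_sh X = fo f_sh Y \<longrightarrow> fo f_st X = fo f_st Y \<and> \<gamma> X = \<gamma> Y) \<longrightarrow>
         (\<exists>\<nu> \<nu>m l e.
          nakayama A D f_sh f_up \<nu> \<nu>m l e \<and> func_eq D (\<nu> \<odot> f_sh) f_st \<and>
          trans_eq D (gamma_nu A D f_sh f_up \<alpha>1 f_st f_x \<alpha>3 \<nu> \<nu>m l (id_trans A f_st)) \<gamma>)) \<and>
        \<comment> \<open>(2), uniqueness; for literal equalities take \<open>\<theta> = \<theta>' = id_trans A f_st\<close>\<close>
        (\<forall>\<nu> \<nu>m l e \<theta> \<nu>' \<nu>m' l' e' \<theta>'.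
          nakayama A D f_sh f_up \<nu> \<nu>m l e \<and> nat_iso D A (\<nu> \<odot> f_sh) f_st \<theta> \<and>
          trans_eq D (gamma_nu A D f_sh f_up \<alpha>1 f_st f_x \<alpha>3 \<nu> \<nu>m l \<theta>) \<gamma> \<and>
          nakayama A D f_sh f_up \<nu>' \<nu>m' l' e' \<and> nat_iso D A (\<nu>' \<odot> f_sh) f_st \<theta>' \<and>
          trans_eq D (gamma_nu A D f_sh f_up \<alpha>1 f_st f_x \<alpha>3 \<nu>' \<nu>m' l' \<theta>') \<gamma> \<longrightarrow>
          (\<exists>\<zeta>. (nat_iso A A \<nu> \<nu>' \<zeta> \<and> (\<forall>X\<in>Obj D. \<theta>' X \<cdot>\<^bsub>A\<^esub> \<zeta> (fo f_sh X) = \<theta> X)) \<and>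
            (\<forall>\<zeta>'. nat_iso A A \<nu> \<nu>' \<zeta>' \<and> (\<forall>X\<in>Obj D. \<theta>' X \<cdot>\<^bsub>A\<^esub> \<zeta>' (fo f_sh X) = \<theta> X)
              \<longrightarrow> trans_eq A \<zeta>' \<zeta>))))"
proof (intro conjI allI impI)
  interpret S: adj D A f_sh f_up \<alpha>1 \<beta>1 by unfold_locales (rule adj1)
  interpret V: adj A D f_up f_st \<alpha>2 \<beta>2 by unfold_locales (rule adj2)
  interpret T: adj D A f_st f_x \<alpha>3 \<beta>3 by unfold_locales (rule adj3)
  interpret A: abelian_category A by (rule A)
  interpret F: faithful_adj D A f_sh f_up \<alpha>1 \<beta>1 by unfold_locales (rule faith)
  interpret two_adj D A f_sh f_up \<alpha>1 \<beta>1 f_st f_x \<alpha>3 \<beta>3 ..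
  let ?gamma = "gamma_nu A D f_sh f_up \<alpha>1 f_st f_x \<alpha>3"
  have extended: "extended_functor D A f_sh f_up \<alpha>1 \<beta>1 f_st f_x \<alpha>3 \<beta>3 \<nu> \<nu>m l e \<theta>"
    if "nakayama A D f_sh f_up \<nu> \<nu>m l e" "nat_iso D A (\<nu> \<odot> f_sh) f_st \<theta>" for \<nu> \<nu>m l e \<theta>
    by unfold_locales (use that in \<open>simp_all add: nakayama_def\<close>)
  {
    fix \<nu> \<nu>m l e \<theta>
    assume *: "nakayama A D f_sh f_up \<nu> \<nu>m l e \<and> nat_iso D A (\<nu> \<odot> f_sh) f_st \<theta>"
    then interpret E: extended_functor D A f_sh f_up \<alpha>1 \<beta>1 f_st f_x \<alpha>3 \<beta>3 \<nu> \<nu>m l e \<theta>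
      by (intro extended) simp_all
    show "chi_conjugate A D f_sh f_up \<alpha>1 f_st f_x \<alpha>3 \<nu> \<nu>m l \<theta>
        (chi A D f_sh f_up \<alpha>1 f_st f_x \<alpha>3 \<nu> \<nu>m l \<theta>)"
      by (rule E.chi_conjugate)
    show "nat_iso A D (f_up \<odot> \<nu>m) f_x (chi A D f_sh f_up \<alpha>1 f_st f_x \<alpha>3 \<nu> \<nu>m l \<theta>)"
      by (rule E.chi_nat_iso)
    show "monad_iso D (f_up \<odot> f_sh) \<alpha>1 (\<lambda>X. fa f_up (\<beta>1 (fo f_sh X)))
        (f_x \<odot> f_st) \<alpha>3 (\<lambda>X. fa f_x (\<beta>3 (fo f_st X))) (?gamma \<nu> \<nu>m l \<theta>)"
      by (rule E.the_gamma_monad_iso) (use * in \<open>simp add: nakayama_def nat_iso_def\<close>)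
  next
    fix \<gamma> assume \<gamma>: "monad_iso D (f_up \<odot> f_sh) \<alpha>1 (\<lambda>X. fa f_up (\<beta>1 (fo f_sh X)))
      (f_x \<odot> f_st) \<alpha>3 (\<lambda>X. fa f_x (\<beta>3 (fo f_st X))) \<gamma>"
    interpret K: kleisli_morphism D A f_sh f_up \<alpha>1 \<beta>1 f_st f_x \<alpha>3 \<beta>3 \<gamma>
      by unfold_locales (use \<gamma> in \<open>simp add: monad_iso_def\<close>)
    have \<gamma>_iso: "iso_arrow D (\<gamma> X)" if "X \<in> Obj D" for X
      by (rule monad_iso_component[OF \<gamma> that])
    let ?b = "\<lambda>X. kl \<gamma> (fo f_up (fo f_sh X)) X (\<beta>1 (fo f_sh X))"
    let ?coeq = "\<lambda>M p. coequalizer_of A p (?b (fo f_up M)) (fa f_st (fa f_up (\<beta>1 M)))"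
    have presentation: "presentation D A f_sh f_up \<alpha>1 \<beta>1 f_st f_x \<alpha>3 \<beta>3 \<gamma> \<alpha>2 \<beta>2 \<pi>"
      if "\<And>M. M \<in> Obj A \<Longrightarrow> ?coeq M (\<pi> M)" for \<pi>
      by unfold_locales (rule that)
    have "\<exists>\<pi>0. \<forall>M\<in>Obj A. ?coeq M (\<pi>0 M)"
      by (intro bchoice ballI A.ex_coequalizer) simp_all
    then obtain \<pi>0 where \<pi>0: "\<And>M. M \<in> Obj A \<Longrightarrow> ?coeq M (\<pi>0 M)" by blast
    interpret P: presentation D A f_sh f_up \<alpha>1 \<beta>1 f_st f_x \<alpha>3 \<beta>3 \<gamma> \<alpha>2 \<beta>2 \<pi>0
      by (rule presentation[OF \<pi>0])
    {
      have "\<exists>\<theta>. \<forall>X\<in>Obj D. \<theta> X \<in> hom_set A (fo P.\<nu> (fo f_sh X)) (fo f_st X) \<and>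
          \<theta> X \<cdot>\<^bsub>A\<^esub> \<pi>0 (fo f_sh X) = P.b X"
        using P.ex_theta by (intro bchoice) blast
      then obtain \<theta> where "\<And>X. X \<in> Obj D \<Longrightarrow> \<theta> X \<in> hom_set A (fo P.\<nu> (fo f_sh X)) (fo f_st X)"
          "\<And>X. X \<in> Obj D \<Longrightarrow> \<theta> X \<cdot>\<^bsub>A\<^esub> \<pi>0 (fo f_sh X) = P.b X" by blast
      from P.nakayama_of_presentation[OF \<gamma>_iso this]
      show "\<exists>\<nu> \<nu>m l e \<theta>. nakayama A D f_sh f_up \<nu> \<nu>m l e \<and> nat_iso D A (\<nu> \<odot> f_sh) f_st \<theta> \<and>
          trans_eq D (?gamma \<nu> \<nu>m l \<theta>) \<gamma>"
        by blast
    next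
      assume same: "\<forall>X\<in>Obj D. \<forall>Y\<in>Obj D. fo f_sh X = fo f_sh Y \<longrightarrow> fo f_st X = fo f_st Y \<and> \<gamma> X = \<gamma> Y"
      \<comment> \<open>Presenting \<open>f_sh X\<close> by the split coequalizer itself makes \<open>\<nu> f_sh X\<close> equal to \<open>f_st X\<close>.\<close>
      define \<pi> where "\<pi> M = (if \<exists>X\<in>Obj D. fo f_sh X = M
        then P.b (SOME X. X \<in> Obj D \<and> fo f_sh X = M) else \<pi>0 M)" for M
      have \<pi>_sh: "\<pi> (fo f_sh X) = P.b X" if X: "X \<in> Obj D" for X
      proof -
        define Y where "Y = (SOME Y. Y \<in> Obj D \<and> fo f_sh Y = fo f_sh X)"
        have Y: "Y \<in> Obj D \<and> fo f_sh Y = fo f_sh X"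
          unfolding Y_def by (rule someI[of _ X]) (simp add: X)
        then have "fo f_st Y = fo f_st X" "\<gamma> Y = \<gamma> X" using same X by blast+
        then have "P.b Y = P.b X" using X Y by (simp add: P.b_def kl_def)
        then show ?thesis using X by (auto simp: \<pi>_def Y_def)
      qed
      have \<pi>: "?coeq M (\<pi> M)" if M: "M \<in> Obj A" for M
      proof (cases "\<exists>X\<in>Obj D. fo f_sh X = M")
        case True
        then obtain X where X: "X \<in> Obj D" "fo f_sh X = M" by blast
        then show ?thesis using P.b_coequalizer[OF X(1)] \<pi>_sh[OF X(1)] by (simp add: P.b_def)
      next
        case False
        then have "\<pi> M = \<pi>0 M" unfolding \<pi>_def by simp
        then show ?thesis using \<pi>0[OF M] by simp
      qed
      interpret Q: presentation D A f_sh f_up \<alpha>1 \<beta>1 f_st f_x \<alpha>3 \<beta>3 \<gamma> \<alpha>2 \<beta>2 \<pi>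
        by (rule presentation[OF \<pi>])
      let ?\<theta> = "id_trans A f_st"
      have fo_eq: "fo Q.\<nu> (fo f_sh X) = fo f_st X" if "X \<in> Obj D" for X
        using that by (simp add: Q.fo_nu \<pi>_sh)
      have "\<exists>\<nu>m l e. nakayama A D f_sh f_up Q.\<nu> \<nu>m l e \<and> nat_iso D A (Q.\<nu> \<odot> f_sh) f_st ?\<theta> \<and>
          trans_eq D (?gamma Q.\<nu> \<nu>m l ?\<theta>) \<gamma>"
        by (rule Q.nakayama_of_presentation[OF \<gamma>_iso])
          (simp_all add: id_trans_def fo_eq \<pi>_sh P.b_def Q.b_def)
      then obtain \<nu>m l e where n: "nakayama A D f_sh f_up Q.\<nu> \<nu>m l e"
          "nat_iso D A (Q.\<nu> \<odot> f_sh) f_st ?\<theta>" "trans_eq D (?gamma Q.\<nu> \<nu>m l ?\<theta>) \<gamma>" by blast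
      have "nat_trans D A (Q.\<nu> \<odot> f_sh) f_st ?\<theta>" using n(2) by (simp add: nat_iso_def)
      from nat_transD(4)[OF this]
      have "fa f_st f = fa Q.\<nu> (fa f_sh f)" if "f \<in> Arr D" for f
        using that by (simp add: id_trans_def fo_eq)
      then have "func_eq D (Q.\<nu> \<odot> f_sh) f_st" by (simp add: func_eq_def fo_eq)
      with n(1,3) show "\<exists>\<nu> \<nu>m l e. nakayama A D f_sh f_up \<nu> \<nu>m l e \<and> func_eq D (\<nu> \<odot> f_sh) f_st \<and>
          trans_eq D (?gamma \<nu> \<nu>m l ?\<theta>) \<gamma>"
        by blast
    next
      fix \<nu> \<nu>m l e \<theta> \<nu>' \<nu>m' l' e' \<theta>'
      assume *: "nakayama A D f_sh f_up \<nu> \<nu>m l e \<and> nat_iso D A (\<nu> \<odot> f_sh) f_st \<theta> \<and>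
        trans_eq D (?gamma \<nu> \<nu>m l \<theta>) \<gamma> \<and>
        nakayama A D f_sh f_up \<nu>' \<nu>m' l' e' \<and> nat_iso D A (\<nu>' \<odot> f_sh) f_st \<theta>' \<and>
        trans_eq D (?gamma \<nu>' \<nu>m' l' \<theta>') \<gamma>"
      show "\<exists>\<zeta>. (nat_iso A A \<nu> \<nu>' \<zeta> \<and> (\<forall>X\<in>Obj D. \<theta>' X \<cdot>\<^bsub>A\<^esub> \<zeta> (fo f_sh X) = \<theta> X)) \<and>
          (\<forall>\<zeta>'. nat_iso A A \<nu> \<nu>' \<zeta>' \<and> (\<forall>X\<in>Obj D. \<theta>' X \<cdot>\<^bsub>A\<^esub> \<zeta>' (fo f_sh X) = \<theta> X)
            \<longrightarrow> trans_eq A \<zeta>' \<zeta>)"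
        by (rule extended_functor_unique[OF F.faithful_adj_axioms])
          (use * in \<open>auto intro: extended simp: trans_eq_def\<close>)
    }
  }
qed


end
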